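(* Let $F:\mathbb{R}^n\to\mathbb{R}^n$ be a $C^2$-smooth vector field and let $\Phi_t$ be the flow on $\mathbb{R}^n$ generated by the system $\dot x=F(x)$. Let $Q$ be a constant real symmetric non-singular $n\times n$ matrix with $2$ negative eigenvalues and $n-2$ positive eigenvalues (counted with multiplicity), and let $\lambda:\mathbb{R}^n\to\mathbb{R}$ be a continuous function such that $$Q\cdot DF(x)+(DF(x))^{\ast}\cdot Q+\lambda(x)Q<0\quad\text{for all }x\in\mathbb{R}^n.$$ Assume that the system $\dot x=F(x)$ is dissipative. Then, for Lebesgue-almost every point $x\in\mathbb{R}^n$, if the $\omega$-limit set $\omega(x)$ contains no equilibrium, then $\omega(x)$ is a periodic orbit.
   Context: $(DF(x))^{\ast}$ is the transpose of the Jacobian $DF(x)$, and $M<0$ for a symmetric matrix $M$ means that $M$ is negative definite. The system is assumed to generate a flow $\Phi:\mathbb{R}\times\mathbb{R}^n\to\mathbb{R}^n$ (solutions exist for all time). $\omega(x)=\bigcap_{s\ge0}\overline{\bigcup_{t\ge s}\{\Phi_t(x)\}}$; an equilibrium is a point $x$ with $\Phi_t(x)=x$ for all $t$ (i.e. $F(x)=0$). Dissipative: there is a bounded set $\Lambda\subset\mathbb{R}^n$ such that for each $x\in\mathbb{R}^n$ there exists $t_0>0$ with $\Phi_t(x)\in\Lambda$ for all $t\ge t_0$. *)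

theory Defs
  imports "HOL-Analysis.Analysis" "HOL-Computational_Algebra.Polynomial"
begin

definition C2_smooth :: "('a::real_normed_vector \<Rightarrow> 'b::real_normed_vector) \<Rightarrow> bool" where
  "C2_smooth f \<longleftrightarrow>
     (\<exists>(f' :: 'a \<Rightarrow> 'a \<Rightarrow>\<^sub>L 'b) (f'' :: 'a \<Rightarrow> 'a \<Rightarrow>\<^sub>L ('a \<Rightarrow>\<^sub>L 'b)).
        (\<forall>x. (f has_derivative blinfun_apply (f' x)) (at x)) \<and>
        (\<forall>x. (f' has_derivative blinfun_apply (f'' x)) (at x)) \<and>
        continuous_on UNIV f'')"

(* The group law of \<Phi> and its joint continuity are not listed: they follow
   from uniqueness of solutions when F is locally Lipschitz. *)
definition flow_of :: "('a::real_normed_vector \<Rightarrow> 'a) \<Rightarrow> (real \<Rightarrow> 'a \<Rightarrow> 'a) \<Rightarrow> bool" where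
  "flow_of F \<Phi> \<longleftrightarrow>
     (\<forall>x. \<Phi> 0 x = x \<and>
          (\<forall>t. ((\<lambda>s. \<Phi> s x) has_vector_derivative F (\<Phi> t x)) (at t)))"

definition omega_limit :: "(real \<Rightarrow> 'a::topological_space \<Rightarrow> 'a) \<Rightarrow> 'a \<Rightarrow> 'a set" where
  "omega_limit \<Phi> x = (\<Inter>s\<in>{0..}. closure (\<Union>t\<in>{s..}. {\<Phi> t x}))"

definition equilibrium :: "(real \<Rightarrow> 'a \<Rightarrow> 'a) \<Rightarrow> 'a \<Rightarrow> bool" where
  "equilibrium \<Phi> x \<longleftrightarrow> (\<forall>t. \<Phi> t x = x)"

definition periodic_orbit :: "(real \<Rightarrow> 'a \<Rightarrow> 'a) \<Rightarrow> 'a set \<Rightarrow> bool" where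
  "periodic_orbit \<Phi> S \<longleftrightarrow>
     (\<exists>p T. T > 0 \<and> \<Phi> T p = p \<and> \<not> equilibrium \<Phi> p \<and> S = range (\<lambda>t. \<Phi> t p))"

definition dissipative :: "(real \<Rightarrow> 'a::metric_space \<Rightarrow> 'a) \<Rightarrow> bool" where
  "dissipative \<Phi> \<longleftrightarrow>
     (\<exists>\<Lambda>. bounded \<Lambda> \<and> (\<forall>x. \<exists>t0>0. \<forall>t\<ge>t0. \<Phi> t x \<in> \<Lambda>))"

definition symmetric_matrix :: "real ^ 'n ^ 'n \<Rightarrow> bool" where
  "symmetric_matrix A \<longleftrightarrow> transpose A = A"

definition negative_definite :: "real ^ 'n ^ 'n \<Rightarrow> bool" where
  "negative_definite A \<longleftrightarrow> symmetric_matrix A \<and> (\<forall>v. v \<noteq> 0 \<longrightarrow> v \<bullet> (A *v v) < 0)"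

(* det (X I - A), a determinant over the ring of polynomials *)
definition charpoly :: "real ^ 'n ^ 'n \<Rightarrow> real poly" where
  "charpoly A = det (mat [:0, 1:] - (\<chi> i j. [:A $ i $ j:]))"

(* the multiset of real eigenvalues, each with its algebraic multiplicity *)
definition eigenvalues :: "real ^ 'n ^ 'n \<Rightarrow> real multiset" where
  "eigenvalues A = proots (charpoly A)"

end

theory Submission
  imports Defs
begin

text \<open>
  Write \<open>V w = w \<bullet> Q w\<close>. Along the difference of two solutions \<open>V\<close> strictly decreases whenever
  it vanishes, so once \<open>V \<le> 0\<close> the difference \<open>w\<close> stays inside the cone \<open>V < 0\<close>, where it is controlled by
  its projection \<open>\<pi> w\<close> to the plane of negative directions: \<open>\<bar>w\<bar> \<le> C \<bar>\<pi> w\<bar>\<close>.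

  If the velocity \<open>F\<close> stays outside the cone along a bounded orbit and away from zero, then the weight
  \<open>exp (\<integral> lam)\<close> decays exponentially, hence vectors inside the cone are expanded without bound. For
  two such orbits starting on a common plane of negative directions, \<open>\<pi> \<circ> \<Phi>\<^sub>t\<close> is injective and
  uniformly expanding with bounded image; a packing argument shows that such points form a null
  set on each plane, hence a null set in space.

  If the velocity enters the cone, consider the shifts \<open>s\<close> for which \<open>X (t + s) - X t\<close> never
  enters the cone. If there is one, the least one is a period of every point of the limit set, and
  \<open>X (t + s) - X t\<close> decays exponentially, so the limit set is one periodic orbit. If there is none,
  each orbit in the limit set projects injectively to the plane; a recurrent one is periodic by a
  Jordan curve argument. A periodic orbit \<open>\<gamma>\<close> in the limit set then is the whole limit set: either some
  \<open>X t - \<Phi>\<^sub>t l\<close> with \<open>l \<in> \<gamma>\<close> stays outside the cone and decays, or \<open>X\<close> is ordered with \<open>\<gamma>\<close> and its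
  successive returns to a section are monotone in the projection.
\<close>

section \<open>Quadratic forms with two negative eigenvalues\<close>

text \<open>One computation drives both halves. Let \<open>E\<close> be the weight
  \<open>exp (\<integral> lam)\<close> along an orbit, times \<open>exp (c * t)\<close> with small
  \<open>c\<close>. Then \<open>E * V w\<close> has slope at most
  \<open>- \<epsilon> * E * (norm w)\<^sup>2\<close>, both for the velocity \<open>w = F X\<close>
  and for a short difference \<open>w\<close> of two solutions. If \<open>w\<close> stays outside
  the cone, the product stays nonnegative, so the integral of \<open>E * (norm w)\<^sup>2\<close> is
  bounded. For a velocity bounded away from zero this makes the weight decay, and a difference whose
  product starts negative is driven to large negative \<open>V\<close>. Conversely, a velocity
  inside the cone bounds the weight from below, and then differences outside the cone must shrink.
  The sign of \<open>lam\<close> is unknown throughout; it is the comparison of velocity and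
  difference along the same orbit that fixes the rates.

  The obstacle in the limit set is that only time shifts of one orbit inherit an order. Points of
  different orbits there are not known to be ordered, so the limit set does not project to a planar
  flow. The Jordan curve argument is therefore run on a single orbit, and the rest of the limit set
  is reached through \<open>X\<close> itself.\<close>

lemma self_adjoint_eigenbasis:
  fixes f :: "'a::euclidean_space \<Rightarrow> 'a"
  assumes lin: "linear f" and sa: "\<And>x y. f x \<bullet> y = x \<bullet> f y"
    and S: "subspace S" "\<And>x. x \<in> S \<Longrightarrow> f x \<in> S"
  shows "\<exists>B. finite B \<and> B \<subseteq> S \<and> pairwise orthogonal B \<and> S \<subseteq> span B \<and>
           (\<forall>b\<in>B. norm b = 1 \<and> (\<exists>c. f b = c *\<^sub>R b))"
  using S
proof (induction "dim S" arbitrary: S rule: less_induct)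
  case less
  show ?case
  proof (cases "S \<subseteq> {0}")
    case True
    then show ?thesis by (intro exI[of _ "{}"]) auto
  next
    case False
    then obtain x0 where x0: "x0 \<in> S" "x0 \<noteq> 0" by auto
    \<comment> \<open>A maximiser of \<open>x \<bullet> f x\<close> on the unit sphere of
      \<open>S\<close> will be an eigenvector; self-adjointness then makes its orthogonal complement
      in \<open>S\<close> invariant, and the induction on the dimension continues there.\<close>
    define K where "K = S \<inter> sphere 0 1"
    have "compact K" unfolding K_def
      using closed_subspace[OF less.prems(1)] by (intro closed_Int_compact) auto
    moreover have "x0 /\<^sub>R norm x0 \<in> K"
      using x0 less.prems(1) by (auto simp: K_def subspace_scale)
    moreover have "continuous_on K (\<lambda>x. x \<bullet> f x)"
      by (intro continuous_intros linear_continuous_on linear_conv_bounded_linear[THEN iffD1] lin)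
    ultimately obtain v where v: "v \<in> K" "\<And>y. y \<in> K \<Longrightarrow> y \<bullet> f y \<le> v \<bullet> f v"
      using continuous_attains_sup[of K "\<lambda>x. x \<bullet> f x"] by blast
    define m where "m = v \<bullet> f v"
    have vS: "v \<in> S" and nv: "norm v = 1" using v by (auto simp: K_def)
    have vv: "v \<bullet> v = 1" using nv by (simp add: dot_square_norm)
    define g where "g = (\<lambda>x. m * (x \<bullet> x) - x \<bullet> f x)"
    have g0: "g x \<ge> 0" if "x \<in> S" for x
    proof (cases "x = 0")
      case True then show ?thesis by (simp add: g_def linear_0[OF lin])
    next
      case False
      then have "x /\<^sub>R norm x \<in> K" using that less.prems(1) by (auto simp: K_def subspace_scale)
      then have "(x /\<^sub>R norm x) \<bullet> f (x /\<^sub>R norm x) \<le> m" unfolding m_def by (rule v(2))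
      then have "(x \<bullet> f x) / (norm x)^2 \<le> m"
        by (simp add: linear_scale[OF lin] power2_eq_square divide_inverse mult_ac)
      then have "x \<bullet> f x \<le> m * (norm x)^2" using False by (simp add: pos_divide_le_eq)
      then show ?thesis by (simp add: g_def dot_square_norm)
    qed
    \<comment> \<open>\<open>u\<close> measures the failure of \<open>v\<close> to be an
      eigenvector. The form \<open>g\<close> is nonnegative on \<open>S\<close> and vanishes at
      \<open>v\<close>, so its first-order term along \<open>u\<close>, which is
      \<open>2 * t * (u \<bullet> u)\<close>, has to vanish.\<close>
    define u where "u = m *\<^sub>R v - f v"
    have uS: "u \<in> S" using vS less.prems by (auto simp: u_def subspace_diff subspace_scale)
    have gexp: "g (v + t *\<^sub>R u) = 2 * t * (u \<bullet> u) + t^2 * g u" for t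
    proof -
      have "g (v + t *\<^sub>R u) = g v + 2 * t * (m * (v \<bullet> u) - f v \<bullet> u) + t^2 * g u"
        using sa[of v u] by (simp add: g_def linear_add[OF lin] linear_scale[OF lin] inner_add_left
          inner_add_right inner_commute power2_eq_square algebra_simps)
      moreover have "g v = 0" by (simp add: g_def m_def vv)
      moreover have "m * (v \<bullet> u) - f v \<bullet> u = u \<bullet> u"
        using inner_commute[of v "f v"] by (simp add: u_def inner_diff_left inner_diff_right)
      ultimately show ?thesis by simp
    qed
    have "u \<bullet> u \<le> 0"
    proof (rule ccontr)
      assume "\<not> u \<bullet> u \<le> 0"
      then have pos: "u \<bullet> u > 0" by linarith
      \<comment> \<open>A negative \<open>t\<close> this small keeps \<open>t * g u\<close> above
        \<open>- (u \<bullet> u)\<close>, so the linear term wins and \<open>g\<close> would become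
        negative. The \<open>+ 1\<close> guards against \<open>g u = 0\<close>.\<close>
      define t where "t = - (u \<bullet> u) / (g u + 1)"
      have gu: "g u \<ge> 0" using g0 uS by blast
      have "g (v + t *\<^sub>R u) \<ge> 0"
        using vS uS less.prems(1) by (intro g0) (simp add: subspace_add subspace_scale)
      then have "0 \<le> t * (2 * (u \<bullet> u) + t * g u)"
        by (simp add: gexp power2_eq_square algebra_simps)
      moreover have "t < 0" using pos gu by (simp add: t_def)
      ultimately have "2 * (u \<bullet> u) + t * g u \<le> 0" by (simp add: zero_le_mult_iff)
      moreover have "t * g u \<ge> - (u \<bullet> u)"
        using pos gu by (simp add: t_def field_simps)
      ultimately show False using pos by simp
    qed
    then have "u \<bullet> u = 0" using inner_ge_zero[of u] by linarith
    then have "u = 0" by simp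
    then have fv: "f v = m *\<^sub>R v" unfolding u_def by simp
    define S' where "S' = S \<inter> {x. v \<bullet> x = 0}"
    have sS': "subspace S'" unfolding S'_def
      using less.prems(1) subspace_hyperplane by (rule subspace_inter)
    have "v \<notin> S'" using vv by (simp add: S'_def)
    moreover have "S' \<subseteq> S" by (auto simp: S'_def)
    ultimately have "S' \<subset> S" using vS by blast
    then have "dim S' < dim S"
      using sS' less.prems(1) dim_psubset[of S' S] by (metis span_eq_iff)
    moreover have "f x \<in> S'" if "x \<in> S'" for x
    proof -
      have "v \<bullet> f x = m * (v \<bullet> x)" using sa[of v x] fv by simp
      then show ?thesis using that less.prems(2) by (simp add: S'_def)
    qed
    ultimately obtain B where B: "finite B" "B \<subseteq> S'" "pairwise orthogonal B" "S' \<subseteq> span B"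
        "\<forall>b\<in>B. norm b = 1 \<and> (\<exists>c. f b = c *\<^sub>R b)"
      using less.hyps[of S'] sS' by metis
    have "S \<subseteq> span (insert v B)"
    proof
      fix x assume "x \<in> S"
      then have "x - (v \<bullet> x) *\<^sub>R v \<in> S'"
        using vS less.prems(1) by (simp add: S'_def subspace_diff subspace_scale inner_diff_right vv)
      then have "x - (v \<bullet> x) *\<^sub>R v \<in> span B" using B(4) by blast
      then show "x \<in> span (insert v B)" unfolding span_insert by blast
    qed
    moreover have "pairwise orthogonal (insert v B)"
      using B(2,3) by (auto simp: pairwise_insert orthogonal_def S'_def inner_commute)
    ultimately show ?thesis
      using B vS nv fv by (intro exI[of _ "insert v B"]) (auto simp: S'_def)
  qed
qed

section \<open>Characteristic polynomials and eigenvalue counts of symmetric matrices\<close>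

lemma const_matrix_mult:
  fixes A B :: "real ^ 'n ^ 'n"
  shows "(\<chi> i j. [:A $ i $ j:]) ** (\<chi> i j. [:B $ i $ j:]) = (\<chi> i j. [:(A ** B) $ i $ j:])"
proof -
  have "(\<Sum>k\<in>K. [:a k:]) = [:\<Sum>k\<in>K. a k:]" if "finite K" for a :: "'n \<Rightarrow> real" and K
    using that by induction auto
  then show ?thesis by (simp add: matrix_matrix_mult_def vec_eq_iff mult.commute)
qed

text \<open>No inverse is formed over the polynomial ring. Determinants are taken of the commutation
  relation and \<open>det (c P)\<close> is cancelled; it is nonzero because orthogonality of
  \<open>P\<close> makes it a unit.\<close>

lemma charpoly_conjugate:
  fixes Q P D :: "real ^ 'n ^ 'n"
  assumes QP: "Q ** P = P ** D" and PP: "transpose P ** P = mat 1"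
  shows "charpoly Q = charpoly D"
proof -
  define c where "c = (\<lambda>A :: real ^ 'n ^ 'n. (\<chi> i j. [:A $ i $ j:]))"
  define X where "X = (mat [:0, 1:] :: real poly ^ 'n ^ 'n)"
  have XA: "X ** A = A ** X" for A
    by (simp add: X_def matrix_matrix_mult_def mat_def vec_eq_iff if_distrib if_distribR
        sum.delta sum.delta' mult.commute cong: if_cong)
  have dl: "(A - B) ** E = A ** E - B ** E" and dr: "E ** (A - B) = E ** A - E ** B"
    for A B E :: "real poly ^ 'n ^ 'n"
    by (simp_all add: matrix_matrix_mult_def vec_eq_iff left_diff_distrib right_diff_distrib sum_subtractf)
  have "c Q ** c P = c P ** c D"
    using QP const_matrix_mult[of Q P] const_matrix_mult[of P D] by (simp add: c_def)
  then have "(X - c Q) ** c P = c P ** (X - c D)"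
    by (simp add: dl dr XA)
  then have "det (X - c Q) * det (c P) = det (X - c D) * det (c P)"
    by (metis det_mul mult.commute)
  moreover have "det (c P) \<noteq> 0"
  proof
    assume z: "det (c P) = 0"
    have "c (transpose P) ** c P = mat 1"
      using const_matrix_mult[of "transpose P" P]
      by (simp add: c_def PP mat_def vec_eq_iff one_pCons)
    then have "det (c (transpose P)) * det (c P) = 1" by (metis det_mul det_I)
    then show False using z by simp
  qed
  ultimately show ?thesis by (simp add: charpoly_def c_def X_def)
qed

lemma charpoly_diagonal:
  fixes d :: "'n::finite \<Rightarrow> real"
  shows "charpoly (\<chi> i j. if i = j then d i else 0) = (\<Prod>i\<in>UNIV. [:- d i, 1:])"
  unfolding charpoly_def by (subst det_diagonal) (auto simp: mat_def)

text \<open>The last clause is the bridge from algebra to geometry: counting roots of the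
  characteristic polynomial becomes counting diagonal entries. The basis is indexed by
  \<open>'n\<close> so that the matrix with columns \<open>e j\<close> is square and conjugates
  \<open>Q\<close> to a diagonal matrix.\<close>

lemma symmetric_matrix_eigenbasis:
  fixes Q :: "real ^ 'n ^ 'n"
  assumes "symmetric_matrix Q"
  shows "\<exists>(e :: 'n \<Rightarrow> real ^ 'n) d.
    (\<forall>i. Q *v e i = d i *\<^sub>R e i) \<and> (\<forall>i j. e i \<bullet> e j = (if i = j then 1 else 0)) \<and>
    (\<forall>w. (\<Sum>i\<in>UNIV. (w \<bullet> e i) *\<^sub>R e i) = w) \<and>
    (\<forall>P. size (filter_mset P (eigenvalues Q)) = card {i. P (d i)})"
proof -
  have sa: "(Q *v x) \<bullet> y = x \<bullet> (Q *v y)" for x y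
    using assms by (metis dot_lmul_matrix inner_commute symmetric_matrix_def transpose_matrix_vector)
  obtain B where B: "finite B" "pairwise orthogonal B" "UNIV \<subseteq> span B"
      "\<And>b. b \<in> B \<Longrightarrow> norm b = 1" "\<And>b. b \<in> B \<Longrightarrow> \<exists>c. Q *v b = c *\<^sub>R b"
    using self_adjoint_eigenbasis[OF matrix_vector_mul_linear, of Q UNIV] sa by auto
  have ind: "independent B"
  proof (rule pairwise_orthogonal_independent[OF B(2)])
    show "0 \<notin> B" using B(4)[of 0] by auto
  qed
  have "span B = UNIV" using B(3) by blast
  then have "card B = DIM(real ^ 'n)"
    using dim_span_eq_card_independent[OF ind] by simp
  then have "card B = card (UNIV :: 'n set)" by simp
  then obtain e where e: "bij_betw e (UNIV :: 'n set) B"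
    using finite_same_card_bij[of "UNIV :: 'n set" B] B(1) by auto
  have eB: "e i \<in> B" for i using e by (auto simp: bij_betw_def)
  have einj: "e i = e j \<longleftrightarrow> i = j" for i j using e by (auto simp: bij_betw_def inj_eq)
  have "\<forall>i. \<exists>c. Q *v e i = c *\<^sub>R e i" using B(5) eB by blast
  from choice[OF this] obtain d where d: "\<And>i. Q *v e i = d i *\<^sub>R e i" by blast
  have on: "e i \<bullet> e j = (if i = j then 1 else 0)" for i j
  proof (cases "i = j")
    case True then show ?thesis using B(4)[OF eB[of i]] by (simp add: dot_square_norm)
  next
    case False
    then show ?thesis using B(2) eB[of i] eB[of j] einj[of i j]
      by (auto simp: pairwise_def orthogonal_def)
  qed
  have ex: "(\<Sum>i\<in>UNIV. (w \<bullet> e i) *\<^sub>R e i) = w" for w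
  proof -
    have "(\<Sum>b\<in>B. (w \<bullet> b) *\<^sub>R b) = w"
      using B by (intro orthonormal_basis_expand) auto
    then show ?thesis using sum.reindex_bij_betw[OF e, of "\<lambda>b. (w \<bullet> b) *\<^sub>R b"] by simp
  qed
  define P where "P = (\<chi> i j. e j $ i)"
  define D where "D = (\<chi> i j. if i = j then d i else 0)"
  have "transpose P ** P = mat 1"
    using on by (simp add: P_def transpose_def matrix_matrix_mult_def mat_def vec_eq_iff inner_vec_def)
  moreover have "Q ** P = P ** D"
  proof -
    have "(Q ** P) $ i $ j = (P ** D) $ i $ j" for i j
    proof -
      have "(Q ** P) $ i $ j = (Q *v e j) $ i"
        by (simp add: matrix_matrix_mult_def P_def matrix_vector_mult_def)
      also have "\<dots> = e j $ i * d j" using d[of j] by simp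
      also have "\<dots> = (P ** D) $ i $ j"
        by (simp add: matrix_matrix_mult_def P_def D_def if_distrib cong: if_cong)
      finally show ?thesis .
    qed
    then show ?thesis by (simp add: vec_eq_iff)
  qed
  ultimately have "charpoly Q = charpoly D" by (intro charpoly_conjugate)
  then have cp: "charpoly Q = (\<Prod>i\<in>UNIV. [:- d i, 1:])"
    by (simp add: D_def charpoly_diagonal)
  have "size (filter_mset R (eigenvalues Q)) = card {i. R (d i)}" for R
  proof -
    have "eigenvalues Q = (\<Sum>i\<in>UNIV. {#d i#})"
      unfolding eigenvalues_def cp by (subst proots_prod) auto
    moreover have "size (filter_mset R (\<Sum>i\<in>A. {#d i#})) = card {i\<in>A. R (d i)}" if "finite A" for A
      using that
    proof induction
      case (insert x A)
      have "{i \<in> insert x A. R (d i)} = (if R (d x) then insert x {i\<in>A. R (d i)} else {i\<in>A. R (d i)})"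
        by auto
      then show ?case using insert by simp
    qed simp
    ultimately show ?thesis by simp
  qed
  then show ?thesis using d on ex by blast
qed

text \<open>The plane is modelled by \<open>complex\<close>, so that multiplication by
  \<open>cnj v\<close> gives coordinates along and across a direction \<open>v\<close>. The scaling
  of \<open>\<pi>\<close> makes \<open>(norm (\<pi> w))\<^sup>2\<close> exactly the size of the
  negative part of the form. When the form is nonpositive this also bounds its positive part, hence
  the whole vector. \<open>\<iota>\<close> lands on the plane of negative eigenvectors with the
  matching scale.\<close>

lemma rank_two_splitting:
  fixes Q :: "real ^ 'n ^ 'n"
  assumes sym: "symmetric_matrix Q"
    and neg: "size {# \<mu> \<in># eigenvalues Q. \<mu> < 0 #} = 2"
    and pos: "size {# \<mu> \<in># eigenvalues Q. \<mu> > 0 #} + 2 = CARD('n)"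
  obtains \<pi> :: "real ^ 'n \<Rightarrow> complex" and \<iota> :: "complex \<Rightarrow> real ^ 'n" and C :: real
  where "linear \<pi>" "linear \<iota>" "C > 0" "\<And>w. w \<bullet> (Q *v w) \<le> 0 \<Longrightarrow> norm w \<le> C * norm (\<pi> w)"
    "\<And>u. \<iota> u \<bullet> (Q *v \<iota> u) = - (norm u)\<^sup>2"
proof -
  obtain e :: "'n \<Rightarrow> real ^ 'n" and d where
    e: "\<And>i. Q *v e i = d i *\<^sub>R e i" "\<And>i j. e i \<bullet> e j = (if i = j then 1 else 0)"
    "\<And>w. (\<Sum>i\<in>UNIV. (w \<bullet> e i) *\<^sub>R e i) = w"
    "\<And>P. size (filter_mset P (eigenvalues Q)) = card {i. P (d i)}"
    using symmetric_matrix_eigenbasis[OF sym] by blast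
  have "card {i. d i < 0} = 2" using neg e(4)[of "\<lambda>\<mu>. \<mu> < 0"] by simp
  then obtain i1 i2 where i12: "{i. d i < 0} = {i1, i2}" "i1 \<noteq> i2" by (auto simp: card_2_iff)
  have "card {i. d i > 0} + card {i. d i < 0} = CARD('n)"
    using neg pos e(4)[of "\<lambda>\<mu>. \<mu> < 0"] e(4)[of "\<lambda>\<mu>. \<mu> > 0"] by simp
  moreover have "card ({i. d i > 0} \<union> {i. d i < 0}) = card {i. d i > 0} + card {i. d i < 0}"
    by (rule card_Un_disjoint) auto
  ultimately have "{i. d i > 0} \<union> {i. d i < 0} = UNIV"
    by (metis card_subset_eq finite subset_UNIV)
  then have "i \<in> {i. d i > 0} \<union> {i. d i < 0}" for i by blast
  then have dnz: "d i \<noteq> 0" for i by (auto simp: less_le)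
  define s1 where "s1 = sqrt (- d i1)"
  define s2 where "s2 = sqrt (- d i2)"
  have dn: "d i1 < 0" "d i2 < 0" using i12 by blast+
  then have s: "s1 > 0" "s2 > 0" "s1^2 = - d i1" "s2^2 = - d i2" by (auto simp: s1_def s2_def)
  have dpos: "d i > 0" if "i \<noteq> i1" "i \<noteq> i2" for i
    using that i12 dnz[of i] by (metis (mono_tags) insertE linorder_neqE mem_Collect_eq singletonD)
  define \<pi> where "\<pi> = (\<lambda>w. Complex (s1 * (w \<bullet> e i1)) (s2 * (w \<bullet> e i2)))"
  define \<iota> where "\<iota> = (\<lambda>u. (Re u / s1) *\<^sub>R e i1 + (Im u / s2) *\<^sub>R e i2)"
  have Qw: "Q *v w = (\<Sum>i\<in>UNIV. (w \<bullet> e i) *\<^sub>R d i *\<^sub>R e i)" for w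
  proof -
    have "Q *v w = Q *v (\<Sum>i\<in>UNIV. (w \<bullet> e i) *\<^sub>R e i)" by (simp only: e(3))
    also have "\<dots> = (\<Sum>i\<in>UNIV. (w \<bullet> e i) *\<^sub>R (Q *v e i))"
      by (simp add: linear_sum linear_scale)
    finally show ?thesis by (simp add: e(1))
  qed
  have V: "w \<bullet> (Q *v w) = (\<Sum>i\<in>UNIV. d i * (w \<bullet> e i)^2)" for w
    by (simp add: Qw inner_sum_right power2_eq_square mult_ac)
  have N: "(norm w)^2 = (\<Sum>i\<in>UNIV. (w \<bullet> e i)^2)" for w
  proof -
    have "(norm w)^2 = w \<bullet> (\<Sum>i\<in>UNIV. (w \<bullet> e i) *\<^sub>R e i)"
      by (simp only: e(3) dot_square_norm)
    then show ?thesis by (simp add: inner_sum_right power2_eq_square)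
  qed
  have npi: "(norm (\<pi> w))^2 = - d i1 * (w \<bullet> e i1)^2 - d i2 * (w \<bullet> e i2)^2" for w
    by (simp add: \<pi>_def cmod_power2 power_mult_distrib s)
  have split: "(\<Sum>i\<in>UNIV. h i) = h i1 + h i2 + (\<Sum>i\<in>UNIV - {i1,i2}. h i)" for h :: "'n \<Rightarrow> real"
  proof -
    have "(\<Sum>i\<in>UNIV. h i) = (\<Sum>i\<in>{i1,i2}. h i) + (\<Sum>i\<in>UNIV - {i1,i2}. h i)"
      by (metis (no_types) finite subset_UNIV sum.subset_diff add.commute)
    then show ?thesis using i12(2) by simp
  qed
  \<comment> \<open>Negative and positive part together have size at least
    \<open>m * (norm w)\<^sup>2\<close> and, for a nonpositive form, at most
    \<open>2 * (norm (\<pi> w))\<^sup>2\<close>; hence \<open>2 / m\<close> in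
    \<open>C\<close>.\<close>
  define m where "m = Min (range (\<lambda>i. \<bar>d i\<bar>))"
  have m: "m > 0" "\<And>i. m \<le> \<bar>d i\<bar>" using dnz by (auto simp: m_def)
  define C where "C = sqrt (2 / m)"
  have C: "C > 0" "C^2 = 2 / m" using m by (auto simp: C_def)
  have cone: "norm w \<le> C * norm (\<pi> w)" if "w \<bullet> (Q *v w) \<le> 0" for w
  proof -
    have "m * (norm w)^2 \<le> (\<Sum>i\<in>UNIV. \<bar>d i\<bar> * (w \<bullet> e i)^2)"
      unfolding N sum_distrib_left using m by (intro sum_mono mult_right_mono) auto
    also have "\<dots> = (norm (\<pi> w))^2 + (\<Sum>i\<in>UNIV - {i1,i2}. d i * (w \<bullet> e i)^2)"
    proof -
      have "(\<Sum>i\<in>UNIV - {i1,i2}. \<bar>d i\<bar> * (w \<bullet> e i)^2) = (\<Sum>i\<in>UNIV - {i1,i2}. d i * (w \<bullet> e i)^2)"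
      proof (rule sum.cong)
        fix i assume "i \<in> UNIV - {i1,i2}"
        then have "d i > 0" using dpos[of i] by blast
        then show "\<bar>d i\<bar> * (w \<bullet> e i)^2 = d i * (w \<bullet> e i)^2" by simp
      qed simp
      then show ?thesis using split[of "\<lambda>i. \<bar>d i\<bar> * (w \<bullet> e i)^2"] dn by (simp add: npi)
    qed
    also have "(\<Sum>i\<in>UNIV - {i1,i2}. d i * (w \<bullet> e i)^2) \<le> (norm (\<pi> w))^2"
      using that V[of w] split[of "\<lambda>i. d i * (w \<bullet> e i)^2"] by (simp add: npi)
    finally have "m * (norm w)^2 \<le> 2 * (norm (\<pi> w))^2" by simp
    then have "(norm w)^2 \<le> 2 * (norm (\<pi> w))^2 / m"
      using m(1) by (simp add: pos_le_divide_eq mult.commute)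
    then have "(norm w)^2 \<le> (C * norm (\<pi> w))^2"
      by (simp add: power_mult_distrib C(2))
    then show ?thesis by (rule power2_le_imp_le) (use C(1) in simp)
  qed
  have "linear \<pi>"
    by (intro linearI) (simp_all add: \<pi>_def inner_add_left complex_eq_iff algebra_simps)
  moreover have "linear \<iota>"
    by (intro linearI) (simp_all add: \<iota>_def algebra_simps add_divide_distrib)
  moreover have "\<iota> u \<bullet> (Q *v \<iota> u) = - (norm u)\<^sup>2" for u
  proof -
    have i1: "\<iota> u \<bullet> e i1 = Re u / s1" and i2: "\<iota> u \<bullet> e i2 = Im u / s2"
      using i12(2) by (auto simp: \<iota>_def inner_add_left e(2))
    have "\<iota> u \<bullet> e i = 0" if "i \<in> UNIV - {i1,i2}" for i
      using that by (auto simp: \<iota>_def inner_add_left e(2))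
    then have "(\<Sum>i\<in>UNIV - {i1,i2}. d i * (\<iota> u \<bullet> e i)^2) = 0" by simp
    then have "\<iota> u \<bullet> (Q *v \<iota> u) = d i1 * (Re u / s1)^2 + d i2 * (Im u / s2)^2"
      by (simp add: V split i1 i2)
    also have "\<dots> = - (norm u)\<^sup>2"
      using dn by (simp add: power_divide s cmod_power2)
    finally show ?thesis .
  qed
  ultimately show ?thesis using that C(1) cone by blast
qed

section \<open>Recurrent planar curves\<close>

text \<open>Inside the disc of radius \<open>\<rho>\<close> the imaginary axis is crossed from left
  to right only. The arc of \<open>G\<close> from its last earlier crossing \<open>s1\<close> to
  \<open>0\<close>, closed up by the piece of the axis between the two crossings, is a Jordan curve
  \<open>J\<close>. \<open>U\<close> is the side of \<open>J\<close> to the left of that piece and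
  \<open>W\<close> the side to the right. Just before \<open>s1\<close> the curve is in
  \<open>U\<close>; it cannot have got there from \<open>W\<close>, since it neither meets the arc
  again nor crosses the axis backwards. Just after \<open>0\<close> it is in
  \<open>W\<close>.\<close>

lemma planar_trap:
  fixes G :: "real \<Rightarrow> complex"
  assumes deriv: "\<And>s. (G has_vector_derivative G' s) (at s)"
    and inj: "inj G" and G0: "G 0 = 0"
    and trans: "\<And>s. norm (G s) \<le> \<rho> \<Longrightarrow> Re (G' s) > 0"
    and s1: "s1 < 0" "Re (G s1) = 0" "Im (G s1) > 0" "norm (G s1) \<le> \<rho>"
    and first: "\<And>s. s1 < s \<Longrightarrow> s < 0 \<Longrightarrow> \<not> (Re (G s) = 0 \<and> norm (G s) \<le> \<rho>)"
  obtains U W where "open W" "U \<inter> W = {}" "\<And>s. s < s1 \<Longrightarrow> G s \<in> U"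
    "\<exists>d>0. \<forall>s. 0 < s \<and> s < d \<longrightarrow> G s \<in> W"
proof -
  define y1 where "y1 = Im (G s1)"
  have y1: "y1 > 0" using s1 by (simp add: y1_def)
  have a: "G s1 = Complex 0 y1" using s1 by (simp add: y1_def complex_eq_iff)
  have ny: "y1 \<le> \<rho>" using s1 y1 a by (simp add: cmod_def)
  have contG: "isCont G s" for s
    using deriv[of s] has_vector_derivative_continuous by blast
  have contGS: "continuous_on S G" for S
    using contG continuous_at_imp_continuous_on by blast
  have derRe: "((\<lambda>s. Re (G s)) has_real_derivative Re (G' s)) (at s)" for s
    using bounded_linear.has_vector_derivative[OF bounded_linear_Re deriv[of s]]
    by (simp add: has_real_derivative_iff_has_vector_derivative)
  have pos_right: "\<exists>d>0. \<forall>t. s < t \<and> t < s + d \<longrightarrow> Re (G t) > 0"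
    if n: "norm (G s) \<le> \<rho>" and R: "Re (G s) = 0" for s
  proof -
    obtain d where "d > 0" and d: "\<forall>h>0. h < d \<longrightarrow> Re (G s) < Re (G (s + h))"
      using DERIV_pos_inc_right[OF derRe trans[OF n]] by blast
    have "Re (G t) > 0" if "s < t" "t < s + d" for t
      using d[rule_format, of "t - s"] that R by auto
    then show ?thesis using \<open>d > 0\<close> by blast
  qed
  have neg_left: "\<exists>d>0. \<forall>t. s - d < t \<and> t < s \<longrightarrow> Re (G t) < 0"
    if n: "norm (G s) \<le> \<rho>" and R: "Re (G s) = 0" for s
  proof -
    obtain d where "d > 0" and d: "\<forall>h>0. h < d \<longrightarrow> Re (G (s - h)) < Re (G s)"
      using DERIV_pos_inc_left[OF derRe trans[OF n]] by blast
    have "Re (G t) < 0" if "s - d < t" "t < s" for t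
      using d[rule_format, of "s - t"] that R by auto
    then show ?thesis using \<open>d > 0\<close> by blast
  qed
  define A where "A = G ` {s1..0}"
  define L where "L = {z::complex. Re z = 0 \<and> 0 \<le> Im z \<and> Im z \<le> y1}"
  define J where "J = A \<union> L"
  define g where "g = (\<lambda>t. G (s1 * (1 - t))) +++ linepath 0 (Complex 0 y1)"
  have pg1: "path_image (\<lambda>t. G (s1 * (1 - t))) = A"
  proof -
    have "(\<lambda>t. s1 * (1 - t)) ` {0..1} = {s1..0}"
    proof safe
      fix t :: real assume t: "t \<in> {0..1}"
      then show "s1 * (1 - t) \<in> {s1..0}"
        using s1 by (auto simp: mult_le_0_iff algebra_simps)
    next
      fix x assume x: "x \<in> {s1..0}"
      then have "x = s1 * (1 - (1 - x / s1))" "1 - x / s1 \<in> {0..1}"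
        using s1 by (auto simp: field_simps)
      then show "x \<in> (\<lambda>t. s1 * (1 - t)) ` {0..1}" by blast
    qed
    then show ?thesis unfolding path_image_def A_def by (metis image_image)
  qed
  have seg: "closed_segment 0 (Complex 0 y1) = L"
  proof -
    have "z \<in> closed_segment 0 (Complex 0 y1) \<longleftrightarrow> z \<in> L" for z
    proof
      assume "z \<in> closed_segment 0 (Complex 0 y1)"
      then obtain u where "0 \<le> u" "u \<le> 1" "z = u *\<^sub>R Complex 0 y1"
        by (auto simp: in_segment)
      then show "z \<in> L" using y1 by (auto simp: L_def mult_left_le_one_le)
    next
      assume z: "z \<in> L"
      then have "z = (Im z / y1) *\<^sub>R Complex 0 y1" "0 \<le> Im z / y1" "Im z / y1 \<le> 1"
        using y1 by (auto simp: L_def complex_eq_iff)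
      then show "z \<in> closed_segment 0 (Complex 0 y1)"
        unfolding in_segment by (metis add_0 scaleR_zero_right)
    qed
    then show ?thesis by blast
  qed
  have Lnorm: "norm z \<le> \<rho>" if "z \<in> L" for z
    using that ny by (auto simp: L_def cmod_def)
  have AL: "A \<inter> L \<subseteq> {0, Complex 0 y1}"
  proof
    fix z assume z: "z \<in> A \<inter> L"
    then obtain s where s: "s1 \<le> s" "s \<le> 0" "z = G s" by (auto simp: A_def)
    have "Re (G s) = 0 \<and> norm (G s) \<le> \<rho>" using s(3) z Lnorm[of z] by (auto simp: L_def)
    then have "\<not> (s1 < s \<and> s < 0)" using first[of s] by blast
    then have "s = s1 \<or> s = 0" using s by linarith
    then show "z \<in> {0, Complex 0 y1}" using s a G0 by auto
  qed
  have "simple_path g" unfolding g_def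
  proof (rule simple_path_join_loop)
    have "path (\<lambda>t. G (s1 * (1 - t)))" unfolding path_def
      by (rule continuous_on_compose2[OF contGS]) (auto intro!: continuous_intros)
    moreover have "inj_on (\<lambda>t. G (s1 * (1 - t))) {0..1}"
    proof (rule inj_onI)
      fix x y :: real assume "G (s1 * (1 - x)) = G (s1 * (1 - y))"
      then have "s1 * (1 - x) = s1 * (1 - y)" using inj by (simp only: inj_eq)
      then show "x = y" using s1 by simp
    qed
    ultimately show "arc (\<lambda>t. G (s1 * (1 - t)))" by (simp add: arc_def)
    show "arc (linepath 0 (Complex 0 y1))" using y1 by (auto intro!: arc_linepath simp: complex_eq_iff)
    show "path_image (\<lambda>t. G (s1 * (1 - t))) \<inter> path_image (linepath 0 (Complex 0 y1)) \<subseteq>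
        {pathstart (\<lambda>t. G (s1 * (1 - t))), pathstart (linepath 0 (Complex 0 y1))}"
      unfolding pg1 using AL seg a by (auto simp: pathstart_def)
  qed (auto simp: pathfinish_def pathstart_def linepath_def a G0)
  moreover have "pathfinish g = pathstart g"
    by (simp add: g_def pathstart_def pathfinish_def joinpaths_def linepath_def a)
  moreover have pig: "path_image g = J"
  proof -
    have "pathfinish (\<lambda>t. G (s1 * (1 - t))) = pathstart (linepath 0 (Complex 0 y1))"
      by (simp add: pathfinish_def G0)
    then show ?thesis unfolding g_def J_def by (simp add: path_image_join pg1 seg)
  qed
  ultimately have JIO: "open (inside J)" "open (outside J)" "inside J \<inter> outside J = {}"
      "inside J \<union> outside J = - J" "frontier (inside J) = J" "frontier (outside J) = J"
    using Jordan_inside_outside[of g] by auto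
  \<comment> \<open>Thin open rectangles along the two sides of the segment. \<open>RP\<close> stops
    below the upper end, where the arc departs to the right, and reaches below \<open>0\<close>.
    \<open>RM\<close> starts above the lower end, where the arc arrives from the left, and reaches
    above the upper end.\<close>
  define RP where "RP = (\<lambda>y' d. {z::complex. 0 < Re z} \<inter> {z. Re z < d} \<inter> {z. Im z > - d} \<inter> {z. Im z < y'})"
  define RM where "RM = (\<lambda>d. {z::complex. Re z > - d} \<inter> {z. Re z < 0} \<inter> {z. Im z > y1/4} \<inter> {z. Im z < y1 + d})"
  have conRP: "connected (RP y' d)" for y' d unfolding RP_def
    by (intro convex_connected convex_Int convex_halfspace_Re_gt convex_halfspace_Re_lt
        convex_halfspace_Im_gt convex_halfspace_Im_lt)
  have conRM: "connected (RM d)" for d unfolding RM_def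
    by (intro convex_connected convex_Int convex_halfspace_Re_gt convex_halfspace_Re_lt
        convex_halfspace_Im_gt convex_halfspace_Im_lt)
  \<comment> \<open>If the arc met every such rectangle, its parameters would accumulate at some
    \<open>s\<close> with \<open>G s\<close> on the segment, so at \<open>s1\<close> or at
    \<open>0\<close>. In each of the two claims below one of these is excluded by its height and the
    other by the sign of \<open>Re G\<close> nearby.\<close>
  have limA: "\<exists>s \<in> {s1..0}. \<exists>f r. strict_mono (r::nat\<Rightarrow>nat) \<and> (\<forall>n. f n \<in> {s1..0} \<and> G (f n) \<in> X (1 / (real (r n) + 1))) \<and> f \<longlonglongrightarrow> s"
    if X: "\<And>d. d > 0 \<Longrightarrow> \<exists>s\<in>{s1..0}. G s \<in> X d" for X
  proof -
    have "\<forall>n. \<exists>s\<in>{s1..0}. G s \<in> X (1 / (real n + 1))" using X by (simp add: add_nonneg_pos)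
    then obtain f where f: "\<And>n. f n \<in> {s1..0}" "\<And>n. G (f n) \<in> X (1 / (real n + 1))"
      by metis
    obtain l r where "l \<in> {s1..0}" "strict_mono r" "(f \<circ> r) \<longlonglongrightarrow> l"
      using compact_Icc[of s1 0] f(1) unfolding compact_def by metis
    then show ?thesis using f by (intro bexI[of _ l] exI[of _ "f \<circ> r"] exI[of _ r]) auto
  qed
  have inv0: "(\<lambda>n. 1 / (real (r n) + 1)) \<longlonglongrightarrow> 0" if "strict_mono r" for r :: "nat \<Rightarrow> nat"
    using LIMSEQ_subseq_LIMSEQ[OF lim_inverse_n' that]
    using LIMSEQ_subseq_LIMSEQ[OF LIMSEQ_inverse_real_of_nat that]
    by (simp add: o_def inverse_eq_divide add.commute)
  have claimRP: "\<exists>d>0. RP y' d \<inter> J = {}" if y': "0 < y'" "y' < y1" for y'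
  proof (rule ccontr)
    assume neg: "\<not> ?thesis"
    have "\<exists>s\<in>{s1..0}. G s \<in> RP y' d" if "d > 0" for d
    proof -
      obtain z where z: "z \<in> RP y' d" "z \<in> J" using neg \<open>d > 0\<close> by blast
      then have "z \<notin> L" by (auto simp: RP_def L_def)
      then show ?thesis using z by (auto simp: J_def A_def)
    qed
    from limA[of "RP y'", OF this] obtain s f r where
      s: "s \<in> {s1..0}" "strict_mono (r::nat\<Rightarrow>nat)" "\<And>n. f n \<in> {s1..0}"
         "\<And>n. G (f n) \<in> RP y' (1 / (real (r n) + 1))" "f \<longlonglongrightarrow> s" by blast
    have lim: "(\<lambda>n. G (f n)) \<longlonglongrightarrow> G s" using isCont_tendsto_compose[OF contG s(5)] .
    have "Re (G s) \<le> 0"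
      by (rule LIMSEQ_le[OF tendsto_Re[OF lim] inv0[OF s(2)]]) (use s(4) in \<open>auto simp: RP_def intro: less_imp_le\<close>)
    moreover have "Re (G s) \<ge> 0"
      by (rule LIMSEQ_le_const[OF tendsto_Re[OF lim]]) (use s(4) in \<open>auto simp: RP_def intro: less_imp_le\<close>)
    moreover have "Im (G s) \<le> y'"
      by (rule LIMSEQ_le_const2[OF tendsto_Im[OF lim]]) (use s(4) in \<open>auto simp: RP_def intro: less_imp_le\<close>)
    moreover have "Im (G s) \<ge> - 0"
      by (rule LIMSEQ_le[OF tendsto_minus[OF inv0[OF s(2)]] tendsto_Im[OF lim]])
         (use s(4) in \<open>auto simp: RP_def intro: less_imp_le\<close>)
    ultimately have Gs: "Re (G s) = 0" "0 \<le> Im (G s)" "Im (G s) \<le> y'" by auto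
    then have "G s \<in> L" using y' by (auto simp: L_def)
    then have "Re (G s) = 0 \<and> norm (G s) \<le> \<rho>" using Lnorm[of "G s"] by (auto simp: L_def)
    then have "\<not> (s1 < s \<and> s < 0)" using first[of s] by blast
    then have "s = s1 \<or> s = 0" using s(1) by auto
    then have "s = 0" using Gs y' by (auto simp: y1_def)
    moreover obtain d where d: "d > 0" "\<forall>t. 0 - d < t \<and> t < 0 \<longrightarrow> Re (G t) < 0"
      using neg_left[of 0] G0 y1 ny by auto
    ultimately have "eventually (\<lambda>n. f n > -d) sequentially"
      using s(5) order_tendstoD(1)[of f 0 sequentially "-d"] by auto
    then obtain n where "f n > -d" by (auto dest: eventually_happens)
    moreover have "f n \<noteq> 0" using s(4)[of n] G0 by (auto simp: RP_def)
    ultimately have "Re (G (f n)) < 0" using d s(3)[of n] by auto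
    then show False using s(4)[of n] by (auto simp: RP_def)
  qed
  have claimRM: "\<exists>d>0. RM d \<inter> J = {}"
  proof (rule ccontr)
    assume neg: "\<not> ?thesis"
    have "\<exists>s\<in>{s1..0}. G s \<in> RM d" if "d > 0" for d
    proof -
      obtain z where z: "z \<in> RM d" "z \<in> J" using neg \<open>d > 0\<close> by blast
      then have "z \<notin> L" by (auto simp: RM_def L_def)
      then show ?thesis using z by (auto simp: J_def A_def)
    qed
    from limA[of "RM", OF this] obtain s f r where
      s: "s \<in> {s1..0}" "strict_mono (r::nat\<Rightarrow>nat)" "\<And>n. f n \<in> {s1..0}"
         "\<And>n. G (f n) \<in> RM (1 / (real (r n) + 1))" "f \<longlonglongrightarrow> s" by blast
    have lim: "(\<lambda>n. G (f n)) \<longlonglongrightarrow> G s" using isCont_tendsto_compose[OF contG s(5)] .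
    have "Re (G s) \<le> 0"
      by (rule LIMSEQ_le_const2[OF tendsto_Re[OF lim]]) (use s(4) in \<open>auto simp: RM_def intro: less_imp_le\<close>)
    moreover have "Re (G s) \<ge> - 0"
      by (rule LIMSEQ_le[OF tendsto_minus[OF inv0[OF s(2)]] tendsto_Re[OF lim]])
        (use s(4) in \<open>auto simp: RM_def intro: less_imp_le\<close>)
    moreover have "Im (G s) \<ge> y1/4"
      by (rule LIMSEQ_le_const[OF tendsto_Im[OF lim]]) (use s(4) in \<open>auto simp: RM_def intro: less_imp_le\<close>)
    moreover have "Im (G s) \<le> y1 + 0"
      by (rule LIMSEQ_le[OF tendsto_Im[OF lim] tendsto_add[OF tendsto_const inv0[OF s(2)]]])
         (use s(4) in \<open>auto simp: RM_def intro: less_imp_le\<close>)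
    ultimately have Gs: "Re (G s) = 0" "y1/4 \<le> Im (G s)" "Im (G s) \<le> y1" by auto
    then have "G s \<in> L" using y1 by (auto simp: L_def)
    then have "Re (G s) = 0 \<and> norm (G s) \<le> \<rho>" using Lnorm[of "G s"] by (auto simp: L_def)
    then have "\<not> (s1 < s \<and> s < 0)" using first[of s] by blast
    then have "s = s1 \<or> s = 0" using s(1) by auto
    then have "s = s1" using Gs y1 G0 by auto
    moreover obtain d where d: "d > 0" "\<forall>t. s1 < t \<and> t < s1 + d \<longrightarrow> Re (G t) > 0"
      using pos_right[of s1] s1 by auto
    ultimately have "eventually (\<lambda>n. f n < s1 + d) sequentially"
      using s(5) order_tendstoD(2)[of f s1 sequentially "s1 + d"] by auto
    then obtain n where "f n < s1 + d" by (auto dest: eventually_happens)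
    moreover have "f n \<noteq> s1" using s(4)[of n] s1 by (auto simp: RM_def)
    ultimately have "Re (G (f n)) > 0" using d s(3)[of n] by auto
    then show False using s(4)[of n] by (auto simp: RM_def)
  qed
  obtain dp where dp: "dp > 0" "RP (3*y1/4) dp \<inter> J = {}" using claimRP[of "3*y1/4"] y1 by auto
  obtain dm where dm: "dm > 0" "RM dm \<inter> J = {}" using claimRM by blast
  \<comment> \<open>The midpoint of the segment is on the frontier of both components of the
    complement of \<open>J\<close>, and near it that complement is covered by the two rectangles. So
    each component meets a rectangle, and since rectangles are connected, each component contains
    exactly one of them.\<close>
  define mm where "mm = Complex 0 (y1/2)"
  define e where "e = Min {dp, dm, y1/8}"
  have e: "e > 0" "e \<le> dp" "e \<le> dm" "e \<le> y1/8" using dp dm y1 by (auto simp: e_def)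
  have mmJ: "mm \<in> J" using y1 by (auto simp: mm_def J_def L_def)
  have ballpt: "z \<in> RP (3*y1/4) dp \<or> z \<in> RM dm" if "z \<in> ball mm e" "z \<notin> J" for z
  proof -
    have "norm (mm - z) < e" using that by (simp add: dist_norm)
    then have "\<bar>Re (mm - z)\<bar> < e" "\<bar>Im (mm - z)\<bar> < e"
      using abs_Re_le_cmod[of "mm - z"] abs_Im_le_cmod[of "mm - z"] by linarith+
    then have b: "\<bar>Re z\<bar> < e" "\<bar>y1/2 - Im z\<bar> < e" by (auto simp: mm_def)
    have "Re z \<noteq> 0"
    proof
      assume "Re z = 0"
      then have "z \<in> L" using b e y1 by (auto simp: L_def)
      then show False using that by (simp add: J_def)
    qed
    then show ?thesis using b e y1 by (auto simp: RP_def RM_def)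
  qed
  have meets: "(C \<inter> RP (3*y1/4) dp \<noteq> {} \<or> C \<inter> RM dm \<noteq> {})" if "frontier C = J" "C \<inter> J = {}" for C
  proof -
    have "mm \<in> closure C" using mmJ that by (auto simp: frontier_def)
    then obtain z where "z \<in> C" "dist z mm < e" using closure_approachable e(1) by blast
    then have "z \<in> ball mm e" "z \<notin> J" using that by (auto simp: dist_commute)
    then show ?thesis using ballpt \<open>z \<in> C\<close> by blast
  qed
  have side: "S \<subseteq> inside J \<or> S \<subseteq> outside J" if "connected S" "S \<inter> J = {}" for S
    using connectedD[OF that(1) JIO(1,2)] JIO(3,4) that(2) by blast
  have nonover: "inside J \<inter> J = {}" "outside J \<inter> J = {}" using JIO by blast+
  obtain U W where UW: "(U = inside J \<and> W = outside J) \<or> (U = outside J \<and> W = inside J)"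
      "RM dm \<subseteq> U" "RP (3*y1/4) dp \<subseteq> W"
    using meets[OF JIO(5) nonover(1)] meets[OF JIO(6) nonover(2)] JIO(3)
      side[OF conRM dm(2)] side[OF conRP dp(2)] by blast
  have oU: "open U" and oW: "open W" using UW(1) JIO(1,2) by blast+
  have UWd: "U \<inter> W = {}" using UW(1) JIO(3) by blast
  have UWc: "U \<union> W = - J" using UW(1) JIO(4) by blast
  \<comment> \<open>A rectangle reaching closer to the upper end still overlaps the fixed one, so it
    is on the same side. All heights below \<open>y1\<close> are wanted because the crossing
    excluded in \<open>allU\<close> may sit at any of them.\<close>
  have sideW: "\<exists>d>0. RP y' d \<subseteq> W" if y': "0 < y'" "y' < y1" for y'
  proof -
    obtain d where d: "d > 0" "RP y' d \<inter> J = {}" using claimRP[OF y'] by blast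
    define z where "z = Complex (min d dp / 2) (min y' (3*y1/4) / 2)"
    have "z \<in> RP y' d" "z \<in> RP (3*y1/4) dp" using d dp y' y1
      by (auto simp: RP_def z_def)
    then have "\<not> RP y' d \<subseteq> U" using UW(3) UWd by blast
    then show ?thesis using side[OF conRP d(2)] UW(1) d(1) by blast
  qed
  have ev0: "\<exists>d>0. \<forall>s. 0 < s \<and> s < d \<longrightarrow> G s \<in> W"
  proof -
    obtain d1 where d1: "d1 > 0" "\<forall>t. 0 < t \<and> t < 0 + d1 \<longrightarrow> Re (G t) > 0"
      using pos_right[of 0] G0 y1 ny by auto
    have "min dp (3*y1/4) > 0" using dp y1 by simp
    then obtain d2 where d2: "d2 > 0" "\<forall>t. \<bar>t\<bar> < d2 \<longrightarrow> norm (G t) < min dp (3*y1/4)"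
      using contG[of 0] unfolding continuous_at_eps_delta dist_norm G0 diff_zero real_norm_def
      by blast
    have "G s \<in> W" if "0 < s" "s < min d1 d2" for s
    proof -
      have "norm (G s) < min dp (3*y1/4)" "Re (G s) > 0" using that d1 d2 by auto
      moreover have "\<bar>Re (G s)\<bar> \<le> norm (G s)" "\<bar>Im (G s)\<bar> \<le> norm (G s)"
        by (rule abs_Re_le_cmod abs_Im_le_cmod)+
      ultimately have "G s \<in> RP (3*y1/4) dp" by (auto simp: RP_def)
      then show ?thesis using UW by blast
    qed
    then show ?thesis using d1 d2 by (intro exI[of _ "min d1 d2"]) auto
  qed
  have nearU: "\<exists>d>0. \<forall>s. s1 - d < s \<and> s < s1 \<longrightarrow> G s \<in> U"
  proof -
    obtain d1 where d1: "d1 > 0" "\<forall>t. s1 - d1 < t \<and> t < s1 \<longrightarrow> Re (G t) < 0"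
      using neg_left[of s1] s1 by auto
    have "min dm (y1/4) > 0" using dm y1 by simp
    then obtain d2 where d2: "d2 > 0" "\<forall>t. \<bar>t - s1\<bar> < d2 \<longrightarrow> norm (G t - G s1) < min dm (y1/4)"
      using contG[of s1] unfolding continuous_at_eps_delta dist_norm real_norm_def
      by blast
    have "G s \<in> U" if "s1 - min d1 d2 < s" "s < s1" for s
    proof -
      have "norm (G s - G s1) < min dm (y1/4)" "Re (G s) < 0" using that d1 d2 by auto
      moreover have "\<bar>Re (G s)\<bar> \<le> norm (G s - G s1)" "\<bar>Im (G s) - y1\<bar> \<le> norm (G s - G s1)"
        using abs_Re_le_cmod[of "G s - G s1"] abs_Im_le_cmod[of "G s - G s1"] a by auto
      ultimately have "G s \<in> RM dm" using y1 by (auto simp: RM_def)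
      then show ?thesis using UW by blast
    qed
    then show ?thesis using d1 d2 by (intro exI[of _ "min d1 d2"]) auto
  qed
  have allU: "G s \<in> U" if "s < s1" for s
  proof (rule ccontr)
    assume nU: "G s \<notin> U"
    obtain d where d: "d > 0" "\<And>s. s1 - d < s \<Longrightarrow> s < s1 \<Longrightarrow> G s \<in> U" using nearU by blast
    \<comment> \<open>At the latest time spent outside \<open>U\<close> the curve must be on
      \<open>J\<close>. Injectivity keeps it off the arc, so it is on the segment, and crossing that
      means moving on into \<open>W\<close> instead of \<open>U\<close>.\<close>
    define T where "T = {t \<in> {s..s1 - d/2}. G t \<in> - U}"
    have "closed ({s..s1 - d/2} \<inter> G -` (- U))"
      using oU contGS by (intro continuous_closed_preimage) auto
    also have "{s..s1 - d/2} \<inter> G -` (- U) = T" by (auto simp: T_def)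
    finally have "closed T" .
    moreover have "T \<subseteq> {s..s1 - d/2}" by (auto simp: T_def)
    ultimately have "compact T" by (metis compact_Icc compact_Int_closed inf.absorb_iff2)
    moreover have "s \<in> T" using nU that d(2)[of s] by (fastforce simp: T_def)
    ultimately obtain t where t: "t \<in> T" "\<And>t'. t' \<in> T \<Longrightarrow> t' \<le> t"
      using compact_attains_sup[of T] by blast
    have t1: "t < s1" "s \<le> t" "G t \<notin> U" using t(1) d(1) by (auto simp: T_def)
    have after: "G t' \<in> U" if "t < t'" "t' < s1" for t'
    proof (cases "t' \<le> s1 - d/2")
      case True
      then show ?thesis using t(2)[of t'] t1 that by (auto simp: T_def)
    qed (use d that in auto)
    have limr: "(G \<longlongrightarrow> G t) (at_right t)"
      using contG[of t] by (simp add: continuous_at_imp_continuous_at_within continuous_within[symmetric])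
    have evr: "eventually (\<lambda>t'. t' < s1 \<and> t < t') (at_right t)"
      using t1(1) by (auto simp: eventually_at_right_field)
    have "G t \<notin> W"
    proof
      assume "G t \<in> W"
      then have "eventually (\<lambda>t'. G t' \<in> W) (at_right t)"
        using limr oW topological_tendstoD by blast
      then have "eventually (\<lambda>t'. G t' \<in> W \<and> t' < s1 \<and> t < t') (at_right t)"
        using evr eventually_conj by blast
      then have "\<exists>t'. G t' \<in> W \<and> t' < s1 \<and> t < t'"
        using eventually_happens trivial_limit_at_right_real by blast
      then show False using after UWd by blast
    qed
    then have "G t \<in> J" using UWc t1 by blast
    moreover have "G t \<notin> A" using inj t1 by (auto simp: A_def inj_eq)
    ultimately have GL: "G t \<in> L" by (simp add: J_def)
    then have y: "Re (G t) = 0" "0 \<le> Im (G t)" "Im (G t) \<le> y1" by (auto simp: L_def)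
    have "Im (G t) \<noteq> y1"
    proof
      assume "Im (G t) = y1"
      then have "G t = G s1" using y a by (simp add: complex_eq_iff)
      then show False using inj t1 by (auto simp: inj_eq)
    qed
    then have ylt: "Im (G t) < y1" using y by auto
    define y' where "y' = (Im (G t) + y1) / 2"
    have y': "0 < y'" "y' < y1" "Im (G t) < y'" using ylt y y1 by (auto simp: y'_def)
    obtain d3 where d3: "d3 > 0" "RP y' d3 \<subseteq> W" using sideW y' by blast
    obtain d4 where d4: "d4 > 0" "\<And>t'. t < t' \<Longrightarrow> t' < t + d4 \<Longrightarrow> Re (G t') > 0"
      using pos_right[of t] y Lnorm GL by auto
    have "eventually (\<lambda>t'. Re (G t') < d3 \<and> Im (G t') > - d3 \<and> Im (G t') < y') (at_right t)"
      using order_tendstoD(2)[OF tendsto_Re[OF limr], of d3]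
        order_tendstoD(1)[OF tendsto_Im[OF limr], of "-d3"]
        order_tendstoD(2)[OF tendsto_Im[OF limr], of y'] y d3 y'
      by (auto simp: eventually_conj_iff)
    moreover have "eventually (\<lambda>t'. t < t' \<and> t' < t + d4) (at_right t)"
      using d4 by (auto simp: eventually_at_right_field intro!: exI[of _ "t + d4"])
    ultimately have "eventually (\<lambda>t'. (Re (G t') < d3 \<and> Im (G t') > - d3 \<and> Im (G t') < y') \<and>
        (t < t' \<and> t' < t + d4) \<and> (t' < s1 \<and> t < t')) (at_right t)"
      using evr by eventually_elim blast
    then obtain t' where t': "Re (G t') < d3" "Im (G t') > - d3" "Im (G t') < y'"
        "t < t'" "t' < t + d4" "t' < s1"
      using eventually_happens trivial_limit_at_right_real by blast
    then have "G t' \<in> RP y' d3" using d4(2)[of t'] by (auto simp: RP_def)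
    then have "G t' \<in> W" using d3 by blast
    then show False using after t' UWd by blast
  qed
  show ?thesis using that[OF oW UWd allU ev0] .
qed

text \<open>\<open>Re (a * cnj b)\<close> is the inner product of the plane, so this says how much
  of a reference velocity \<open>b\<close> survives a perturbation by half its size.\<close>

lemma Re_mult_cnj_ge:
  assumes "norm (a - b) \<le> norm b / 2"
  shows "(norm b)\<^sup>2 / 2 \<le> Re (a * cnj b)"
proof -
  have "a * cnj b = (a - b) * cnj b + of_real ((norm b)\<^sup>2)"
    by (simp add: left_diff_distrib complex_norm_square[symmetric])
  then have "Re (a * cnj b) = Re ((a - b) * cnj b) + (norm b)\<^sup>2" by simp
  moreover have "- Re ((a - b) * cnj b) \<le> norm ((a - b) * cnj b)"
    using abs_Re_le_cmod[of "(a - b) * cnj b"] by linarith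
  moreover have "norm ((a - b) * cnj b) \<le> norm b / 2 * norm b"
    unfolding norm_mult complex_mod_cnj using assms by (intro mult_right_mono) auto
  moreover have "norm b / 2 * norm b = (norm b)\<^sup>2 / 2" by (simp add: power2_eq_square)
  ultimately show ?thesis by linarith
qed

text \<open>Recurrence is towards the past and on whole time windows. An earlier copy of the
  crossing at \<open>0\<close> supplies the crossing \<open>s1\<close> that closes the trap; then an
  earlier copy of a point just after \<open>0\<close> would lie in both \<open>U\<close> and
  \<open>W\<close>.\<close>

lemma no_injective_recurrence_aux:
  fixes G :: "real \<Rightarrow> complex"
  assumes deriv: "\<And>s. (G has_vector_derivative G' s) (at s)"
    and inj: "inj G" and G0: "G 0 = 0"
    and trans: "\<And>s. norm (G s) \<le> \<rho> \<Longrightarrow> Re (G' s) > 0" and "\<rho> > 0"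
    and rec: "\<And>\<epsilon> N L. \<epsilon> > 0 \<Longrightarrow> \<exists>\<sigma>\<le>-N. \<forall>\<tau>\<in>{-L..L}. norm (G (\<sigma> + \<tau>) - G \<tau>) < \<epsilon>"
  shows False
proof -
  have contG: "isCont G s" for s
    using deriv[of s] has_vector_derivative_continuous by blast
  have contGS: "continuous_on S G" for S
    using contG continuous_at_imp_continuous_on by blast
  have derRe: "((\<lambda>s. Re (G s)) has_real_derivative Re (G' s)) (at s)" for s
    using bounded_linear.has_vector_derivative[OF bounded_linear_Re deriv[of s]]
    by (simp add: has_real_derivative_iff_has_vector_derivative)
  obtain d0 where d0: "d0 > 0" "\<And>t. \<bar>t\<bar> < d0 \<Longrightarrow> norm (G t) < \<rho> / 2"
    using contG[of 0] \<open>\<rho> > 0\<close> G0 unfolding continuous_at_eps_delta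
    by (metis diff_zero dist_norm half_gt_zero real_norm_def)
  define \<delta> where "\<delta> = d0 / 2"
  have \<delta>: "\<delta> > 0" "\<And>t. \<bar>t\<bar> \<le> \<delta> \<Longrightarrow> norm (G t) < \<rho> / 2" using d0 by (auto simp: \<delta>_def)
  have incr: "Re (G s) < Re (G t)" if "-\<delta> \<le> s" "s < t" "t \<le> \<delta>" for s t
  proof (rule DERIV_pos_imp_increasing[OF that(2)])
    fix x assume "s \<le> x" "x \<le> t"
    then have "norm (G x) < \<rho> / 2" using that by (intro \<delta>(2)) auto
    then have "Re (G' x) > 0" using trans[of x] \<open>\<rho> > 0\<close> by auto
    then show "\<exists>y. ((\<lambda>s. Re (G s)) has_real_derivative y) (at x) \<and> 0 < y" using derRe by blast
  qed
  have Rneg: "Re (G (-\<delta>)) < 0" and Rpos: "Re (G \<delta>) > 0"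
    using incr[of "-\<delta>" 0] incr[of 0 \<delta>] \<delta>(1) G0 by auto
  \<comment> \<open>Small enough for the copied window to keep the signs of \<open>Re G\<close> at
    its ends, hence to cross the axis, and to do so inside the disc.\<close>
  define \<epsilon> where "\<epsilon> = Min {\<rho>/2, - Re (G (-\<delta>)), Re (G \<delta>)}"
  have \<epsilon>: "\<epsilon> > 0" "\<epsilon> \<le> \<rho>/2" "\<epsilon> \<le> - Re (G (-\<delta>))" "\<epsilon> \<le> Re (G \<delta>)"
    using Rneg Rpos \<open>\<rho> > 0\<close> by (auto simp: \<epsilon>_def)
  \<comment> \<open>With \<open>3*\<delta>\<close> the whole copied window lies before
    \<open>-\<delta>\<close>; from there on \<open>Re G\<close> is increasing up to
    \<open>0\<close>, so the set \<open>Z\<close> of crossings below need not look beyond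
    \<open>-\<delta>\<close>.\<close>
  obtain \<sigma> where \<sigma>: "\<sigma> \<le> - (3*\<delta>)" "\<forall>\<tau>\<in>{-\<delta>..\<delta>}. norm (G (\<sigma> + \<tau>) - G \<tau>) < \<epsilon>"
    using rec[OF \<epsilon>(1), of "3*\<delta>" \<delta>] by auto
  have "\<bar>Re (G (\<sigma> + \<tau>)) - Re (G \<tau>)\<bar> < \<epsilon>" if "\<tau> \<in> {-\<delta>..\<delta>}" for \<tau>
    using \<sigma>(2) that abs_Re_le_cmod[of "G (\<sigma> + \<tau>) - G \<tau>"] by fastforce
  from this[of "-\<delta>"] this[of \<delta>] have "Re (G (\<sigma> + -\<delta>)) \<le> 0" "0 \<le> Re (G (\<sigma> + \<delta>))"
    using \<epsilon> \<delta>(1) by auto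
  then obtain s where s: "\<sigma> + -\<delta> \<le> s" "s \<le> \<sigma> + \<delta>" "Re (G s) = 0"
    using IVT[of "\<lambda>s. Re (G s)" "\<sigma> + -\<delta>" 0 "\<sigma> + \<delta>"] \<delta>(1) contG by auto
  have "norm (G s) \<le> \<rho>"
  proof -
    have "norm (G (\<sigma> + (s - \<sigma>)) - G (s - \<sigma>)) < \<epsilon>" using \<sigma>(2) s by (intro \<sigma>(2)[rule_format]) auto
    moreover have "norm (G (s - \<sigma>)) < \<rho>/2" using s by (intro \<delta>(2)) auto
    ultimately show ?thesis using \<epsilon> norm_triangle_ineq2[of "G s" "G (s - \<sigma>)"] by auto
  qed
  define Z where "Z = {t \<in> {s..-\<delta>}. Re (G t) \<in> {0} \<and> norm (G t) \<in> {..\<rho>}}"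
  have "closed {t \<in> {s..-\<delta>}. Re (G t) \<in> {0}}"
    by (intro continuous_closed_preimage[unfolded vimage_def Int_def, simplified mem_Collect_eq])
       (auto intro!: continuous_intros contGS)
  moreover have "closed {t \<in> {s..-\<delta>}. norm (G t) \<in> {..\<rho>}}"
    by (intro continuous_closed_preimage[unfolded vimage_def Int_def, simplified mem_Collect_eq])
       (auto intro!: continuous_intros contGS)
  ultimately have "closed ({t \<in> {s..-\<delta>}. Re (G t) \<in> {0}} \<inter> {t \<in> {s..-\<delta>}. norm (G t) \<in> {..\<rho>}})"
    by (rule closed_Int)
  also have "\<dots> = Z" by (auto simp: Z_def)
  finally have "compact Z" by (metis (no_types, lifting) Z_def compact_Icc compact_Int_closed inf.absorb_iff2 mem_Collect_eq subsetI)
  moreover have "s \<in> Z" using s \<open>norm (G s) \<le> \<rho>\<close> \<sigma>(1) \<delta>(1) by (auto simp: Z_def)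
  ultimately obtain s1 where s1: "s1 \<in> Z" "\<And>t. t \<in> Z \<Longrightarrow> t \<le> s1"
    using compact_attains_sup[of Z] by blast
  have s1': "s1 < 0" "Re (G s1) = 0" "norm (G s1) \<le> \<rho>" "s \<le> s1" using s1 \<delta> by (auto simp: Z_def)
  have first: "\<not> (Re (G t) = 0 \<and> norm (G t) \<le> \<rho>)" if "s1 < t" "t < 0" for t
  proof (cases "t \<le> -\<delta>")
    case True
    then show ?thesis using s1(2)[of t] that s1' by (auto simp: Z_def)
  next
    case False
    then show ?thesis using incr[of t 0] that G0 \<delta>(1) by auto
  qed
  have "Im (G s1) \<noteq> 0"
  proof
    assume "Im (G s1) = 0"
    then have "G s1 = G 0" using G0 s1' by (simp add: complex_eq_iff)
    then show False using inj s1' by (auto simp: inj_eq)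
  qed
  \<comment> \<open>\<open>planar_trap\<close> has the earlier crossing above \<open>0\<close>;
    reflection in the real axis achieves this and leaves real parts alone.\<close>
  define H where "H = (if Im (G s1) > 0 then G else (\<lambda>s. cnj (G s)))"
  define H' where "H' = (if Im (G s1) > 0 then G' else (\<lambda>s. cnj (G' s)))"
  obtain U W where UW: "open W" "U \<inter> W = {}" "\<And>s. s < s1 \<Longrightarrow> H s \<in> U"
    "\<exists>d>0. \<forall>s. 0 < s \<and> s < d \<longrightarrow> H s \<in> W"
  proof (rule planar_trap[of H H' \<rho> s1])
    show "(H has_vector_derivative H' s) (at s)" for s
      using deriv[of s] bounded_linear.has_vector_derivative[OF bounded_linear_cnj deriv[of s]]
      by (simp add: H_def H'_def)
    show "inj H" using inj by (auto simp: H_def inj_def)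
    show "Im (H s1) > 0" using \<open>Im (G s1) \<noteq> 0\<close> by (auto simp: H_def)
  qed (use trans G0 s1' first in \<open>auto simp: H_def H'_def split: if_splits\<close>)
  then obtain d where d: "d > 0" "\<And>s. 0 < s \<Longrightarrow> s < d \<Longrightarrow> H s \<in> W" by blast
  have "H (d/2) \<in> W" using d by auto
  then obtain e where e: "e > 0" "ball (H (d/2)) e \<subseteq> W" using UW(1) open_contains_ball by blast
  \<comment> \<open>The bound \<open>d - s1\<close> places \<open>\<sigma>' + d/2\<close> before
    \<open>s1\<close>.\<close>
  obtain \<sigma>' where \<sigma>': "\<sigma>' \<le> - (d - s1)" "\<forall>\<tau>\<in>{-d..d}. norm (G (\<sigma>' + \<tau>) - G \<tau>) < e"
    using rec[OF e(1), of "d - s1" d] by auto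
  have "norm (G (\<sigma>' + d/2) - G (d/2)) < e" using \<sigma>'(2) d by auto
  then have "norm (H (\<sigma>' + d/2) - H (d/2)) < e"
    by (auto simp: H_def complex_cnj_diff[symmetric] simp del: complex_cnj_diff)
  then have "H (\<sigma>' + d/2) \<in> W" using e(2) by (auto simp: dist_norm norm_minus_commute)
  moreover have "H (\<sigma>' + d/2) \<in> U" using UW(3)[of "\<sigma>' + d/2"] \<sigma>'(1) d(1) by auto
  ultimately show False using UW(2) by blast
qed

text \<open>Normalisation: translating by \<open>G 0\<close> and multiplying by \<open>cnj v\<close>
  turns the direction \<open>v\<close> into the positive real axis and scales distances by
  \<open>norm v\<close>.\<close>

lemma no_injective_recurrence:
  fixes G :: "real \<Rightarrow> complex"
  assumes deriv: "\<And>s. (G has_vector_derivative G' s) (at s)"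
    and inj: "inj G" and "v \<noteq> 0"
    and trans: "\<And>s. norm (G s - G 0) \<le> \<rho> \<Longrightarrow> Re (G' s * cnj v) > 0" and "\<rho> > 0"
    and rec: "\<And>\<epsilon> N L. \<epsilon> > 0 \<Longrightarrow> \<exists>\<sigma>\<le>-N. \<forall>\<tau>\<in>{-L..L}. norm (G (\<sigma> + \<tau>) - G \<tau>) < \<epsilon>"
  shows False
proof (rule no_injective_recurrence_aux[of "\<lambda>s. (G s - G 0) * cnj v" "\<lambda>s. G' s * cnj v" "\<rho> * norm v"])
  show "((\<lambda>s. (G s - G 0) * cnj v) has_vector_derivative G' s * cnj v) (at s)" for s
    using deriv[of s] by (auto intro!: derivative_eq_intros)
  show "inj (\<lambda>s. (G s - G 0) * cnj v)" using inj \<open>v \<noteq> 0\<close> by (auto simp: inj_def)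
  show "0 < Re (G' s * cnj v)" if "cmod ((G s - G 0) * cnj v) \<le> \<rho> * cmod v" for s
    using that \<open>v \<noteq> 0\<close> trans[of s] by (simp add: norm_mult)
  show "0 < \<rho> * cmod v" using \<open>\<rho> > 0\<close> \<open>v \<noteq> 0\<close> by simp
  fix \<epsilon> N L :: real assume "\<epsilon> > 0"
  then obtain \<sigma> where \<sigma>: "\<sigma> \<le> -N" "\<forall>\<tau>\<in>{-L..L}. norm (G (\<sigma> + \<tau>) - G \<tau>) < \<epsilon> / norm v"
    using rec[of "\<epsilon> / norm v" N L] \<open>v \<noteq> 0\<close> by auto
  have "norm ((G (\<sigma> + \<tau>) - G 0) * cnj v - (G \<tau> - G 0) * cnj v) < \<epsilon>" if "\<tau> \<in> {-L..L}" for \<tau>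
  proof -
    have "(G (\<sigma> + \<tau>) - G 0) * cnj v - (G \<tau> - G 0) * cnj v = (G (\<sigma> + \<tau>) - G \<tau>) * cnj v"
      by (simp add: algebra_simps)
    then have "norm ((G (\<sigma> + \<tau>) - G 0) * cnj v - (G \<tau> - G 0) * cnj v) = norm (G (\<sigma> + \<tau>) - G \<tau>) * norm v"
      by (simp only: norm_mult complex_mod_cnj)
    moreover have "norm (G (\<sigma> + \<tau>) - G \<tau>) < \<epsilon> / norm v" using \<sigma>(2) that by blast
    ultimately show ?thesis using \<open>v \<noteq> 0\<close> by (simp add: pos_less_divide_eq)
  qed
  then show "\<exists>\<sigma>\<le>-N. \<forall>\<tau>\<in>{-L..L}. norm ((G (\<sigma> + \<tau>) - G 0) * cnj v - (G \<tau> - G 0) * cnj v) < \<epsilon>"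
    using \<sigma>(1) by blast
qed simp

section \<open>Negligible sets\<close>

text \<open>The points of a maximal \<open>\<epsilon>\<close>-separated subset of \<open>A\<close>
  have images \<open>M * \<epsilon>\<close> apart in a fixed ball, which bounds their number by
  volume, while the \<open>\<epsilon>\<close>-balls around them cover \<open>A\<close>. The measure
  of \<open>A\<close> is thus at most a constant times \<open>(2 / M) ^ n\<close>, for every
  \<open>M\<close>. The \<open>min\<close> asks for expansion below the scale
  \<open>\<epsilon>\<close> and for mere separation above it.\<close>

lemma negligible_if_expandable:
  fixes A :: "'a::euclidean_space set"
  assumes A: "compact A"
    and exp: "\<And>M. M > 0 \<Longrightarrow> \<exists>\<epsilon>>0. \<exists>g::'a\<Rightarrow>'a. (\<forall>u\<in>A. norm (g u) \<le> R) \<and>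
          (\<forall>u\<in>A. \<forall>v\<in>A. M * min (norm (u - v)) \<epsilon> \<le> norm (g u - g v))"
  shows "negligible A"
proof -
  define K where "K = measure lborel (ball (0::'a) (R + 1))"
  define n where "n = DIM('a)"
  have n: "n > 0" by (simp add: n_def)
  have bound: "measure lebesgue A \<le> (2 / M) ^ n * K" if M: "M > 0" for M
  proof -
    obtain \<epsilon>0 and g :: "'a \<Rightarrow> 'a" where \<epsilon>0: "\<epsilon>0 > 0" and gR: "\<And>u. u \<in> A \<Longrightarrow> norm (g u) \<le> R"
      and gM: "\<And>u v. u \<in> A \<Longrightarrow> v \<in> A \<Longrightarrow> M * min (norm (u - v)) \<epsilon>0 \<le> norm (g u - g v)"
      using exp[OF M] by metis
    \<comment> \<open>\<open>M * \<epsilon> \<le> 1\<close> keeps the balls of radius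
      \<open>M * \<epsilon> / 2\<close> around the images inside radius
      \<open>R + 1\<close>.\<close>
    define \<epsilon> where "\<epsilon> = min \<epsilon>0 (1 / M)"
    have \<epsilon>: "\<epsilon> > 0" "\<epsilon> \<le> \<epsilon>0" "M * \<epsilon> \<le> 1" using \<epsilon>0 M by (auto simp: \<epsilon>_def min_def field_simps)
    define sep where "sep = (\<lambda>X. finite X \<and> X \<subseteq> A \<and> (\<forall>u\<in>X. \<forall>v\<in>X. u \<noteq> v \<longrightarrow> \<epsilon> \<le> norm (u - v)))"
    have card_sep: "real (card X) * measure lborel (ball (0::'a) (M * \<epsilon> / 2)) \<le> K" if X: "sep X" for X
    proof -
      have fX: "finite X" and XA: "X \<subseteq> A"
        and Xs: "\<And>u v. u \<in> X \<Longrightarrow> v \<in> X \<Longrightarrow> u \<noteq> v \<Longrightarrow> \<epsilon> \<le> norm (u - v)"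
        using X by (auto simp: sep_def)
      have gs: "M * \<epsilon> \<le> norm (g u - g v)" if "u \<in> X" "v \<in> X" "u \<noteq> v" for u v
      proof -
        have "M * \<epsilon> \<le> M * min (norm (u - v)) \<epsilon>0"
          using Xs[OF that] \<epsilon> M by (intro mult_left_mono) auto
        also have "\<dots> \<le> norm (g u - g v)" using gM that XA by blast
        finally show ?thesis .
      qed
      have disj: "disjoint_family_on (\<lambda>x. ball (g x) (M * \<epsilon> / 2)) X"
        unfolding disjoint_family_on_def
      proof (intro ballI impI)
        fix u v assume uv: "u \<in> X" "v \<in> X" "u \<noteq> v"
        show "ball (g u) (M * \<epsilon> / 2) \<inter> ball (g v) (M * \<epsilon> / 2) = {}"
        proof (rule ccontr)
          assume "\<not> ?thesis"
          then obtain w where "dist (g u) w < M * \<epsilon> / 2" "dist (g v) w < M * \<epsilon> / 2" by auto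
          then have "dist (g u) (g v) < M * \<epsilon>" using dist_triangle3[of "g u" "g v" w]
            by (simp add: dist_commute)
          then show False using gs[OF uv] by (simp add: dist_norm)
        qed
      qed
      have "real (card X) * measure lborel (ball (0::'a) (M * \<epsilon> / 2)) = (\<Sum>x\<in>X. measure lebesgue (ball (g x) (M * \<epsilon> / 2)))"
        using M \<epsilon> by (simp add: content_ball)
      also have "\<dots> = measure lebesgue (\<Union>x\<in>X. ball (g x) (M * \<epsilon> / 2))"
        using fX disj by (intro measure_UNION'[symmetric]) (auto simp: disjoint_family_on_def pairwise_def disjnt_def)
      also have "\<dots> \<le> measure lebesgue (ball (0::'a) (R + 1))"
      proof (rule measure_mono_fmeasurable)
        show "(\<Union>x\<in>X. ball (g x) (M * \<epsilon> / 2)) \<subseteq> ball 0 (R + 1)"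
        proof
          fix w assume "w \<in> (\<Union>x\<in>X. ball (g x) (M * \<epsilon> / 2))"
          then obtain x where x: "x \<in> X" "norm (g x - w) < M * \<epsilon> / 2" by (auto simp: dist_norm)
          have "norm w \<le> norm (g x) + norm (g x - w)" using norm_triangle_ineq4[of "g x" "g x - w"] by simp
          then show "w \<in> ball 0 (R + 1)" using x \<epsilon>(3) gR[of x] XA by auto
        qed
      qed (use fX in auto)
      finally show ?thesis by (simp add: K_def)
    qed
    have cpos: "measure lborel (ball (0::'a) (M * \<epsilon> / 2)) > 0" using M \<epsilon> by simp
    have "\<exists>X. sep X \<and> (\<forall>Y. sep Y \<longrightarrow> card Y \<le> card X)"
    proof (rule ex_has_greatest_nat[of sep "{}" card "nat \<lceil>K / measure lborel (ball (0::'a) (M * \<epsilon> / 2))\<rceil> + 1"])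
      show "sep {}" by (simp add: sep_def)
      show "\<forall>Y. sep Y \<longrightarrow> card Y < nat \<lceil>K / measure lborel (ball (0::'a) (M * \<epsilon> / 2))\<rceil> + 1"
      proof (intro allI impI)
        fix Y assume "sep Y"
        then have "real (card Y) \<le> K / measure lborel (ball (0::'a) (M * \<epsilon> / 2))"
          using card_sep[of Y] cpos by (simp add: pos_le_divide_eq)
        then show "card Y < nat \<lceil>K / measure lborel (ball (0::'a) (M * \<epsilon> / 2))\<rceil> + 1" by linarith
      qed
    qed
    then obtain X where X: "sep X" "\<And>Y. sep Y \<Longrightarrow> card Y \<le> card X" by blast
    have fX: "finite X" using X by (simp add: sep_def)
    have cover: "A \<subseteq> (\<Union>x\<in>X. ball x \<epsilon>)"
    proof
      fix u assume u: "u \<in> A"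
      show "u \<in> (\<Union>x\<in>X. ball x \<epsilon>)"
      proof (rule ccontr)
        assume nu: "u \<notin> (\<Union>x\<in>X. ball x \<epsilon>)"
        then have far: "\<epsilon> \<le> norm (x - u)" if "x \<in> X" for x using that by (auto simp: dist_norm not_less)
        then have "sep (insert u X)" using X(1) u by (auto simp: sep_def norm_minus_commute)
        moreover have "u \<notin> X" using far[of u] \<epsilon> by auto
        ultimately show False using X(2)[of "insert u X"] fX by simp
      qed
    qed
    have "measure lebesgue A \<le> measure lebesgue (\<Union>x\<in>X. ball x \<epsilon>)"
      using cover fX lmeasurable_compact[OF A] by (intro measure_mono_fmeasurable) auto
    also have "\<dots> \<le> (\<Sum>x\<in>X. measure lebesgue (ball x \<epsilon>))"
      using fX by (intro measure_UNION_le) auto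
    also have "\<dots> = real (card X) * (unit_ball_vol n * \<epsilon> ^ n)"
      using \<epsilon> by (simp add: content_ball n_def)
    also have "\<dots> = (2 / M) ^ n * (real (card X) * measure lborel (ball (0::'a) (M * \<epsilon> / 2)))"
      using \<epsilon> M by (simp add: content_ball n_def power_mult_distrib power_divide)
    also have "\<dots> \<le> (2 / M) ^ n * K"
      using card_sep[OF X(1)] M by (intro mult_left_mono) auto
    finally show ?thesis .
  qed
  have "(\<lambda>k. (2 / real (Suc k)) ^ n * K) \<longlonglongrightarrow> 0 ^ n * K"
    by (intro tendsto_intros) (use LIMSEQ_inverse_real_of_nat[THEN tendsto_mult_right[of _ _ _ 2]] in
        \<open>simp add: divide_inverse\<close>)
  then have "measure lebesgue A \<le> 0 ^ n * K"
    by (rule LIMSEQ_le_const) (use bound in auto)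
  then have "measure lebesgue A = 0" using n measure_nonneg[of lebesgue A] by (simp add: power_0_left)
  then show ?thesis using lmeasurable_compact[OF A] by (simp add: negligible_iff_measure)
qed

text \<open>Fubini on the pairs \<open>(z, u)\<close> with \<open>z + \<iota> u \<in> B\<close>, and translation invariance, so that the image of
  \<open>\<iota>\<close> needs no complement.\<close>

lemma negligible_if_slices_negligible:
  fixes B :: "'a::euclidean_space set" and \<iota> :: "'b::euclidean_space \<Rightarrow> 'a"
  assumes B: "closed B" and \<iota>: "linear \<iota>" and null: "\<And>z. negligible {u. z + \<iota> u \<in> B}"
  shows "negligible B"
proof -
  define D where "D = {p. fst p + \<iota> (snd p) \<in> B}"
  have c\<iota>: "continuous_on S \<iota>" for S using \<iota> by (simp add: linear_continuous_on linear_conv_bounded_linear)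
  have "closed D"
  proof -
    have "closed ((\<lambda>p. fst p + \<iota> (snd p)) -` B)"
      by (intro continuous_closed_vimage B continuous_on_interior[of UNIV] continuous_intros
           continuous_on_compose2[OF c\<iota>[of UNIV]]) auto
    then show ?thesis by (simp add: D_def vimage_def)
  qed
  then have D: "D \<in> sets (lborel \<Otimes>\<^sub>M lborel)"
    by (metis borel_closed borel_prod sets_lborel sets_pair_measure_cong)
  have slice: "emeasure lborel (Pair z -` D) = 0" for z
  proof -
    have eq: "Pair z -` D = {u. z + \<iota> u \<in> B}" by (auto simp: D_def)
    moreover have "Pair z -` D \<in> sets borel" using sets_Pair1[OF D, of z] by simp
    ultimately show ?thesis using null[of z]
      by (simp add: negligible_iff_null_sets null_sets_def main_part_sets emeasure_completion)
  qed
  have "emeasure (lborel \<Otimes>\<^sub>M lborel) D = 0"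
    by (subst lborel.emeasure_pair_measure_alt[OF D]) (simp add: slice)
  then have "0 = (\<integral>\<^sup>+ u. emeasure lborel ((\<lambda>z. (z, u)) -` D) \<partial>lborel)"
    using lborel_pair.emeasure_pair_measure_alt2[OF D] by simp
  also have "\<dots> = (\<integral>\<^sup>+ u. emeasure lborel B \<partial>(lborel :: 'b measure))"
  proof (rule nn_integral_cong)
    fix u :: 'b
    have "(\<lambda>z. (z, u)) -` D = (+) (\<iota> u) -` B" by (auto simp: D_def add.commute)
    moreover have "emeasure lborel B = emeasure (distr lborel borel ((+) (\<iota> u))) B"
      by (simp add: lborel_distr_plus)
    ultimately show "emeasure lborel ((\<lambda>z. (z, u)) -` D) = emeasure lborel B"
      using B by (simp add: emeasure_distr)
  qed
  also have "\<dots> = emeasure lborel B * \<infinity>" by simp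
  finally have "emeasure lborel B = 0" by (metis ennreal_mult_eq_top_iff infinity_ennreal_def ennreal_zero_neq_top)
  then show ?thesis using B by (auto simp: negligible_iff_null_sets intro!: null_sets_completionI)
qed

section \<open>Flows dissipating an indefinite quadratic form\<close>

text \<open>Zero can be crossed downwards only: at a first return to nonnegative values
  \<open>h\<close> would vanish, and its negative slope there would make it positive just
  before.\<close>

lemma negative_persists:
  fixes h :: "real \<Rightarrow> real"
  assumes deriv: "\<And>t. (h has_real_derivative h' t) (at t)"
    and down: "\<And>t. h t = 0 \<Longrightarrow> h' t < 0" and "h a \<le> 0" "a < b"
  shows "h b < 0"
proof (rule ccontr)
  assume hb: "\<not> h b < 0"
  have cont: "isCont h t" for t using DERIV_isCont deriv by blast
  have contS: "continuous_on S h" for S using cont continuous_at_imp_continuous_on by blast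
  have "\<exists>a'. a \<le> a' \<and> a' < b \<and> h a' < 0"
  proof (cases "h a < 0")
    case True then show ?thesis using \<open>a < b\<close> by auto
  next
    case False
    then have "h a = 0" using assms by simp
    then obtain d where d: "d > 0" "\<forall>k>0. k < d \<longrightarrow> h (a + k) < h a"
      using DERIV_neg_dec_right[OF deriv down] by blast
    define k where "k = min (d/2) ((b - a)/2)"
    have "k > 0" "k < d" "a + k < b" using d(1) \<open>a < b\<close> by (auto simp: k_def min_def field_simps)
    then show ?thesis using d(2) \<open>h a = 0\<close> by (intro exI[of _ "a + k"]) auto
  qed
  then obtain a' where a': "a' < b" "h a' < 0" by blast
  define T where "T = {a'..b} \<inter> h -` {0..}"
  have "closed T" unfolding T_def by (intro continuous_closed_preimage contS) auto
  moreover have "T \<subseteq> {a'..b}" by (auto simp: T_def)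
  ultimately have "compact T" by (metis compact_Icc compact_Int_closed inf.absorb_iff2)
  moreover have "b \<in> T" using hb a' by (auto simp: T_def)
  ultimately obtain c where c: "c \<in> T" "\<And>t. t \<in> T \<Longrightarrow> c \<le> t"
    using compact_attains_inf[of T] by blast
  have ca: "a' < c" "h c \<ge> 0" using c(1) a' by (auto simp: T_def less_le)
  have before: "h t < 0" if "a' \<le> t" "t < c" for t
    using c(2)[of t] that c(1) by (force simp: T_def)
  have "h c \<le> 0"
  proof (rule ccontr)
    assume "\<not> h c \<le> 0"
    then obtain t where "a' \<le> t" "t \<le> c" "h t = 0"
      using IVT[of h a' 0 c] a' ca cont by auto
    then show False using before[of t] \<open>\<not> h c \<le> 0\<close> by (cases "t = c") auto
  qed
  then have "h c = 0" using ca by simp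
  then obtain d where d: "d > 0" "\<forall>k>0. k < d \<longrightarrow> h c < h (c - k)"
    using DERIV_neg_dec_left[OF deriv down] by blast
  define k where "k = min (d/2) (c - a')"
  have "k > 0" "k < d" "a' \<le> c - k" using d ca by (auto simp: k_def)
  then show False using d(2) before[of "c - k"] \<open>h c = 0\<close> by fastforce
qed

text \<open>\<open>q\<close> is the matrix as a linear map and \<open>form_neg\<close> is the matrix
  inequality tested on a vector. \<open>DF\<close> takes values in \<open>blinfun\<close> so that
  its continuity in the operator norm gives Lipschitz constants on balls. \<open>\<pi>\<close> and
  \<open>C\<close> carry the splitting; the embedded plane \<open>\<iota>\<close> enters with the
  measure estimate.\<close>

locale rank_two_flow =
  fixes F :: "'a::euclidean_space \<Rightarrow> 'a" and DF :: "'a \<Rightarrow> 'a \<Rightarrow>\<^sub>L 'a"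
    and \<Phi> :: "real \<Rightarrow> 'a \<Rightarrow> 'a" and q :: "'a \<Rightarrow> 'a" and lam :: "'a \<Rightarrow> real"
    and \<pi> :: "'a \<Rightarrow> complex" and C :: real
  assumes F_deriv: "\<And>x. (F has_derivative blinfun_apply (DF x)) (at x)"
    and DF_cont: "continuous_on UNIV DF"
    and flow: "flow_of F \<Phi>"
    and lin_q: "linear q" and q_sym: "\<And>x y. q x \<bullet> y = x \<bullet> q y"
    and lam_cont: "continuous_on UNIV lam"
    and form_neg: "\<And>x v. v \<noteq> 0 \<Longrightarrow> 2 * (q v \<bullet> DF x v) + lam x * (v \<bullet> q v) < 0"
    and lin_pi: "linear \<pi>" and C_pos: "C > 0"
    and cone: "\<And>v. v \<bullet> q v \<le> 0 \<Longrightarrow> norm v \<le> C * norm (\<pi> v)"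
begin

definition V :: "'a \<Rightarrow> real" where "V v = v \<bullet> q v"

text \<open>Complete solutions rather than initial points, so that an orbit and its own time shift
  are compared in the same way as two orbits.\<close>

definition sol :: "(real \<Rightarrow> 'a) \<Rightarrow> bool" where
  "sol f \<longleftrightarrow> (\<forall>t. (f has_vector_derivative F (f t)) (at t))"

lemma bl_q: "bounded_linear q" and bl_pi: "bounded_linear \<pi>"
  using lin_q lin_pi by (simp_all add: linear_conv_bounded_linear)

lemma cone_V: "V v \<le> 0 \<Longrightarrow> norm v \<le> C * norm (\<pi> v)"
  using cone by (simp add: V_def)

lemma pi_diff: "\<pi> (x - y) = \<pi> x - \<pi> y"
  using lin_pi linear_diff by blast

lemma V_0 [simp]: "V 0 = 0" by (simp add: V_def)

lemma V_minus: "V (x - y) = V (y - x)"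
proof -
  have "q (x - y) = - q (y - x)" using lin_q linear_neg[of q "y - x"] by simp
  then show ?thesis by (simp add: V_def inner_diff_left inner_diff_right)
qed

lemma V_scaleR: "V (c *\<^sub>R v) = c\<^sup>2 * V v"
  by (simp add: V_def linear_scale[OF lin_q] power2_eq_square)

lemma continuous_on_q [continuous_intros]:
  "continuous_on S f \<Longrightarrow> continuous_on S (\<lambda>x. q (f x))"
  using bl_q bounded_linear.continuous_on by blast

lemma continuous_on_pi [continuous_intros]:
  "continuous_on S f \<Longrightarrow> continuous_on S (\<lambda>x. \<pi> (f x))"
  using bl_pi bounded_linear.continuous_on by blast

lemma continuous_on_V [continuous_intros]:
  "continuous_on S f \<Longrightarrow> continuous_on S (\<lambda>x. V (f x))"
  unfolding V_def by (intro continuous_intros)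

lemma tendsto_V [tendsto_intros]: "(f \<longlongrightarrow> l) G \<Longrightarrow> ((\<lambda>x. V (f x)) \<longlongrightarrow> V l) G"
  unfolding V_def by (intro tendsto_intros bounded_linear.tendsto[OF bl_q])

lemma F_cont: "continuous_on S F"
  using F_deriv has_derivative_continuous continuous_at_imp_continuous_on by blast

lemma continuous_on_F [continuous_intros]:
  "continuous_on S f \<Longrightarrow> continuous_on S (\<lambda>x. F (f x))"
  using F_cont[of UNIV] continuous_on_compose2 by blast

lemma tendsto_F [tendsto_intros]: "(f \<longlongrightarrow> l) G \<Longrightarrow> ((\<lambda>x. F (f x)) \<longlongrightarrow> F l) G"
  using F_deriv has_derivative_continuous isCont_tendsto_compose by blast

lemma continuous_on_lam [continuous_intros]:
  "continuous_on S f \<Longrightarrow> continuous_on S (\<lambda>x. lam (f x))"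
  using lam_cont continuous_on_compose2 by blast

lemma V_bound: obtains B where "B > 0" "\<And>v. \<bar>V v\<bar> \<le> B * (norm v)\<^sup>2"
proof -
  obtain B where B: "B > 0" "\<And>v. norm (q v) \<le> norm v * B"
    using bounded_linear.pos_bounded[OF bl_q] by blast
  have "\<bar>V v\<bar> \<le> B * (norm v)\<^sup>2" for v
  proof -
    have "\<bar>V v\<bar> \<le> norm v * norm (q v)" unfolding V_def by (rule Cauchy_Schwarz_ineq2)
    also have "\<dots> \<le> norm v * (norm v * B)" using B by (intro mult_left_mono) auto
    finally show ?thesis by (simp add: power2_eq_square mult_ac)
  qed
  then show ?thesis using that B by blast
qed

section \<open>Uniqueness, group law and continuous dependence\<close>

lemma \<Phi>_0 [simp]: "\<Phi> 0 x = x"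
  using flow by (simp add: flow_of_def)

lemma sol_\<Phi>: "sol (\<lambda>t. \<Phi> t x)"
  using flow by (simp add: flow_of_def sol_def)

lemma sol_shift: "sol f \<Longrightarrow> sol (\<lambda>t. f (t + c))"
  unfolding sol_def
proof
  fix t assume "\<forall>t. (f has_vector_derivative F (f t)) (at t)"
  then have "(f has_vector_derivative F (f (t + c))) (at (t + c))" by blast
  moreover have "((\<lambda>t. t + c) has_vector_derivative 1) (at t)"
    by (auto intro!: derivative_eq_intros)
  ultimately have "((f \<circ> (\<lambda>t. t + c)) has_vector_derivative (1 *\<^sub>R F (f (t + c)))) (at t)"
    by (intro vector_diff_chain_at) auto
  then show "((\<lambda>t. f (t + c)) has_vector_derivative F (f (t + c))) (at t)"
    by (simp add: o_def)
qed

lemma sol_cont: "sol f \<Longrightarrow> continuous_on S f"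
  unfolding sol_def using has_vector_derivative_continuous continuous_at_imp_continuous_on by blast

lemma continuous_on_\<Phi> [continuous_intros]:
  "continuous_on S f \<Longrightarrow> continuous_on S (\<lambda>s. \<Phi> (f s) x)"
  using sol_cont[OF sol_\<Phi>, of UNIV] continuous_on_compose2 by blast

lemma tendsto_\<Phi>_time: "(f \<longlongrightarrow> l) G \<Longrightarrow> ((\<lambda>s. \<Phi> (f s) x) \<longlongrightarrow> \<Phi> l x) G"
  using sol_\<Phi>[of x] has_vector_derivative_continuous isCont_tendsto_compose
  unfolding sol_def by blast

lemma F_lipschitz:
  obtains L where "L \<ge> 0" "\<And>x y. norm x \<le> R \<Longrightarrow> norm y \<le> R \<Longrightarrow> norm (F x - F y) \<le> L * norm (x - y)"
proof -
  have "bounded (DF ` cball 0 R)"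
    using DF_cont by (intro compact_imp_bounded compact_continuous_image) (auto intro: continuous_on_subset)
  then obtain B where B: "B > 0" "\<And>x. norm x \<le> R \<Longrightarrow> norm (DF x) \<le> B"
    unfolding bounded_pos by auto
  have "norm (F x - F y) \<le> B * norm (x - y)" if "norm x \<le> R" "norm y \<le> R" for x y
  proof (rule differentiable_bound[of "cball 0 R"])
    show "(F has_derivative blinfun_apply (DF z)) (at z within cball 0 R)" for z
      using F_deriv has_derivative_at_withinI by blast
    show "onorm (blinfun_apply (DF z)) \<le> B" if "z \<in> cball 0 R" for z
      using B that by (simp add: norm_blinfun.rep_eq)
  qed (use that in auto)
  then show ?thesis using that B by (meson less_imp_le)
qed

lemma norm_sq_diff_deriv:
  assumes "sol f" "sol g"
  shows "((\<lambda>t. (norm (f t - g t))\<^sup>2) has_real_derivative 2 * ((f t - g t) \<bullet> (F (f t) - F (g t)))) (at t)"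
proof -
  have "((\<lambda>t. f t - g t) has_vector_derivative (F (f t) - F (g t))) (at t)"
    using assms unfolding sol_def by (intro has_vector_derivative_diff) auto
  then have "((\<lambda>t. (f t - g t) \<bullet> (f t - g t)) has_derivative
      (\<lambda>h. (f t - g t) \<bullet> (h *\<^sub>R (F (f t) - F (g t))) + (h *\<^sub>R (F (f t) - F (g t))) \<bullet> (f t - g t))) (at t)"
    unfolding has_vector_derivative_def by (intro has_derivative_inner)
  then show ?thesis
    unfolding has_field_derivative_def dot_square_norm[symmetric]
    by (rule has_derivative_eq_rhs) (auto simp: fun_eq_iff inner_commute algebra_simps)
qed

lemma V_deriv:
  assumes w: "(w has_vector_derivative w') (at t)"
  shows "((\<lambda>t. V (w t)) has_real_derivative 2 * (q (w t) \<bullet> w')) (at t)"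
proof -
  have "((\<lambda>t. q (w t)) has_vector_derivative q w') (at t)"
    by (rule bounded_linear.has_vector_derivative[OF bl_q w])
  with w have "((\<lambda>t. w t \<bullet> q (w t)) has_derivative
      (\<lambda>h. w t \<bullet> (h *\<^sub>R q w') + (h *\<^sub>R w') \<bullet> q (w t))) (at t)"
    unfolding has_vector_derivative_def by (intro has_derivative_inner)
  moreover have "w t \<bullet> q w' = q (w t) \<bullet> w'" "w' \<bullet> q (w t) = q (w t) \<bullet> w'"
    by (simp_all add: q_sym inner_commute)
  ultimately show ?thesis
    unfolding has_field_derivative_def V_def
    by (elim has_derivative_eq_rhs) (simp add: fun_eq_iff)
qed

lemma V_diff_deriv:
  assumes "sol f" "sol g"
  shows "((\<lambda>t. V (f t - g t)) has_real_derivative 2 * (q (f t - g t) \<bullet> (F (f t) - F (g t)))) (at t)"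
  using assms unfolding sol_def by (intro V_deriv has_vector_derivative_diff) auto

text \<open>The velocity along a solution solves the linearised equation, so it obeys the
  infinitesimal form of the estimates for differences.\<close>

lemma V_F_deriv:
  assumes "sol f"
  shows "((\<lambda>t. V (F (f t))) has_real_derivative 2 * (q (F (f t)) \<bullet> DF (f t) (F (f t)))) (at t)"
proof (rule V_deriv)
  have "(f has_vector_derivative F (f t)) (at t)" using assms by (simp add: sol_def)
  then show "((\<lambda>t. F (f t)) has_vector_derivative DF (f t) (F (f t))) (at t)"
    using F_deriv[of "f t"] vector_derivative_diff_chain_within[of f "F (f t)" t UNIV F "blinfun_apply (DF (f t))"]
    by (simp add: o_def has_derivative_at_withinI)
qed

lemma gronwall_forward:
  assumes f: "sol f" and g: "sol g" and "L \<ge> 0" and "a \<le> b"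
    and lip: "\<And>t. a \<le> t \<Longrightarrow> t \<le> b \<Longrightarrow> norm (F (f t) - F (g t)) \<le> L * norm (f t - g t)"
  shows "norm (f b - g b) \<le> exp (L * (b - a)) * norm (f a - g a)"
    and "norm (f a - g a) \<le> exp (L * (b - a)) * norm (f b - g b)"
proof -
  let ?n = "\<lambda>t. (norm (f t - g t))\<^sup>2"
  have est: "\<bar>(f t - g t) \<bullet> (F (f t) - F (g t))\<bar> \<le> L * ?n t" if "a \<le> t" "t \<le> b" for t
  proof -
    have "\<bar>(f t - g t) \<bullet> (F (f t) - F (g t))\<bar> \<le> norm (f t - g t) * norm (F (f t) - F (g t))"
      by (rule Cauchy_Schwarz_ineq2)
    also have "\<dots> \<le> norm (f t - g t) * (L * norm (f t - g t))"
      using lip[OF that] by (intro mult_left_mono) auto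
    finally show ?thesis by (simp add: power2_eq_square mult_ac)
  qed
  have "exp (- 2 * L * b) * ?n b \<le> exp (- 2 * L * a) * ?n a"
  proof (rule DERIV_nonpos_imp_nonincreasing[OF \<open>a \<le> b\<close>])
    fix t assume t: "a \<le> t" "t \<le> b"
    have "((\<lambda>t. exp (- 2 * L * t) * ?n t) has_real_derivative
        (exp (- 2 * L * t) * (2 * ((f t - g t) \<bullet> (F (f t) - F (g t))) - 2 * L * ?n t))) (at t)"
      by (rule derivative_eq_intros norm_sq_diff_deriv[OF f g] refl)+ (simp add: algebra_simps)
    moreover have "exp (- 2 * L * t) * (2 * ((f t - g t) \<bullet> (F (f t) - F (g t))) - 2 * L * ?n t) \<le> 0"
      using est[OF t] by (intro mult_nonneg_nonpos) auto
    ultimately show "\<exists>y. ((\<lambda>t. exp (- 2 * L * t) * ?n t) has_real_derivative y) (at t) \<and> y \<le> 0" by blast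
  qed
  then have "?n b \<le> (exp (L * (b - a)) * norm (f a - g a))\<^sup>2"
    by (simp add: power_mult_distrib exp_double[symmetric] exp_minus exp_diff field_simps
        flip: exp_add)
  then show "norm (f b - g b) \<le> exp (L * (b - a)) * norm (f a - g a)"
    by (rule power2_le_imp_le) simp
  have "exp (2 * L * a) * ?n a \<le> exp (2 * L * b) * ?n b"
  proof (rule DERIV_nonneg_imp_nondecreasing[OF \<open>a \<le> b\<close>])
    fix t assume t: "a \<le> t" "t \<le> b"
    have "((\<lambda>t. exp (2 * L * t) * ?n t) has_real_derivative
        (exp (2 * L * t) * (2 * ((f t - g t) \<bullet> (F (f t) - F (g t))) + 2 * L * ?n t))) (at t)"
      by (rule derivative_eq_intros norm_sq_diff_deriv[OF f g] refl)+ (simp add: algebra_simps)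
    moreover have "exp (2 * L * t) * (2 * ((f t - g t) \<bullet> (F (f t) - F (g t))) + 2 * L * ?n t) \<ge> 0"
      using est[OF t] by (intro mult_nonneg_nonneg) auto
    ultimately show "\<exists>y. ((\<lambda>t. exp (2 * L * t) * ?n t) has_real_derivative y) (at t) \<and> y \<ge> 0" by blast
  qed
  then have "?n a \<le> (exp (L * (b - a)) * norm (f b - g b))\<^sup>2"
    by (simp add: power_mult_distrib exp_double[symmetric] exp_minus exp_diff field_simps
        flip: exp_add)
  then show "norm (f a - g a) \<le> exp (L * (b - a)) * norm (f b - g b)"
    by (rule power2_le_imp_le) simp
qed

lemma sol_bounded_interval:
  assumes "sol f" obtains R where "\<And>t. a \<le> t \<Longrightarrow> t \<le> b \<Longrightarrow> norm (f t) \<le> R"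
proof -
  have "bounded (f ` {a..b})"
    using sol_cont[OF assms] by (intro compact_imp_bounded compact_continuous_image) auto
  then obtain B where "\<forall>x\<in>{a..b}. norm (f x) \<le> B" unfolding bounded_iff by auto
  then show ?thesis by (intro that[of B]) auto
qed

lemma sol_unique:
  assumes f: "sol f" and g: "sol g" and "f s = g s"
  shows "f t = g t"
proof -
  define a b where "a = min s t" and "b = max s t"
  obtain R1 where R1: "\<And>t. a \<le> t \<Longrightarrow> t \<le> b \<Longrightarrow> norm (f t) \<le> R1" using sol_bounded_interval[OF f] by blast
  obtain R2 where R2: "\<And>t. a \<le> t \<Longrightarrow> t \<le> b \<Longrightarrow> norm (g t) \<le> R2" using sol_bounded_interval[OF g] by blast
  obtain L where L: "L \<ge> 0" "\<And>x y. norm x \<le> max R1 R2 \<Longrightarrow> norm y \<le> max R1 R2 \<Longrightarrow> norm (F x - F y) \<le> L * norm (x - y)"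
    using F_lipschitz by blast
  have lip: "norm (F (f t) - F (g t)) \<le> L * norm (f t - g t)" if "a \<le> t" "t \<le> b" for t
    using R1[OF that] R2[OF that] by (intro L) auto
  have "a \<le> b" by (simp add: a_def b_def)
  note gr = gronwall_forward[OF f g L(1) this lip]
  show ?thesis
  proof (cases "s \<le> t")
    case True
    then show ?thesis using gr(1) assms(3) by (auto simp: a_def b_def min_def max_def split: if_splits)
  next
    case False
    then show ?thesis using gr(2) assms(3) by (auto simp: a_def b_def min_def max_def split: if_splits)
  qed
qed

lemma sol_eq_\<Phi>: "sol f \<Longrightarrow> f (t + s) = \<Phi> t (f s)"
  using sol_unique[OF sol_shift[of f s] sol_\<Phi>[of "f s"], of 0 t] by simp

lemma \<Phi>_add: "\<Phi> (t + s) x = \<Phi> t (\<Phi> s x)"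
  using sol_eq_\<Phi>[OF sol_\<Phi>] .

lemma \<Phi>_inj: "\<Phi> t x = \<Phi> t y \<longleftrightarrow> x = y"
  by (metis \<Phi>_0 \<Phi>_add add.left_inverse)

text \<open>The bound on the orbit of \<open>y\<close> is a hypothesis because \<open>F\<close> has
  Lipschitz constants on balls only. Given it, \<open>K\<close> depends on \<open>p\<close>,
  \<open>R\<close> and the window, but not on \<open>y\<close>.\<close>

lemma flow_lipschitz:
  assumes "a \<le> 0" "0 \<le> b"
  obtains K where "K \<ge> 0"
    "\<And>y t. (\<And>s. a \<le> s \<Longrightarrow> s \<le> b \<Longrightarrow> norm (\<Phi> s y) \<le> R) \<Longrightarrow> a \<le> t \<Longrightarrow> t \<le> b \<Longrightarrow>
       norm (\<Phi> t y - \<Phi> t p) \<le> K * norm (y - p)"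
proof -
  obtain R1 where R1: "\<And>t. a \<le> t \<Longrightarrow> t \<le> b \<Longrightarrow> norm (\<Phi> t p) \<le> R1"
    using sol_bounded_interval[OF sol_\<Phi>] by blast
  obtain L where L: "L \<ge> 0" "\<And>x y. norm x \<le> max R R1 \<Longrightarrow> norm y \<le> max R R1 \<Longrightarrow> norm (F x - F y) \<le> L * norm (x - y)"
    using F_lipschitz by blast
  define K where "K = exp (L * (b - a))"
  have "norm (\<Phi> t y - \<Phi> t p) \<le> K * norm (y - p)"
    if R: "\<And>s. a \<le> s \<Longrightarrow> s \<le> b \<Longrightarrow> norm (\<Phi> s y) \<le> R" and t: "a \<le> t" "t \<le> b" for y t
  proof -
    have lip: "norm (F (\<Phi> s y) - F (\<Phi> s p)) \<le> L * norm (\<Phi> s y - \<Phi> s p)" if "a \<le> s" "s \<le> b" for s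
      using R[OF that] R1[OF that] by (intro L) auto
    have "norm (\<Phi> t y - \<Phi> t p) \<le> exp (L * \<bar>t\<bar>) * norm (y - p)"
    proof (cases "t \<ge> 0")
      case True
      then show ?thesis
        using gronwall_forward(1)[OF sol_\<Phi>[of y] sol_\<Phi>[of p] L(1), of 0 t] lip assms t by simp
    next
      case False
      then show ?thesis
        using gronwall_forward(2)[OF sol_\<Phi>[of y] sol_\<Phi>[of p] L(1), of t 0] lip assms t by simp
    qed
    also have "\<dots> \<le> K * norm (y - p)"
      unfolding K_def using t assms L(1) by (intro mult_right_mono) (auto intro!: mult_left_mono)
    finally show ?thesis .
  qed
  then show ?thesis using that[of K] by (simp add: K_def)
qed

lemma continuous_on_\<Phi>_bounded:
  assumes bd: "\<And>x s. x \<in> S \<Longrightarrow> min t 0 \<le> s \<Longrightarrow> s \<le> max t 0 \<Longrightarrow> norm (\<Phi> s x) \<le> R"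
  shows "continuous_on S (\<Phi> t)"
  unfolding continuous_on_iff
proof (intro ballI allI impI)
  fix p and e :: real assume p: "p \<in> S" and e: "e > 0"
  obtain K where K: "K \<ge> 0"
    "\<And>y s. (\<And>r. min t 0 \<le> r \<Longrightarrow> r \<le> max t 0 \<Longrightarrow> norm (\<Phi> r y) \<le> R) \<Longrightarrow> min t 0 \<le> s \<Longrightarrow> s \<le> max t 0 \<Longrightarrow>
       norm (\<Phi> s y - \<Phi> s p) \<le> K * norm (y - p)"
    using flow_lipschitz[of "min t 0" "max t 0" R p] by auto
  have "dist (\<Phi> t y) (\<Phi> t p) < e" if "y \<in> S" "dist y p < e / (K + 1)" for y
  proof -
    have "norm (\<Phi> t y - \<Phi> t p) \<le> K * norm (y - p)" using bd[OF that(1)] by (intro K(2)) auto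
    also have "\<dots> \<le> (K + 1) * norm (y - p)" by (intro mult_right_mono) auto
    also have "\<dots> < e" using that(2) K(1) by (simp add: dist_norm pos_less_divide_eq mult.commute)
    finally show ?thesis by (simp add: dist_norm)
  qed
  then show "\<exists>d>0. \<forall>y\<in>S. dist y p < d \<longrightarrow> dist (\<Phi> t y) (\<Phi> t p) < e"
    using e K(1) by (intro exI[of _ "e / (K + 1)"]) auto
qed

text \<open>Vector functions have no mean value theorem with equality, so it is applied to the
  scalar function \<open>q w \<bullet> F\<close> along the segment.\<close>

lemma mean_value:
  obtains z where "z \<in> closed_segment x y" "2 * (q (y - x) \<bullet> (F y - F x)) = 2 * (q (y - x) \<bullet> DF z (y - x))"
proof -
  define w where "w = y - x"
  define \<phi> where "\<phi> = (\<lambda>s. q w \<bullet> F (x + s *\<^sub>R w))"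
  have der: "(\<phi> has_real_derivative (q w \<bullet> DF (x + s *\<^sub>R w) w)) (at s)" for s
  proof -
    have "((\<lambda>s. x + s *\<^sub>R w) has_vector_derivative w) (at s)"
      by (auto intro!: derivative_eq_intros)
    then have "((\<lambda>s. F (x + s *\<^sub>R w)) has_vector_derivative DF (x + s *\<^sub>R w) w) (at s)"
      using vector_derivative_diff_chain_within[of "\<lambda>s. x + s *\<^sub>R w" w s UNIV F "blinfun_apply (DF (x + s *\<^sub>R w))"]
      by (simp add: o_def has_derivative_at_withinI F_deriv)
    then show ?thesis unfolding \<phi>_def has_real_derivative_iff_has_vector_derivative
      by (rule bounded_linear.has_vector_derivative[OF bounded_linear_inner_right])
  qed
  obtain s where s: "0 < s" "s < 1" "\<phi> 1 - \<phi> 0 = (1 - 0) * (q w \<bullet> DF (x + s *\<^sub>R w) w)"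
    using MVT2[of 0 1 \<phi> "\<lambda>s. q w \<bullet> DF (x + s *\<^sub>R w) w"] der by auto
  have "x + s *\<^sub>R w \<in> closed_segment x y"
    unfolding in_segment using s by (intro exI[of _ s]) (auto simp: w_def algebra_simps)
  moreover have "\<phi> 1 - \<phi> 0 = q w \<bullet> (F y - F x)"
    by (simp add: \<phi>_def w_def inner_diff_right)
  ultimately show ?thesis using that s(3) by (simp add: w_def)
qed

text \<open>At a zero of \<open>V\<close> the term with \<open>lam\<close> drops out of
  \<open>form_neg\<close>, so it does not matter at which point of the segment
  \<open>mean_value\<close> evaluates \<open>DF\<close>. Passing from \<open>V \<le> 0\<close> to
  \<open>V < 0\<close> is the tool for turning the weak inequalities obtained in limits into strict
  ones: go back one unit of time and flow forward.\<close>

lemma ordered_persists: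
  assumes f: "sol f" and g: "sol g" and "f a \<noteq> g a" "V (f a - g a) \<le> 0" "a < b"
  shows "V (f b - g b) < 0"
proof (rule negative_persists[OF V_diff_deriv[OF f g] _ assms(4,5)])
  fix t assume V0: "V (f t - g t) = 0"
  have ne: "f t \<noteq> g t" using sol_unique[OF f g] assms(3) by blast
  obtain z where "2 * (q (f t - g t) \<bullet> (F (f t) - F (g t))) = 2 * (q (f t - g t) \<bullet> DF z (f t - g t))"
    using mean_value[of "g t" "f t"] by blast
  moreover have "2 * (q (f t - g t) \<bullet> DF z (f t - g t)) < 0"
    using form_neg[of "f t - g t" z] ne V0 by (simp add: V_def)
  ultimately show "2 * (q (f t - g t) \<bullet> (F (f t) - F (g t))) < 0" by simp
qed

lemma ordered_flow: "x \<noteq> y \<Longrightarrow> V (x - y) \<le> 0 \<Longrightarrow> t > 0 \<Longrightarrow> V (\<Phi> t x - \<Phi> t y) < 0"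
  using ordered_persists[OF sol_\<Phi>[of x] sol_\<Phi>[of y], of 0 t] by simp

lemma ordered_flow': "x \<noteq> y \<Longrightarrow> V (x - y) < 0 \<Longrightarrow> t \<ge> 0 \<Longrightarrow> V (\<Phi> t x - \<Phi> t y) < 0"
  using ordered_flow[of x y t] by (cases "t = 0") auto

lemma equilibrium_iff: "equilibrium \<Phi> x \<longleftrightarrow> F x = 0"
proof
  assume "equilibrium \<Phi> x"
  then have "(\<lambda>t. \<Phi> t x) = (\<lambda>t. x)" by (auto simp: equilibrium_def)
  then have "((\<lambda>t. x) has_vector_derivative F x) (at 0)"
    using sol_\<Phi>[of x] unfolding sol_def by (metis \<Phi>_0)
  then show "F x = 0" using vector_derivative_unique_at has_vector_derivative_const by blast
next
  assume "F x = 0"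
  then have "sol (\<lambda>t. x)" by (simp add: sol_def)
  then show "equilibrium \<Phi> x"
    using sol_unique[OF sol_\<Phi>[of x], of "\<lambda>t. x" 0] by (simp add: equilibrium_def)
qed

lemma F_nonzero_flow: "F x \<noteq> 0 \<Longrightarrow> F (\<Phi> t x) \<noteq> 0"
  by (metis \<Phi>_0 \<Phi>_add add.right_inverse equilibrium_def equilibrium_iff)

lemma tangent_persists:
  assumes "F x \<noteq> 0" "V (F (\<Phi> a x)) \<le> 0" "a < b"
  shows "V (F (\<Phi> b x)) < 0"
proof (rule negative_persists[OF V_F_deriv[OF sol_\<Phi>] _ assms(2,3)])
  fix t assume "V (F (\<Phi> t x)) = 0"
  then show "2 * (q (F (\<Phi> t x)) \<bullet> DF (\<Phi> t x) (F (\<Phi> t x))) < 0"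
    using form_neg[of "F (\<Phi> t x)" "\<Phi> t x"] F_nonzero_flow[OF assms(1)] by (simp add: V_def)
qed

text \<open>The slack \<open>c\<close> of either sign turns monotonicity of weighted \<open>V\<close> into an exponential rate.\<close>

lemma quantitative:
  obtains \<epsilon> \<kappa> \<rho> where "\<epsilon> > 0" "\<kappa> > 0" "\<rho> > 0"
    "\<And>x v c. norm x \<le> R \<Longrightarrow> \<bar>c\<bar> \<le> \<kappa> \<Longrightarrow>
       2 * (q v \<bullet> DF x v) \<le> - (lam x + c) * V v - \<epsilon> * (norm v)\<^sup>2"
    "\<And>x y c. norm x \<le> R \<Longrightarrow> norm y \<le> R \<Longrightarrow> norm (y - x) \<le> \<rho> \<Longrightarrow> \<bar>c\<bar> \<le> \<kappa> \<Longrightarrow>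
       2 * (q (y - x) \<bullet> (F y - F x)) \<le> - (lam x + c) * V (y - x) - \<epsilon> * (norm (y - x))\<^sup>2"
proof -
  obtain B where B: "B > 0" "\<And>v. \<bar>V v\<bar> \<le> B * (norm v)\<^sup>2" using V_bound by blast
  define m where "m = (\<lambda>(x, v). 2 * (q v \<bullet> blinfun_apply (DF x) v) + lam x * V v)"
  have cm: "continuous_on S m" for S unfolding m_def case_prod_beta
    by (intro continuous_intros continuous_on_compose2[OF DF_cont]) auto
  have "\<exists>\<epsilon>>0. \<forall>x v. norm x \<le> R \<longrightarrow> norm v = 1 \<longrightarrow> m (x, v) \<le> - \<epsilon>"
  proof (cases "cball (0::'a) R \<times> sphere (0::'a) 1 = {}")
    case True
    then have "R < 0" by auto
    then have "\<not> norm x \<le> R" for x :: 'a using norm_ge_zero[of x] by linarith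
    then show ?thesis by (intro exI[of _ 1]) simp
  next
    case False
    then obtain p where p: "p \<in> cball (0::'a) R \<times> sphere (0::'a) 1"
        "\<And>p'. p' \<in> cball (0::'a) R \<times> sphere (0::'a) 1 \<Longrightarrow> m p' \<le> m p"
      using continuous_attains_sup[OF _ False cm] by (metis compact_Times compact_cball compact_sphere)
    have "norm (snd p) = 1" using p(1) by auto
    then have "snd p \<noteq> 0" by auto
    then have "m p < 0" using form_neg[of "snd p" "fst p"] by (simp add: m_def V_def case_prod_beta)
    then show ?thesis using p(2) by (intro exI[of _ "- m p"]) auto
  qed
  then obtain \<epsilon>0 where \<epsilon>0: "\<epsilon>0 > 0" "\<And>x v. norm x \<le> R \<Longrightarrow> norm v = 1 \<Longrightarrow> m (x, v) \<le> - \<epsilon>0" by blast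
  have inf: "2 * (q v \<bullet> DF x v) \<le> - lam x * V v - \<epsilon>0 * (norm v)\<^sup>2" if "norm x \<le> R" for x v
  proof (cases "v = 0")
    case False
    define u where "u = v /\<^sub>R norm v"
    have u: "norm u = 1" "v = norm v *\<^sub>R u" using False by (auto simp: u_def)
    have "m (x, v) = (norm v)\<^sup>2 * m (x, u)"
      by (subst (1) u(2)) (simp add: m_def V_scaleR linear_scale[OF lin_q] blinfun.scaleR_right
          power2_eq_square algebra_simps)
    also have "\<dots> \<le> (norm v)\<^sup>2 * (- \<epsilon>0)" using \<epsilon>0(2)[OF that u(1)] by (intro mult_left_mono) auto
    finally show ?thesis by (simp add: m_def algebra_simps)
  qed simp
  \<comment> \<open>One third pays for the slack \<open>c\<close>, one for replacing
    \<open>lam z\<close> by \<open>lam x\<close>, and one remains.\<close>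
  define \<epsilon> where "\<epsilon> = \<epsilon>0 / 3"
  define \<kappa> where "\<kappa> = \<epsilon> / B"
  have \<epsilon>: "\<epsilon> > 0" and \<kappa>: "\<kappa> > 0" using \<epsilon>0 B by (auto simp: \<epsilon>_def \<kappa>_def)
  have \<kappa>V: "c * V v \<le> \<epsilon> * (norm v)\<^sup>2" if "\<bar>c\<bar> \<le> \<kappa>" for v c
  proof -
    have "c * V v \<le> \<bar>c\<bar> * \<bar>V v\<bar>" by (metis abs_ge_self abs_mult)
    also have "\<dots> \<le> \<kappa> * (B * (norm v)\<^sup>2)" using B(2)[of v] \<kappa> that by (intro mult_mono) auto
    also have "\<dots> = \<epsilon> * (norm v)\<^sup>2" using B by (simp add: \<kappa>_def)
    finally show ?thesis .
  qed
  have "uniformly_continuous_on (cball 0 R) lam"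
    using lam_cont by (intro compact_uniformly_continuous) (auto intro: continuous_on_subset)
  then obtain \<rho>0 where \<rho>0: "\<rho>0 > 0"
      "\<And>x z. x \<in> cball 0 R \<Longrightarrow> z \<in> cball 0 R \<Longrightarrow> dist z x < \<rho>0 \<Longrightarrow> dist (lam z) (lam x) < \<epsilon> / B"
    unfolding uniformly_continuous_on_def using \<epsilon> B by (metis zero_less_divide_iff)
  define \<rho> where "\<rho> = \<rho>0 / 2"
  show ?thesis
  proof
    show "\<epsilon> > 0" "\<kappa> > 0" "\<rho> > 0" using \<epsilon> \<kappa> \<rho>0 by (auto simp: \<rho>_def)
    fix x v :: 'a and c :: real assume "norm x \<le> R" and c: "\<bar>c\<bar> \<le> \<kappa>"
    then have "2 * (q v \<bullet> DF x v) \<le> - lam x * V v - 3 * \<epsilon> * (norm v)\<^sup>2"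
      using inf by (simp add: \<epsilon>_def)
    moreover have "0 \<le> \<epsilon> * (norm v)\<^sup>2" using \<epsilon> by simp
    ultimately show "2 * (q v \<bullet> DF x v) \<le> - (lam x + c) * V v - \<epsilon> * (norm v)\<^sup>2"
      using \<kappa>V[OF c, of v] by (simp add: algebra_simps)
  next
    fix x y :: 'a and c :: real
    assume xy: "norm x \<le> R" "norm y \<le> R" "norm (y - x) \<le> \<rho>" and c: "\<bar>c\<bar> \<le> \<kappa>"
    define w where "w = y - x"
    obtain z where z: "z \<in> closed_segment x y" "2 * (q w \<bullet> (F y - F x)) = 2 * (q w \<bullet> DF z w)"
      using mean_value[of x y] unfolding w_def by blast
    have zR: "z \<in> cball 0 R" using z(1) xy closed_segment_subset[of x "cball 0 R" y] by auto
    have "dist z x \<le> \<rho>" using z(1) xy(3) segment_bound(1)[of z x y] by (simp add: dist_norm)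
    then have "dist (lam z) (lam x) < \<epsilon> / B" using xy \<rho>0 zR by (intro \<rho>0(2)) (auto simp: \<rho>_def)
    then have lz: "\<bar>lam z - lam x\<bar> \<le> \<epsilon> / B" by (simp add: dist_real_def)
    have "- lam z * V w \<le> - lam x * V w + \<bar>lam z - lam x\<bar> * \<bar>V w\<bar>"
    proof -
      have "(lam x - lam z) * V w \<le> \<bar>lam z - lam x\<bar> * \<bar>V w\<bar>"
        by (metis abs_ge_self abs_minus_commute abs_mult)
      then show ?thesis by (simp add: left_diff_distrib)
    qed
    also have "\<bar>lam z - lam x\<bar> * \<bar>V w\<bar> \<le> (\<epsilon> / B) * (B * (norm w)\<^sup>2)"
      using lz B \<epsilon> by (intro mult_mono) auto
    finally have "- lam z * V w \<le> - lam x * V w + \<epsilon> * (norm w)\<^sup>2" using B by simp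
    moreover have "2 * (q w \<bullet> DF z w) \<le> - lam z * V w - 3 * \<epsilon> * (norm w)\<^sup>2"
      using inf[of z w] zR by (simp add: \<epsilon>_def)
    ultimately have "2 * (q w \<bullet> (F y - F x)) \<le> - (lam x + c) * V w - \<epsilon> * (norm w)\<^sup>2"
      using \<kappa>V[OF c, of w] z(2) by (simp add: algebra_simps)
    then show "2 * (q (y - x) \<bullet> (F y - F x)) \<le> - (lam x + c) * V (y - x) - \<epsilon> * (norm (y - x))\<^sup>2"
      by (simp add: w_def)
  qed
qed

text \<open>\<open>exp \<Lambda>\<close> is the integrating factor for the inequalities in
  \<open>quantitative\<close>.\<close>

lemma weight_exists:
  assumes "sol f"
  obtains \<Lambda> where "\<And>t. (\<Lambda> has_real_derivative (lam (f t) + \<kappa>)) (at t)"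
proof -
  have "\<exists>\<Lambda>. \<forall>t. -\<infinity> < ereal t \<longrightarrow> ereal t < \<infinity> \<longrightarrow> (\<Lambda> has_vector_derivative (lam (f t) + \<kappa>)) (at t)"
  proof (rule einterval_antiderivative)
    fix t :: real
    have "continuous_on UNIV (\<lambda>t. lam (f t) + \<kappa>)" by (intro continuous_intros sol_cont[OF assms])
    then show "isCont (\<lambda>t. lam (f t) + \<kappa>) t" by (simp add: continuous_on_eq_continuous_at)
  qed auto
  then show ?thesis using that by (auto simp: has_real_derivative_iff_has_vector_derivative)
qed

end

lemma first_hitting:
  fixes h :: "real \<Rightarrow> real"
  assumes cont: "\<And>t. isCont h t" and "h a < r" "h b \<ge> r" "a \<le> b"
  obtains c where "a \<le> c" "c \<le> b" "h c = r" "\<And>s. a \<le> s \<Longrightarrow> s \<le> c \<Longrightarrow> h s \<le> r"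
proof -
  define T where "T = {a..b} \<inter> h -` {r}"
  have "closed T" unfolding T_def
    using cont by (intro continuous_closed_preimage continuous_at_imp_continuous_on) auto
  moreover have "T \<subseteq> {a..b}" by (auto simp: T_def)
  ultimately have "compact T" by (metis compact_Icc compact_Int_closed inf.absorb_iff2)
  moreover obtain t where "a \<le> t" "t \<le> b" "h t = r" using IVT[of h a r b] assms by auto
  then have "t \<in> T" by (simp add: T_def)
  ultimately obtain c where c: "c \<in> T" "\<And>t. t \<in> T \<Longrightarrow> c \<le> t"
    using compact_attains_inf[of T] by blast
  have "h s \<le> r" if s: "a \<le> s" "s \<le> c" for s
  proof (rule ccontr)
    assume n: "\<not> h s \<le> r"
    then obtain t where t: "a \<le> t" "t \<le> s" "h t = r" using IVT[of h a r s] assms s by auto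
    then have "t \<in> T" using s c(1) by (auto simp: T_def)
    then have "s = t" using c(2)[of t] t s by auto
    then show False using n t by simp
  qed
  then show ?thesis using that c(1) by (auto simp: T_def)
qed

context rank_two_flow
begin

text \<open>Two comparisons along one orbit. The velocity has \<open>V \<le> - c0\<close>, which
  prevents the weight from ever dropping below \<open>c1\<close> times an earlier value. The
  difference has \<open>V \<ge> 0\<close>, so its weighted \<open>V\<close> with slack
  \<open>\<kappa>1\<close> is nonnegative and decreasing, and its total drop bounds the integral of
  the weighted square. Bounding \<open>V\<close> itself would not suffice, as it may vanish at
  nonzero vectors.\<close>

lemma decay:
  assumes R: "\<And>t. t \<ge> t1 \<Longrightarrow> norm (\<Phi> t x) \<le> R" and c0: "c0 > 0" "\<And>t. t \<ge> t1 \<Longrightarrow> V (F (\<Phi> t x)) \<le> - c0"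
  obtains \<eta> K \<kappa> where "\<eta> > 0" "K > 0" "\<kappa> > 0"
    "\<And>g t0 t. sol g \<Longrightarrow> t0 \<ge> t1 \<Longrightarrow> (\<And>s. s \<ge> t0 \<Longrightarrow> norm (g s) \<le> R \<and> 0 \<le> V (g s - \<Phi> s x)) \<Longrightarrow>
       norm (g t0 - \<Phi> t0 x) \<le> \<eta> \<Longrightarrow> t \<ge> t0 \<Longrightarrow>
       norm (g t - \<Phi> t x) \<le> K * exp (- \<kappa> * (t - t0)) * norm (g t0 - \<Phi> t0 x)"
proof -
  obtain \<epsilon> \<kappa>1 \<rho> where q: "\<epsilon> > 0" "\<kappa>1 > 0" "\<rho> > 0"
    "\<And>x v c. norm x \<le> R \<Longrightarrow> \<bar>c\<bar> \<le> \<kappa>1 \<Longrightarrow>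
       2 * (q v \<bullet> DF x v) \<le> - (lam x + c) * V v - \<epsilon> * (norm v)\<^sup>2"
    "\<And>x y c. norm x \<le> R \<Longrightarrow> norm y \<le> R \<Longrightarrow> norm (y - x) \<le> \<rho> \<Longrightarrow> \<bar>c\<bar> \<le> \<kappa>1 \<Longrightarrow>
       2 * (q (y - x) \<bullet> (F y - F x)) \<le> - (lam x + c) * V (y - x) - \<epsilon> * (norm (y - x))\<^sup>2"
    using quantitative[of R] by metis
  obtain B where B: "B > 0" "\<And>v. \<bar>V v\<bar> \<le> B * (norm v)\<^sup>2" using V_bound by blast
  obtain L where L: "L \<ge> 0" "\<And>x y. norm x \<le> R \<Longrightarrow> norm y \<le> R \<Longrightarrow> norm (F x - F y) \<le> L * norm (x - y)"
    using F_lipschitz by blast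
  have "bounded (F ` cball 0 R)"
    by (intro compact_imp_bounded compact_continuous_image F_cont) auto
  then obtain Fm where Fm: "Fm > 0" "\<And>x. norm x \<le> R \<Longrightarrow> norm (F x) \<le> Fm"
    unfolding bounded_pos by auto
  obtain \<Lambda> where \<Lambda>0: "\<And>t. (\<Lambda> has_real_derivative lam (\<Phi> t x) + 0) (at t)"
    using weight_exists[OF sol_\<Phi>] by blast
  then have \<Lambda>: "(\<Lambda> has_real_derivative lam (\<Phi> t x)) (at t)" for t by simp
  \<comment> \<open>Along the orbit \<open>- V\<close> of the velocity is at least \<open>c0\<close>
    and at most \<open>B * Fm\<^sup>2\<close>.\<close>
  define c1 where "c1 = c0 / (B * Fm\<^sup>2)"
  have c1: "c1 > 0" using c0 B Fm by (simp add: c1_def)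
  have low: "c1 * exp (\<Lambda> s) \<le> exp (\<Lambda> t)" if s: "t1 \<le> s" "s \<le> t" for s t
  proof -
    have "exp (\<Lambda> t) * V (F (\<Phi> t x)) \<le> exp (\<Lambda> s) * V (F (\<Phi> s x))"
    proof (rule DERIV_nonpos_imp_nonincreasing[OF s(2)])
      fix r assume r: "s \<le> r" "r \<le> t"
      let ?w = "F (\<Phi> r x)"
      have "((\<lambda>r. exp (\<Lambda> r) * V (F (\<Phi> r x))) has_real_derivative
          exp (\<Lambda> r) * (lam (\<Phi> r x) * V ?w + 2 * (q ?w \<bullet> DF (\<Phi> r x) ?w))) (at r)"
        by (rule derivative_eq_intros \<Lambda> V_F_deriv[OF sol_\<Phi>] refl)+ (simp add: algebra_simps)
      moreover have "2 * (q ?w \<bullet> DF (\<Phi> r x) ?w) \<le> - (lam (\<Phi> r x) + 0) * V ?w - \<epsilon> * (norm ?w)\<^sup>2"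
        using R q s r by (intro q(4)) auto
      then have "lam (\<Phi> r x) * V ?w + 2 * (q ?w \<bullet> DF (\<Phi> r x) ?w) \<le> - (\<epsilon> * (norm ?w)\<^sup>2)" by simp
      then have "lam (\<Phi> r x) * V ?w + 2 * (q ?w \<bullet> DF (\<Phi> r x) ?w) \<le> 0"
        using q(1) by (smt (verit) mult_nonneg_nonneg zero_le_power2)
      then have "exp (\<Lambda> r) * (lam (\<Phi> r x) * V ?w + 2 * (q ?w \<bullet> DF (\<Phi> r x) ?w)) \<le> 0"
        by (intro mult_nonneg_nonpos) auto
      ultimately show "\<exists>y. ((\<lambda>r. exp (\<Lambda> r) * V (F (\<Phi> r x))) has_real_derivative y) (at r) \<and> y \<le> 0"
        by blast
    qed
    also have "\<dots> \<le> exp (\<Lambda> s) * (- c0)" using c0(2)[OF s(1)] by (intro mult_left_mono) auto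
    finally have "c0 * exp (\<Lambda> s) \<le> exp (\<Lambda> t) * (- V (F (\<Phi> t x)))" by (simp add: mult.commute)
    also have "\<dots> \<le> exp (\<Lambda> t) * (B * Fm\<^sup>2)"
    proof (intro mult_left_mono)
      have "- V (F (\<Phi> t x)) \<le> B * (norm (F (\<Phi> t x)))\<^sup>2" using B(2)[of "F (\<Phi> t x)"] by linarith
      also have "\<dots> \<le> B * Fm\<^sup>2" using B Fm R s by (intro mult_left_mono power_mono) auto
      finally show "- V (F (\<Phi> t x)) \<le> B * Fm\<^sup>2" .
    qed simp
    finally show ?thesis using B Fm by (simp add: c1_def field_simps)
  qed
  \<comment> \<open>The estimate controls the square of the distance, so the rate halves when the
    root is taken. In \<open>K\<close> the factor \<open>exp (L + \<kappa>)\<close> covers times up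
    to \<open>t0 + 1\<close> as well as the step from the time \<open>s\<close> found below to
    \<open>t\<close>.\<close>
  define \<kappa> where "\<kappa> = \<kappa>1 / 2"
  define K where "K = exp (L + \<kappa>) * (1 + sqrt (B / (\<epsilon> * c1)))"
  have \<kappa>: "\<kappa> > 0" "\<kappa>1 = 2 * \<kappa>" using q by (auto simp: \<kappa>_def)
  have sqpos: "sqrt (B / (\<epsilon> * c1)) > 0" using B q c1 by simp
  then have K1: "K \<ge> exp (L + \<kappa>)" unfolding K_def by (simp add: mult_le_cancel_left1)
  moreover have "exp (L + \<kappa>) \<ge> 1" using L \<kappa> by simp
  ultimately have K: "K \<ge> 1" by linarith
  have est: "norm (g t - \<Phi> t x) \<le> K * exp (- \<kappa> * (t - t0)) * norm (g t0 - \<Phi> t0 x)"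
    if g: "sol g" and t0: "t0 \<ge> t1" and gs: "\<And>s. s \<ge> t0 \<Longrightarrow> norm (g s) \<le> R \<and> 0 \<le> V (g s - \<Phi> s x)"
      and close: "\<And>s. t0 \<le> s \<Longrightarrow> s \<le> t \<Longrightarrow> norm (g s - \<Phi> s x) \<le> \<rho>" and t: "t \<ge> t0" for g t0 t
  proof -
    define w where "w = (\<lambda>s. g s - \<Phi> s x)"
    have gr: "norm (w b) \<le> exp L * norm (w a)" if ab: "t0 \<le> a" "a \<le> b" "b \<le> a + 1" for a b
    proof -
      have "norm (w b) \<le> exp (L * (b - a)) * norm (w a)"
        unfolding w_def using ab gs R t0 L by (intro gronwall_forward(1) g sol_\<Phi>) auto
      also have "exp (L * (b - a)) \<le> exp L" using ab L(1) by (simp add: mult_left_le)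
      finally show ?thesis by (simp add: mult_right_mono)
    qed
    show ?thesis
    proof (cases "t \<le> t0 + 1")
      case True
      have "norm (w t) \<le> exp L * norm (w t0)" using gr[of t0 t] t True by simp
      also have "exp L \<le> K * exp (- \<kappa> * (t - t0))"
      proof -
        have "exp L \<le> exp (L + \<kappa>) * exp (- \<kappa> * (t - t0))"
          using True \<kappa>(1) by (simp flip: exp_add)
        also have "\<dots> \<le> K * exp (- \<kappa> * (t - t0))" using K1 by (intro mult_right_mono) auto
        finally show ?thesis .
      qed
      finally show ?thesis by (simp add: w_def mult_right_mono)
    next
      case False
      define E where "E = (\<lambda>s. exp (\<Lambda> s + \<kappa>1 * s))"
      define a where "a = (\<lambda>s. E s * V (w s))"
      define a' where "a' = (\<lambda>s. E s * ((lam (\<Phi> s x) + \<kappa>1) * V (w s) + 2 * (q (w s) \<bullet> (F (g s) - F (\<Phi> s x)))))"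
      have E': "(E has_real_derivative E s * (lam (\<Phi> s x) + \<kappa>1)) (at s)" for s
        unfolding E_def by (auto intro!: derivative_eq_intros \<Lambda>)
      have Epos: "E s > 0" for s by (simp add: E_def)
      have da: "(a has_real_derivative a' s) (at s)" for s
        unfolding a_def w_def
        by (rule derivative_eq_intros E' V_diff_deriv[OF g sol_\<Phi>] refl)+ (simp add: a'_def w_def algebra_simps)
      have a'b: "a' s \<le> - (\<epsilon> * E s * (norm (w s))\<^sup>2)" if s: "t0 \<le> s" "s \<le> t" for s
      proof -
        have "2 * (q (w s) \<bullet> (F (g s) - F (\<Phi> s x))) \<le> - (lam (\<Phi> s x) + \<kappa>1) * V (w s) - \<epsilon> * (norm (w s))\<^sup>2"
          unfolding w_def using q close[OF s] gs[of s] R[of s] s t0 by (intro q(5)) auto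
        then have "(lam (\<Phi> s x) + \<kappa>1) * V (w s) + 2 * (q (w s) \<bullet> (F (g s) - F (\<Phi> s x))) \<le> - (\<epsilon> * (norm (w s))\<^sup>2)"
          by (simp add: algebra_simps)
        then have "a' s \<le> E s * (- (\<epsilon> * (norm (w s))\<^sup>2))"
          unfolding a'_def using Epos[of s] by (intro mult_left_mono) auto
        then show ?thesis by (simp add: mult_ac)
      qed
      have "a (t - 1) \<le> a t0"
      proof (rule DERIV_nonpos_imp_nonincreasing[of t0 "t - 1" a])
        show "t0 \<le> t - 1" using False by simp
        fix s assume s: "t0 \<le> s" "s \<le> t - 1"
        have "0 \<le> \<epsilon> * E s * (norm (w s))\<^sup>2" using q(1) Epos[of s] by simp
        then have "a' s \<le> 0" using a'b[of s] s by linarith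
        then show "\<exists>y. (a has_real_derivative y) (at s) \<and> y \<le> 0" using da by blast
      qed
      moreover have "a t \<ge> 0" using gs[of t] t Epos[of t] by (simp add: a_def w_def)
      \<comment> \<open>The mean value theorem on the last unit interval finds one time at which the
        square is small; Gronwall carries this over to \<open>t\<close>.\<close>
      moreover obtain s where s: "t - 1 < s" "s < t" "a t - a (t - 1) = (t - (t - 1)) * a' s"
        using MVT2[of "t - 1" t a a'] da by auto
      ultimately have "\<epsilon> * E s * (norm (w s))\<^sup>2 \<le> a t0" using a'b[of s] s False by simp
      also have "a t0 \<le> E t0 * (B * (norm (w t0))\<^sup>2)"
        unfolding a_def using Epos[of t0] B(2)[of "w t0"] by (intro mult_left_mono) auto
      finally have 1: "\<epsilon> * E s * (norm (w s))\<^sup>2 \<le> E t0 * (B * (norm (w t0))\<^sup>2)" .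
      have "c1 * exp (\<kappa>1 * (t - 1 - t0)) * E t0 = c1 * exp (\<Lambda> t0) * exp (\<kappa>1 * (t - 1))"
        unfolding E_def by (simp add: algebra_simps flip: exp_add)
      also have "\<dots> \<le> exp (\<Lambda> s) * exp (\<kappa>1 * s)"
        using low[of t0 s] t0 s False q(2) by (intro mult_mono) auto
      also have "\<dots> = E s" by (simp add: E_def exp_add)
      finally have 2: "c1 * exp (\<kappa>1 * (t - 1 - t0)) * E t0 \<le> E s" .
      have "E t0 * (\<epsilon> * c1 * exp (\<kappa>1 * (t - 1 - t0)) * (norm (w s))\<^sup>2) =
          \<epsilon> * (c1 * exp (\<kappa>1 * (t - 1 - t0)) * E t0) * (norm (w s))\<^sup>2" by (simp add: mult_ac)
      also have "\<dots> \<le> \<epsilon> * E s * (norm (w s))\<^sup>2"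
        using 2 q(1) by (intro mult_right_mono mult_left_mono) auto
      also note 1
      finally have "\<epsilon> * c1 * exp (\<kappa>1 * (t - 1 - t0)) * (norm (w s))\<^sup>2 \<le> B * (norm (w t0))\<^sup>2"
        using Epos[of t0] by simp
      then have "(norm (w s))\<^sup>2 * exp (\<kappa>1 * (t - 1 - t0)) \<le> B / (\<epsilon> * c1) * (norm (w t0))\<^sup>2"
        using q(1) c1 by (simp add: field_simps)
      then have "(norm (w s))\<^sup>2 * exp (\<kappa>1 * (t - 1 - t0)) * exp (- (\<kappa>1 * (t - 1 - t0)))
          \<le> B / (\<epsilon> * c1) * (norm (w t0))\<^sup>2 * exp (- (\<kappa>1 * (t - 1 - t0)))"
        by (rule mult_right_mono) simp
      then have "(norm (w s))\<^sup>2 \<le> B / (\<epsilon> * c1) * (norm (w t0))\<^sup>2 * exp (- (\<kappa>1 * (t - 1 - t0)))"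
        by (simp only: mult.assoc exp_minus_inverse mult_1_right)
      also have "\<dots> = (sqrt (B / (\<epsilon> * c1)) * exp (\<kappa> - \<kappa> * (t - t0)) * norm (w t0))\<^sup>2"
      proof -
        have "(exp (\<kappa> - \<kappa> * (t - t0)))\<^sup>2 = exp (- (\<kappa>1 * (t - 1 - t0)))"
          by (simp add: \<kappa>(2) exp_double[symmetric] algebra_simps)
        then show ?thesis using B q c1 by (simp add: power_mult_distrib)
      qed
      finally have "norm (w s) \<le> sqrt (B / (\<epsilon> * c1)) * exp (\<kappa> - \<kappa> * (t - t0)) * norm (w t0)"
        by (rule power2_le_imp_le) (use B q c1 in simp)
      then have ws: "exp L * norm (w s) \<le> exp L * (sqrt (B / (\<epsilon> * c1)) * exp (\<kappa> - \<kappa> * (t - t0)) * norm (w t0))"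
        by (intro mult_left_mono) auto
      have ee: "exp L * exp (\<kappa> - \<kappa> * (t - t0)) = exp (L + \<kappa>) * exp (- \<kappa> * (t - t0))"
        by (simp flip: exp_add)
      have "norm (w t) \<le> exp L * norm (w s)" using gr[of s t] s False by simp
      also note ws
      also have "exp L * (sqrt (B / (\<epsilon> * c1)) * exp (\<kappa> - \<kappa> * (t - t0)) * norm (w t0))
          = (exp L * exp (\<kappa> - \<kappa> * (t - t0))) * (sqrt (B / (\<epsilon> * c1)) * norm (w t0))"
        by (simp only: mult_ac)
      also have "\<dots> = (exp (L + \<kappa>) * sqrt (B / (\<epsilon> * c1))) * (exp (- \<kappa> * (t - t0)) * norm (w t0))"
        unfolding ee by (simp only: mult_ac)
      also have "\<dots> \<le> K * (exp (- \<kappa> * (t - t0)) * norm (w t0))"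
        by (intro mult_right_mono) (auto simp: K_def algebra_simps)
      finally show ?thesis by (simp add: w_def mult.assoc)
    qed
  qed
  \<comment> \<open>\<open>K * \<eta> < \<rho>\<close> removes the closeness assumption of
    \<open>est\<close>: at a first time with distance \<open>\<rho>\<close> the estimate would
    already give a smaller distance.\<close>
  define \<eta> where "\<eta> = \<rho> / (2 * K)"
  have \<eta>: "\<eta> > 0" "K * \<eta> < \<rho>" "\<eta> < \<rho>" using q K by (auto simp: \<eta>_def field_simps)
  have main: "norm (g t - \<Phi> t x) \<le> K * exp (- \<kappa> * (t - t0)) * norm (g t0 - \<Phi> t0 x)"
    if g: "sol g" and t0: "t0 \<ge> t1" and gs: "\<And>s. s \<ge> t0 \<Longrightarrow> norm (g s) \<le> R \<and> 0 \<le> V (g s - \<Phi> s x)"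
      and start: "norm (g t0 - \<Phi> t0 x) \<le> \<eta>" and t: "t \<ge> t0" for g t0 t
  proof -
    have "norm (g s - \<Phi> s x) \<le> \<rho>" if s: "t0 \<le> s" for s
    proof (rule ccontr)
      assume n: "\<not> ?thesis"
      have "continuous_on UNIV (\<lambda>s. norm (g s - \<Phi> s x))"
        by (intro continuous_intros sol_cont[OF g])
      then have cont: "isCont (\<lambda>s. norm (g s - \<Phi> s x)) s" for s
        by (simp add: continuous_on_eq_continuous_at)
      obtain c where c: "t0 \<le> c" "norm (g c - \<Phi> c x) = \<rho>" "\<And>s. t0 \<le> s \<Longrightarrow> s \<le> c \<Longrightarrow> norm (g s - \<Phi> s x) \<le> \<rho>"
        using first_hitting[of "\<lambda>s. norm (g s - \<Phi> s x)" t0 \<rho> s] cont n s start \<eta> by auto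
      have "norm (g c - \<Phi> c x) \<le> K * exp (- \<kappa> * (c - t0)) * norm (g t0 - \<Phi> t0 x)"
        using est[OF g t0 gs c(3) c(1)] by blast
      also have "\<dots> \<le> K * 1 * \<eta>"
        using K start c(1) \<kappa> by (intro mult_mono) auto
      finally show False using c(2) \<eta> by simp
    qed
    then show ?thesis using est[OF g t0 gs _ t] by blast
  qed
  have "K > 0" using K by simp
  then show ?thesis using that[OF \<eta>(1) _ \<kappa>(1) main] by blast
qed

end

section \<open>Orbits whose velocity never enters the cone\<close>

context rank_two_flow
begin

text \<open>All three conditions are closed and share the bound \<open>m\<close>, which makes the
  set compact. The union over the positive integers \<open>m\<close> will contain every exceptional
  point.\<close>

definition outside_cone :: "real \<Rightarrow> 'a set" where
  "outside_cone m = {x. \<forall>t\<ge>0. norm (\<Phi> t x) \<le> m \<and> 1 / m \<le> norm (F (\<Phi> t x)) \<and> 0 \<le> V (F (\<Phi> t x))}"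

lemma outside_cone_bound: "x \<in> outside_cone m \<Longrightarrow> 0 \<le> t \<Longrightarrow> norm (\<Phi> t x) \<le> m"
  by (simp add: outside_cone_def)

lemma compact_outside_cone: "compact (outside_cone m)"
proof -
  have "closed (outside_cone m)"
    unfolding closed_sequential_limits
  proof (intro allI impI, elim conjE)
    fix X x assume X: "\<forall>n. X n \<in> outside_cone m" and lim: "X \<longlonglongrightarrow> x"
    have "norm (\<Phi> t x) \<le> m \<and> 1 / m \<le> norm (F (\<Phi> t x)) \<and> 0 \<le> V (F (\<Phi> t x))" if t: "t \<ge> 0" for t
    proof -
      \<comment> \<open>Orbit bounds are at hand for exactly these points: \<open>m\<close> for the
        terms of the sequence, and a bound on the time interval for the limit.\<close>
      have "continuous_on (insert x (range X)) (\<Phi> t)"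
      proof -
        obtain R where R: "\<And>s. 0 \<le> s \<Longrightarrow> s \<le> t \<Longrightarrow> norm (\<Phi> s x) \<le> R"
          using sol_bounded_interval[OF sol_\<Phi>] by blast
        show ?thesis
          by (rule continuous_on_\<Phi>_bounded[of _ _ "max R m"])
            (use R X t in \<open>auto simp: outside_cone_def le_max_iff_disj\<close>)
      qed
      then have L: "(\<lambda>n. \<Phi> t (X n)) \<longlonglongrightarrow> \<Phi> t x"
        by (rule continuous_on_tendsto_compose[OF _ lim]) auto
      have "norm (\<Phi> t x) \<le> m"
        by (rule LIMSEQ_le_const2[OF tendsto_norm[OF L]]) (use X t in \<open>auto simp: outside_cone_def\<close>)
      moreover have "1 / m \<le> norm (F (\<Phi> t x))"
        by (rule LIMSEQ_le_const[OF tendsto_norm[OF tendsto_F[OF L]]]) (use X t in \<open>auto simp: outside_cone_def\<close>)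
      moreover have "0 \<le> V (F (\<Phi> t x))"
        by (rule LIMSEQ_le_const[OF tendsto_V[OF tendsto_F[OF L]]]) (use X t in \<open>auto simp: outside_cone_def\<close>)
      ultimately show ?thesis by blast
    qed
    then show "x \<in> outside_cone m" by (simp add: outside_cone_def)
  qed
  moreover have "bounded (outside_cone m)"
    unfolding bounded_iff using outside_cone_bound[of _ m 0] by (intro exI[of _ m]) auto
  ultimately show ?thesis by (simp add: compact_eq_bounded_closed)
qed

text \<open>Weighted \<open>V\<close> of the velocity, with slack \<open>\<kappa>\<close>, is
  nonnegative and falls at least at the rate \<open>\<epsilon> / m\<^sup>2\<close> times the weight,
  because the velocity is at least \<open>1 / m\<close>. So the weight with slack has small integral
  over a unit interval, and as it cannot change much within a unit of time it is bounded; without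
  the slack it therefore decays.\<close>

lemma outside_cone_weight_decay:
  assumes m: "m > 0"
  obtains K \<kappa> where "K > 0" "\<kappa> > 0"
    "\<And>x \<Lambda> t. x \<in> outside_cone m \<Longrightarrow> (\<And>t. (\<Lambda> has_real_derivative lam (\<Phi> t x)) (at t)) \<Longrightarrow> \<Lambda> 0 = 0 \<Longrightarrow>
       t \<ge> 0 \<Longrightarrow> exp (\<Lambda> t) \<le> K * exp (- \<kappa> * t)"
proof -
  obtain \<epsilon> \<kappa> \<rho> where q: "\<epsilon> > 0" "\<kappa> > 0"
    "\<And>x v c. norm x \<le> m \<Longrightarrow> \<bar>c\<bar> \<le> \<kappa> \<Longrightarrow>
       2 * (q v \<bullet> DF x v) \<le> - (lam x + c) * V v - \<epsilon> * (norm v)\<^sup>2"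
    using quantitative[of m] by metis
  obtain B where B: "B > 0" "\<And>v. \<bar>V v\<bar> \<le> B * (norm v)\<^sup>2" using V_bound by blast
  have "bounded (F ` cball 0 m)"
    by (intro compact_imp_bounded compact_continuous_image F_cont) auto
  then obtain Fm where Fm: "Fm > 0" "\<And>x. norm x \<le> m \<Longrightarrow> norm (F x) \<le> Fm"
    unfolding bounded_pos by auto
  have "bounded (lam ` cball 0 m)"
    by (intro compact_imp_bounded compact_continuous_image continuous_on_subset[OF lam_cont]) auto
  then obtain lm where lm: "lm > 0" "\<And>x. norm x \<le> m \<Longrightarrow> \<bar>lam x\<bar> \<le> lm"
    unfolding bounded_pos by auto
  \<comment> \<open>\<open>B * Fm\<^sup>2\<close> bounds the initial value,
    \<open>m\<^sup>2 / \<epsilon>\<close> comes from the rate, and \<open>exp lm\<close> from the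
    variation of the weight within a unit of time.\<close>
  define K where "K = B * Fm\<^sup>2 * m\<^sup>2 * exp lm / \<epsilon>"
  have K: "K > 0" using B Fm m q by (simp add: K_def)
  have "exp (\<Lambda> t) \<le> K * exp (- \<kappa> * t)"
    if x: "x \<in> outside_cone m" and \<Lambda>: "\<And>t. (\<Lambda> has_real_derivative lam (\<Phi> t x)) (at t)"
      and \<Lambda>0: "\<Lambda> 0 = 0" and t: "t \<ge> 0" for x \<Lambda> t
  proof -
    define E where "E = (\<lambda>t. exp (\<Lambda> t + \<kappa> * t))"
    define a where "a = (\<lambda>t. E t * V (F (\<Phi> t x)))"
    define a' where "a' = (\<lambda>t. E t * ((lam (\<Phi> t x) + \<kappa>) * V (F (\<Phi> t x)) + 2 * (q (F (\<Phi> t x)) \<bullet> DF (\<Phi> t x) (F (\<Phi> t x)))))"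
    have xb: "norm (\<Phi> s x) \<le> m" "1 / m \<le> norm (F (\<Phi> s x))" "0 \<le> V (F (\<Phi> s x))" if "s \<ge> 0" for s
      using x that by (auto simp: outside_cone_def)
    have E': "(E has_real_derivative E s * (lam (\<Phi> s x) + \<kappa>)) (at s)" for s
      unfolding E_def by (auto intro!: derivative_eq_intros \<Lambda>)
    have da: "(a has_real_derivative a' s) (at s)" for s
      unfolding a_def
      by (rule derivative_eq_intros E' V_F_deriv[OF sol_\<Phi>] refl)+ (simp add: a'_def algebra_simps)
    have a'b: "a' s \<le> - (\<epsilon> / m\<^sup>2 * E s)" if s: "s \<ge> 0" for s
    proof -
      have "2 * (q (F (\<Phi> s x)) \<bullet> DF (\<Phi> s x) (F (\<Phi> s x))) \<le> - (lam (\<Phi> s x) + \<kappa>) * V (F (\<Phi> s x)) - \<epsilon> * (norm (F (\<Phi> s x)))\<^sup>2"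
        using q xb[OF s] by (intro q(3)) auto
      moreover have "(1 / m)\<^sup>2 \<le> (norm (F (\<Phi> s x)))\<^sup>2" using xb[OF s] m by (intro power_mono) auto
      then have "\<epsilon> * (1 / m)\<^sup>2 \<le> \<epsilon> * (norm (F (\<Phi> s x)))\<^sup>2" using q by simp
      ultimately have "(lam (\<Phi> s x) + \<kappa>) * V (F (\<Phi> s x)) + 2 * (q (F (\<Phi> s x)) \<bullet> DF (\<Phi> s x) (F (\<Phi> s x))) \<le> - (\<epsilon> / m\<^sup>2)"
        by (simp add: power_divide algebra_simps)
      then have "a' s \<le> E s * (- (\<epsilon> / m\<^sup>2))" unfolding a'_def by (intro mult_left_mono) (auto simp: E_def)
      then show ?thesis by (simp add: mult.commute)
    qed
    have a'neg: "a' s \<le> 0" if "s \<ge> 0" for s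
    proof -
      have "0 \<le> \<epsilon> / m\<^sup>2 * E s" using q by (simp add: E_def)
      then show ?thesis using a'b[OF that] by linarith
    qed
    have "a t \<le> a 0"
      by (rule DERIV_nonpos_imp_nonincreasing[OF t]) (use da a'neg in blast)
    also have "a 0 \<le> B * Fm\<^sup>2"
    proof -
      have "V (F x) \<le> B * (norm (F x))\<^sup>2" using B(2)[of "F x"] by linarith
      also have "\<dots> \<le> B * Fm\<^sup>2" using B Fm(2)[of x] xb[of 0] by (intro mult_left_mono power_mono) auto
      finally show ?thesis by (simp add: a_def E_def \<Lambda>0)
    qed
    finally have at: "a t \<le> B * Fm\<^sup>2" .
    obtain s where s: "t < s" "s < t + 1" "a (t + 1) - a t = (t + 1 - t) * a' s"
      using MVT2[of t "t + 1" a a'] da by auto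
    have "a (t + 1) \<ge> 0" using xb[of "t + 1"] t by (auto simp: a_def E_def)
    then have "\<epsilon> / m\<^sup>2 * E s \<le> a t" using s(3) a'b[of s] s(1) t by simp
    moreover have "exp (- lm) * E t \<le> E s"
    proof -
      obtain r where r: "t < r" "r < s" "\<Lambda> s - \<Lambda> t = (s - t) * lam (\<Phi> r x)"
        using MVT2[of t s \<Lambda> "\<lambda>t. lam (\<Phi> t x)"] \<Lambda> s(1) by auto
      have "\<bar>(s - t) * lam (\<Phi> r x)\<bar> \<le> 1 * lm"
        unfolding abs_mult using s lm(2)[OF xb(1)[of r]] r t by (intro mult_mono) auto
      then have "- lm + \<Lambda> t \<le> \<Lambda> s" using r(3) by linarith
      moreover have "\<kappa> * t \<le> \<kappa> * s" using q s by auto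
      ultimately show ?thesis unfolding E_def exp_add[symmetric] by simp
    qed
    ultimately have "\<epsilon> / m\<^sup>2 * (exp (- lm) * E t) \<le> B * Fm\<^sup>2"
      using at q m by (smt (verit, best) mult_left_mono divide_nonneg_nonneg zero_le_power2)
    then have "E t \<le> K" using q m by (simp add: K_def exp_minus field_simps)
    then have "E t * exp (- \<kappa> * t) \<le> K * exp (- \<kappa> * t)" by (intro mult_right_mono) auto
    then show ?thesis by (simp add: E_def flip: exp_add)
  qed
  then show ?thesis using that[OF K q(2)] by blast
qed

text \<open>The weighted \<open>V\<close> of the difference starts at or below
  \<open>- (norm u)\<^sup>2\<close> and decreases, while the weight decays. Hence \<open>- V\<close>
  grows exponentially, and the cone condition hands the growth on to the projection.\<close>

lemma outside_cone_expansion: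
  fixes \<iota> :: "complex \<Rightarrow> 'a"
  assumes m: "m > 0" and \<iota>: "linear \<iota>" "\<And>u. V (\<iota> u) \<le> - (norm u)\<^sup>2" and M: "M > 0"
  obtains t \<epsilon> where "t \<ge> 0" "\<epsilon> > 0"
    "\<And>x u. x \<in> outside_cone m \<Longrightarrow> x + \<iota> u \<in> outside_cone m \<Longrightarrow> norm (\<iota> u) \<le> \<epsilon> \<Longrightarrow>
       M * norm u \<le> norm (\<pi> (\<Phi> t (x + \<iota> u)) - \<pi> (\<Phi> t x))"
proof -
  obtain K \<kappa> where K: "K > 0" "\<kappa> > 0"
    "\<And>x \<Lambda> t. x \<in> outside_cone m \<Longrightarrow> (\<And>t. (\<Lambda> has_real_derivative lam (\<Phi> t x)) (at t)) \<Longrightarrow> \<Lambda> 0 = 0 \<Longrightarrow>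
       t \<ge> 0 \<Longrightarrow> exp (\<Lambda> t) \<le> K * exp (- \<kappa> * t)"
    using outside_cone_weight_decay[OF m] by metis
  obtain \<epsilon>1 \<kappa>1 \<rho> where q: "\<epsilon>1 > 0" "\<kappa>1 > 0" "\<rho> > 0"
    "\<And>x y c. norm x \<le> m \<Longrightarrow> norm y \<le> m \<Longrightarrow> norm (y - x) \<le> \<rho> \<Longrightarrow> \<bar>c\<bar> \<le> \<kappa>1 \<Longrightarrow>
       2 * (q (y - x) \<bullet> (F y - F x)) \<le> - (lam x + c) * V (y - x) - \<epsilon>1 * (norm (y - x))\<^sup>2"
    using quantitative[of m] by metis
  obtain B where B: "B > 0" "\<And>v. \<bar>V v\<bar> \<le> B * (norm v)\<^sup>2" using V_bound by blast
  obtain L where L: "L \<ge> 0" "\<And>x y. norm x \<le> m \<Longrightarrow> norm y \<le> m \<Longrightarrow> norm (F x - F y) \<le> L * norm (x - y)"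
    using F_lipschitz by blast
  \<comment> \<open>The chain of estimates loses \<open>K\<close>, \<open>B\<close> and
    \<open>C\<^sup>2\<close>; \<open>P\<close> is what \<open>exp (\<kappa> * t)\<close> must reach
    to leave the factor \<open>M\<close>.\<close>
  define P where "P = M\<^sup>2 * K * B * C\<^sup>2"
  have P: "P > 0" using M K B C_pos by (simp add: P_def)
  define t where "t = max 0 (ln P / \<kappa>)"
  have t: "t \<ge> 0" "P \<le> exp (\<kappa> * t)"
  proof -
    have "ln P / \<kappa> \<le> t" by (simp add: t_def)
    then have "ln P \<le> \<kappa> * t" using K(2) by (simp add: pos_divide_le_eq mult.commute)
    then have "exp (ln P) \<le> exp (\<kappa> * t)" by (simp only: exp_le_cancel_iff)
    then show "P \<le> exp (\<kappa> * t)" using P by simp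
  qed (simp add: t_def)
  \<comment> \<open>By Gronwall, points this close stay within \<open>\<rho>\<close> up to time
    \<open>t\<close>, as \<open>quantitative\<close> demands.\<close>
  define \<epsilon> where "\<epsilon> = \<rho> * exp (- L * t)"
  have \<epsilon>: "\<epsilon> > 0" using q by (simp add: \<epsilon>_def)
  have "M * norm u \<le> norm (\<pi> (\<Phi> t (x + \<iota> u)) - \<pi> (\<Phi> t x))"
    if x: "x \<in> outside_cone m" and y: "x + \<iota> u \<in> outside_cone m" and u: "norm (\<iota> u) \<le> \<epsilon>" for x u
  proof -
    define y where "y = x + \<iota> u"
    have xb: "norm (\<Phi> s x) \<le> m" "norm (\<Phi> s y) \<le> m" if "s \<ge> 0" for s
      using x y that by (auto simp: outside_cone_def y_def)
    have close: "norm (\<Phi> s y - \<Phi> s x) \<le> \<rho>" if s: "0 \<le> s" "s \<le> t" for s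
    proof -
      have "norm (\<Phi> s y - \<Phi> s x) \<le> exp (L * (s - 0)) * norm (\<Phi> 0 y - \<Phi> 0 x)"
        using s L xb by (intro gronwall_forward(1) sol_\<Phi>) auto
      also have "\<dots> \<le> exp (L * t) * \<epsilon>"
        using u s L by (intro mult_mono) (auto simp: y_def intro!: mult_left_mono)
      also have "\<dots> = \<rho>" by (simp add: \<epsilon>_def flip: exp_add mult.assoc)
      finally show ?thesis .
    qed
    obtain \<Lambda>1 where \<Lambda>1: "\<And>t. (\<Lambda>1 has_real_derivative lam (\<Phi> t x) + 0) (at t)"
      using weight_exists[OF sol_\<Phi>] by blast
    define \<Lambda> where "\<Lambda> = (\<lambda>t. \<Lambda>1 t - \<Lambda>1 0)"
    have \<Lambda>: "(\<Lambda> has_real_derivative lam (\<Phi> t x)) (at t)" "\<Lambda> 0 = 0" for t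
      using \<Lambda>1[of t] by (auto simp: \<Lambda>_def intro!: derivative_eq_intros)
    have "exp (\<Lambda> t) * V (\<Phi> t y - \<Phi> t x) \<le> exp (\<Lambda> 0) * V (\<Phi> 0 y - \<Phi> 0 x)"
    proof (rule DERIV_nonpos_imp_nonincreasing[OF t(1)])
      fix s assume s: "0 \<le> s" "s \<le> t"
      let ?w = "\<Phi> s y - \<Phi> s x"
      have "((\<lambda>s. exp (\<Lambda> s) * V (\<Phi> s y - \<Phi> s x)) has_real_derivative
          exp (\<Lambda> s) * (lam (\<Phi> s x) * V ?w + 2 * (q ?w \<bullet> (F (\<Phi> s y) - F (\<Phi> s x))))) (at s)"
        by (rule derivative_eq_intros \<Lambda> V_diff_deriv[OF sol_\<Phi> sol_\<Phi>] refl)+ (simp add: algebra_simps)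
      moreover have "2 * (q ?w \<bullet> (F (\<Phi> s y) - F (\<Phi> s x))) \<le> - (lam (\<Phi> s x) + 0) * V ?w - \<epsilon>1 * (norm ?w)\<^sup>2"
        using xb close s q by (intro q(4)) auto
      then have "lam (\<Phi> s x) * V ?w + 2 * (q ?w \<bullet> (F (\<Phi> s y) - F (\<Phi> s x))) \<le> - (\<epsilon>1 * (norm ?w)\<^sup>2)"
        by simp
      then have "lam (\<Phi> s x) * V ?w + 2 * (q ?w \<bullet> (F (\<Phi> s y) - F (\<Phi> s x))) \<le> 0"
        using q(1) by (smt (verit) mult_nonneg_nonneg zero_le_power2)
      then have "exp (\<Lambda> s) * (lam (\<Phi> s x) * V ?w + 2 * (q ?w \<bullet> (F (\<Phi> s y) - F (\<Phi> s x)))) \<le> 0"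
        by (intro mult_nonneg_nonpos) auto
      ultimately show "\<exists>y'. ((\<lambda>s. exp (\<Lambda> s) * V (\<Phi> s y - \<Phi> s x)) has_real_derivative y') (at s) \<and> y' \<le> 0"
        by blast
    qed
    then have VL: "exp (\<Lambda> t) * V (\<Phi> t y - \<Phi> t x) \<le> - (norm u)\<^sup>2"
      using \<iota>(2)[of u] \<Lambda>(2) by (simp add: y_def)
    let ?w = "\<Phi> t y - \<Phi> t x"
    have neg: "V ?w \<le> 0"
    proof (rule ccontr)
      assume "\<not> ?thesis"
      then have "exp (\<Lambda> t) * V ?w > 0" by simp
      then show False using VL by (smt (verit) zero_le_power2)
    qed
    have "(norm u)\<^sup>2 \<le> exp (\<Lambda> t) * (- V ?w)" using VL by simp
    also have "\<dots> \<le> (K * exp (- \<kappa> * t)) * (- V ?w)"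
      using K(3)[OF x \<Lambda>(1) \<Lambda>(2) t(1)] neg by (intro mult_right_mono) auto
    also have "\<dots> \<le> (K * exp (- \<kappa> * t)) * (B * (norm ?w)\<^sup>2)"
      using B(2)[of ?w] K by (intro mult_left_mono) auto
    also have "\<dots> \<le> (K * exp (- \<kappa> * t)) * (B * (C * norm (\<pi> ?w))\<^sup>2)"
      using cone_V[OF neg] K B by (intro mult_left_mono power_mono) auto
    finally have "(norm u)\<^sup>2 * exp (\<kappa> * t) \<le> K * B * C\<^sup>2 * (norm (\<pi> ?w))\<^sup>2"
      by (simp add: exp_minus field_simps power_mult_distrib)
    moreover have "(norm u)\<^sup>2 * P \<le> (norm u)\<^sup>2 * exp (\<kappa> * t)"
      using t(2) by (intro mult_left_mono) auto
    ultimately have "(K * B * C\<^sup>2) * ((M * norm u)\<^sup>2) \<le> (K * B * C\<^sup>2) * (norm (\<pi> ?w))\<^sup>2"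
      by (simp add: P_def power_mult_distrib algebra_simps)
    then have "(M * norm u)\<^sup>2 \<le> (norm (\<pi> ?w))\<^sup>2" using K B C_pos by simp
    then have "M * norm u \<le> norm (\<pi> ?w)" by (rule power2_le_imp_le) simp
    then show ?thesis by (simp add: pi_diff y_def)
  qed
  then show ?thesis using that[OF t(1) \<epsilon>] by blast
qed

text \<open>The projected flow maps each slice parallel to the negative plane into a fixed disc and
  expands close pairs by any factor \<open>M\<close>. Pairs further apart are merely kept apart, by
  injectivity and compactness, which the \<open>min\<close> in
  \<open>negligible_if_expandable\<close> tolerates.\<close>

lemma negligible_outside_cone:
  fixes \<iota> :: "complex \<Rightarrow> 'a"
  assumes m: "m > 0" and \<iota>: "linear \<iota>" "\<And>u. V (\<iota> u) \<le> - (norm u)\<^sup>2"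
  shows "negligible (outside_cone m)"
proof (rule negligible_if_slices_negligible[OF compact_imp_closed[OF compact_outside_cone] \<iota>(1)])
  fix z :: 'a
  define A where "A = {u. z + \<iota> u \<in> outside_cone m}"
  obtain B where B: "B > 0" "\<And>v. \<bar>V v\<bar> \<le> B * (norm v)\<^sup>2" using V_bound by blast
  have bl: "bounded_linear \<iota>" using \<iota>(1) by (simp add: linear_conv_bounded_linear)
  then have c\<iota>: "continuous_on S (\<lambda>u. z + \<iota> u)" for S
    by (intro continuous_on_add continuous_on_const linear_continuous_on)
  obtain N where N: "N > 0" "\<And>u. norm (\<iota> u) \<le> norm u * N"
    using bounded_linear.pos_bounded[OF bl] by blast
  obtain P where P: "P > 0" "\<And>u. norm (\<pi> u) \<le> norm u * P"
    using bounded_linear.pos_bounded[OF bl_pi] by blast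
  \<comment> \<open>Negativity of \<open>V\<close> on the plane bounds \<open>\<iota>\<close> from
    below, so slices of a bounded set are bounded.\<close>
  have low: "norm u \<le> sqrt B * norm (\<iota> u)" for u
  proof -
    have "(norm u)\<^sup>2 \<le> B * (norm (\<iota> u))\<^sup>2" using \<iota>(2)[of u] B(2)[of "\<iota> u"] by linarith
    then have "(norm u)\<^sup>2 \<le> (sqrt B * norm (\<iota> u))\<^sup>2" using B(1) by (simp add: power_mult_distrib)
    then show ?thesis by (rule power2_le_imp_le) (use B(1) in auto)
  qed
  have bound_m: "norm x \<le> m" if "x \<in> outside_cone m" for x
    using outside_cone_bound[OF that, of 0] by simp
  have "closed A"
  proof -
    have "closed ((\<lambda>u. z + \<iota> u) -` outside_cone m)"
      using c\<iota>[of UNIV] compact_imp_closed[OF compact_outside_cone]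
      by (intro continuous_closed_vimage) (auto simp: continuous_on_eq_continuous_at)
    then show ?thesis by (simp add: A_def vimage_def)
  qed
  moreover have "bounded A"
    unfolding bounded_iff
  proof (intro exI[of _ "sqrt B * (m + norm z)"] ballI)
    fix u assume "u \<in> A"
    then have "norm (z + \<iota> u) \<le> m" using bound_m by (simp add: A_def)
    then have "norm (\<iota> u) \<le> m + norm z" using norm_triangle_ineq4[of "z + \<iota> u" z] by simp
    then have "sqrt B * norm (\<iota> u) \<le> sqrt B * (m + norm z)" using B(1) by (intro mult_left_mono) auto
    then show "norm u \<le> sqrt B * (m + norm z)" using low[of u] by linarith
  qed
  ultimately have cA: "compact A" by (simp add: compact_eq_bounded_closed)
  have "negligible A"
  proof (rule negligible_if_expandable[OF cA, of "P * m"])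
    fix M :: real assume M: "M > 0"
    obtain t \<epsilon> where t: "t \<ge> 0" "\<epsilon> > 0" and expand: "\<And>x u. x \<in> outside_cone m \<Longrightarrow> x + \<iota> u \<in> outside_cone m \<Longrightarrow> norm (\<iota> u) \<le> \<epsilon> \<Longrightarrow>
       M * norm u \<le> norm (\<pi> (\<Phi> t (x + \<iota> u)) - \<pi> (\<Phi> t x))"
      using outside_cone_expansion[OF m \<iota> M] by metis
    define g where "g = (\<lambda>u. \<pi> (\<Phi> t (z + \<iota> u)))"
    have near: "M * norm (u - v) \<le> norm (g u - g v)" if "u \<in> A" "v \<in> A" "norm (u - v) \<le> \<epsilon> / N" for u v
    proof -
      have e: "z + \<iota> v + \<iota> (u - v) = z + \<iota> u" by (simp add: linear_diff[OF \<iota>(1)])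
      have "norm (\<iota> (u - v)) \<le> \<epsilon>" using N(2)[of "u - v"] that(3) N(1) by (simp add: pos_le_divide_eq)
      then show ?thesis using expand[of "z + \<iota> v" "u - v"] that unfolding e by (simp add: A_def g_def)
    qed
    have c\<Phi>: "continuous_on (outside_cone m) (\<Phi> t)"
      by (rule continuous_on_\<Phi>_bounded[of _ _ m]) (use t(1) in \<open>auto simp: outside_cone_def\<close>)
    have cg: "continuous_on A g" unfolding g_def
      by (intro continuous_intros continuous_on_compose2[OF c\<Phi> c\<iota>]) (auto simp: A_def)
    have inj: "norm (g u - g v) > 0" if "u \<noteq> v" for u v
    proof -
      have "V (\<iota> (u - v)) < 0" using \<iota>(2)[of "u - v"] that
        by (smt (verit) zero_less_norm_iff right_minus_eq zero_less_power)
      moreover have d: "(z + \<iota> u) - (z + \<iota> v) = \<iota> (u - v)" by (simp add: linear_diff[OF \<iota>(1)])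
      ultimately have "V (\<Phi> t (z + \<iota> u) - \<Phi> t (z + \<iota> v)) < 0"
        using t(1) by (intro ordered_flow') (auto simp: d)
      then have "\<pi> (\<Phi> t (z + \<iota> u) - \<Phi> t (z + \<iota> v)) \<noteq> 0"
        using cone_V[of "\<Phi> t (z + \<iota> u) - \<Phi> t (z + \<iota> v)"] by fastforce
      then show ?thesis by (simp add: g_def pi_diff)
    qed
    define D where "D = (A \<times> A) \<inter> {p. \<epsilon> / N \<le> norm (fst p - snd p)}"
    have "closed {p :: complex \<times> complex. \<epsilon> / N \<le> norm (fst p - snd p)}"
      by (intro closed_Collect_le continuous_intros)
    then have cD: "compact D" unfolding D_def using cA by (intro compact_Int_closed compact_Times) auto
    have "continuous_on D (\<lambda>p. norm (g (fst p) - g (snd p)))"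
      by (intro continuous_intros continuous_on_compose2[OF cg]) (auto simp: D_def)
    then obtain c where c: "c > 0" "\<And>p. p \<in> D \<Longrightarrow> c \<le> norm (g (fst p) - g (snd p))"
    proof (cases "D = {}")
      case False
      then obtain p where p: "p \<in> D" "\<And>p'. p' \<in> D \<Longrightarrow> norm (g (fst p) - g (snd p)) \<le> norm (g (fst p') - g (snd p'))"
        using continuous_attains_inf[OF cD False \<open>continuous_on D _\<close>] by blast
      have "fst p \<noteq> snd p" using p(1) t(2) N(1) by (auto simp: D_def divide_le_0_iff)
      then show ?thesis using that[of "norm (g (fst p) - g (snd p))"] inj p(2) by blast
    qed (use that[of 1] in auto)
    \<comment> \<open>Distances up to \<open>\<epsilon> / N\<close> are expanded by
      \<open>near\<close>; beyond that the images are at least \<open>c\<close> apart, and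
      \<open>M\<close> times the cap \<open>c / M\<close> does not exceed this gap.\<close>
    define e where "e = min (\<epsilon> / N) (c / M)"
    have "e > 0" using t N c M by (simp add: e_def)
    moreover have "norm (g u) \<le> P * m" if "u \<in> A" for u
    proof -
      have "norm (\<Phi> t (z + \<iota> u)) \<le> m" using that t(1) by (auto simp: A_def outside_cone_def)
      then have "norm (\<Phi> t (z + \<iota> u)) * P \<le> m * P" using P(1) by simp
      then show ?thesis using P(2)[of "\<Phi> t (z + \<iota> u)"] by (simp add: g_def mult.commute)
    qed
    moreover have "M * min (norm (u - v)) e \<le> norm (g u - g v)" if "u \<in> A" "v \<in> A" for u v
    proof (cases "norm (u - v) \<le> \<epsilon> / N")
      case True
      have "M * min (norm (u - v)) e \<le> M * norm (u - v)" using M by (intro mult_left_mono) auto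
      then show ?thesis using near[OF that True] by linarith
    next
      case False
      then have "c \<le> norm (g u - g v)" using c(2)[of "(u, v)"] that by (auto simp: D_def)
      moreover have "M * min (norm (u - v)) e \<le> M * (c / M)" using M by (intro mult_left_mono) (auto simp: e_def)
      ultimately show ?thesis using M by simp
    qed
    ultimately show "\<exists>\<epsilon>>0. \<exists>g::complex \<Rightarrow> complex. (\<forall>u\<in>A. norm (g u) \<le> P * m) \<and>
          (\<forall>u\<in>A. \<forall>v\<in>A. M * min (norm (u - v)) \<epsilon> \<le> norm (g u - g v))"
      by blast
  qed
  then show "negligible {u. z + \<iota> u \<in> outside_cone m}" by (simp add: A_def)
qed

end

section \<open>Limit sets of orbits with velocity in the cone\<close>

lemma omega_limit_iff:
  fixes \<Phi> :: "real \<Rightarrow> 'a::metric_space \<Rightarrow> 'a"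
  shows "y \<in> omega_limit \<Phi> x \<longleftrightarrow> (\<forall>e>0. \<forall>s. \<exists>t\<ge>s. dist (\<Phi> t x) y < e)"
proof
  assume y: "y \<in> omega_limit \<Phi> x"
  show "\<forall>e>0. \<forall>s. \<exists>t\<ge>s. dist (\<Phi> t x) y < e"
  proof (intro allI impI)
    fix e s :: real assume "e > 0"
    have "y \<in> closure (\<Union>t\<in>{max 0 s..}. {\<Phi> t x})" using y by (auto simp: omega_limit_def)
    then obtain t where "t \<in> {max 0 s..}" "dist (\<Phi> t x) y < e"
      using \<open>e > 0\<close> unfolding closure_approachable by auto
    then show "\<exists>t\<ge>s. dist (\<Phi> t x) y < e" by (intro exI[of _ t]) auto
  qed
next
  assume "\<forall>e>0. \<forall>s. \<exists>t\<ge>s. dist (\<Phi> t x) y < e"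
  then have "y \<in> closure (\<Union>t\<in>{s..}. {\<Phi> t x})" for s
    unfolding closure_approachable by fastforce
  then show "y \<in> omega_limit \<Phi> x" by (simp add: omega_limit_def)
qed

lemma omega_limit_sequence:
  fixes \<Phi> :: "real \<Rightarrow> 'a::metric_space \<Rightarrow> 'a"
  assumes "y \<in> omega_limit \<Phi> x"
  obtains \<tau> where "\<And>n. real n \<le> \<tau> n" "(\<lambda>n. \<Phi> (\<tau> n) x) \<longlonglongrightarrow> y"
proof -
  have "\<forall>n. \<exists>t\<ge>real n. dist (\<Phi> t x) y < inverse (real (Suc n))"
    using assms unfolding omega_limit_iff by simp
  then obtain \<tau> where \<tau>: "\<And>n. real n \<le> \<tau> n" "\<And>n. dist (\<Phi> (\<tau> n) x) y < inverse (real (Suc n))"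
    by metis
  have "(\<lambda>n. dist (\<Phi> (\<tau> n) x) y) \<longlonglongrightarrow> 0"
    by (rule tendsto_sandwich[OF _ _ tendsto_const LIMSEQ_inverse_real_of_nat])
      (use \<tau>(2) in \<open>auto intro!: always_eventually less_imp_le\<close>)
  then have "(\<lambda>n. \<Phi> (\<tau> n) x) \<longlonglongrightarrow> y" by (rule tendsto_dist_iff[THEN iffD2])
  then show ?thesis using that \<tau>(1) by blast
qed

lemma omega_limitI:
  fixes \<Phi> :: "real \<Rightarrow> 'a::metric_space \<Rightarrow> 'a"
  assumes "filterlim \<tau> at_top sequentially" "(\<lambda>n. \<Phi> (\<tau> n) x) \<longlonglongrightarrow> y"
  shows "y \<in> omega_limit \<Phi> x"
  unfolding omega_limit_iff
proof (intro allI impI)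
  fix e s :: real assume "e > 0"
  have "eventually (\<lambda>n. \<tau> n \<ge> s) sequentially" using assms(1) by (simp add: filterlim_at_top)
  moreover have "eventually (\<lambda>n. dist (\<Phi> (\<tau> n) x) y < e) sequentially"
    using assms(2) \<open>e > 0\<close> by (rule tendstoD)
  ultimately have "eventually (\<lambda>n. \<tau> n \<ge> s \<and> dist (\<Phi> (\<tau> n) x) y < e) sequentially"
    by (rule eventually_conj)
  then show "\<exists>t\<ge>s. dist (\<Phi> t x) y < e" by (auto dest: eventually_happens)
qed

lemma compact_subsequence:
  fixes S :: "'a::metric_space set"
  assumes "compact S" "\<And>n. f n \<in> S"
  obtains l r where "l \<in> S" "strict_mono (r :: nat \<Rightarrow> nat)" "(\<lambda>n. f (r n)) \<longlonglongrightarrow> l"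
proof -
  have "\<exists>l\<in>S. \<exists>r. strict_mono (r :: nat \<Rightarrow> nat) \<and> (f \<circ> r) \<longlonglongrightarrow> l"
    using assms unfolding compact_def by blast
  then show ?thesis using that unfolding o_def by blast
qed

lemma filterlim_real_le: "(\<And>n. real n \<le> \<tau> n) \<Longrightarrow> filterlim \<tau> at_top sequentially"
  by (rule filterlim_at_top_mono[OF filterlim_real_sequentially]) auto

context rank_two_flow
begin

lemma periodic_shift:
  assumes "\<Phi> T p = p" shows "\<Phi> (t + T) p = \<Phi> t p" "\<Phi> (t - T) p = \<Phi> t p"
proof -
  show 1: "\<Phi> (t + T) p = \<Phi> t p" for t using assms by (simp add: \<Phi>_add)
  show "\<Phi> (t - T) p = \<Phi> t p" using 1[of "t - T"] by simp
qed

lemma periodic_range: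
  assumes "T > 0" "\<Phi> T p = p"
  shows "range (\<lambda>t. \<Phi> t p) = (\<lambda>t. \<Phi> t p) ` {0..T}"
proof -
  have nat: "\<Phi> (t + real k * T) p = \<Phi> t p" for t k
  proof (induction k)
    case (Suc k)
    have "\<Phi> (t + real (Suc k) * T) p = \<Phi> ((t + real k * T) + T) p" by (simp add: algebra_simps)
    then show ?case using periodic_shift(1)[OF assms(2)] Suc by simp
  qed simp
  have int: "\<Phi> (t + of_int k * T) p = \<Phi> t p" for t k
  proof (cases "k \<ge> 0")
    case True then show ?thesis using nat[of t "nat k"] by simp
  next
    case False
    then show ?thesis using nat[of "t + of_int k * T" "nat (-k)"] by (simp add: algebra_simps)
  qed
  have "\<Phi> t p \<in> (\<lambda>t. \<Phi> t p) ` {0..T}" for t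
  proof -
    define k where "k = \<lfloor>t / T\<rfloor>"
    have "of_int k \<le> t / T" "t / T \<le> of_int k + 1" unfolding k_def by linarith+
    then have "t + of_int (- k) * T \<in> {0..T}" using assms(1) by (auto simp: field_simps)
    then show ?thesis using int[of t "-k"] by (metis image_eqI)
  qed
  then show ?thesis by blast
qed

lemma compact_periodic:
  assumes "T > 0" "\<Phi> T p = p" shows "compact (range (\<lambda>t. \<Phi> t p))"
  unfolding periodic_range[OF assms] by (intro compact_continuous_image continuous_intros) auto

lemma omega_limit_shift: "omega_limit \<Phi> (\<Phi> c x) = omega_limit \<Phi> x"
proof -
  have "(\<exists>t\<ge>s. dist (\<Phi> (t + c) x) y < e) \<longleftrightarrow> (\<exists>t\<ge>s + c. dist (\<Phi> t x) y < e)" for y e s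
  proof
    assume "\<exists>t\<ge>s. dist (\<Phi> (t + c) x) y < e"
    then obtain t where "t \<ge> s" "dist (\<Phi> (t + c) x) y < e" by blast
    then show "\<exists>t\<ge>s + c. dist (\<Phi> t x) y < e" by (intro exI[of _ "t + c"]) simp
  next
    assume "\<exists>t\<ge>s + c. dist (\<Phi> t x) y < e"
    then obtain t where "t \<ge> s + c" "dist (\<Phi> t x) y < e" by blast
    then show "\<exists>t\<ge>s. dist (\<Phi> (t + c) x) y < e" by (intro exI[of _ "t - c"]) simp
  qed
  note shift = this
  have "y \<in> omega_limit \<Phi> (\<Phi> c x) \<longleftrightarrow> y \<in> omega_limit \<Phi> x" for y
  proof
    assume "y \<in> omega_limit \<Phi> (\<Phi> c x)"
    then have all: "\<exists>t\<ge>s + c. dist (\<Phi> t x) y < e" if "e > 0" for e s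
      using that unfolding omega_limit_iff \<Phi>_add[symmetric] shift by blast
    show "y \<in> omega_limit \<Phi> x"
      unfolding omega_limit_iff using all[of _ "s - c" for s] by simp
  next
    assume "y \<in> omega_limit \<Phi> x"
    then show "y \<in> omega_limit \<Phi> (\<Phi> c x)"
      unfolding omega_limit_iff \<Phi>_add[symmetric] shift by blast
  qed
  then show ?thesis by blast
qed

end

section \<open>Shadowing and compactness for bounded orbits without equilibria in the limit\<close>

locale bounded_orbit = rank_two_flow +
  fixes x :: 'a and R :: real
  assumes X_bound: "\<And>t. t \<ge> 0 \<Longrightarrow> norm (\<Phi> t x) \<le> R"
    and no_equilibrium: "\<And>y. y \<in> omega_limit \<Phi> x \<Longrightarrow> F y \<noteq> 0"
begin

abbreviation X where "X t \<equiv> \<Phi> t x"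
abbreviation \<Omega> where "\<Omega> \<equiv> omega_limit \<Phi> x"

text \<open>The condition \<open>\<tau> + a \<ge> 0\<close> keeps the shifted window in forward
  time, where the orbit is bounded; this is why \<open>K\<close> can be independent of
  \<open>\<tau>\<close>.\<close>

lemma shadow:
  assumes "a \<le> 0" "0 \<le> b"
  obtains K where "K > 0"
    "\<And>\<tau> t. \<tau> + a \<ge> 0 \<Longrightarrow> a \<le> t \<Longrightarrow> t \<le> b \<Longrightarrow> norm (X (t + \<tau>) - \<Phi> t y) \<le> K * norm (X \<tau> - y)"
proof -
  obtain K where K: "K \<ge> 0" "\<And>z t. (\<And>s. a \<le> s \<Longrightarrow> s \<le> b \<Longrightarrow> norm (\<Phi> s z) \<le> R) \<Longrightarrow> a \<le> t \<Longrightarrow> t \<le> b \<Longrightarrow>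
       norm (\<Phi> t z - \<Phi> t y) \<le> K * norm (z - y)"
    using flow_lipschitz[OF assms, of R y] by metis
  have "norm (X (t + \<tau>) - \<Phi> t y) \<le> (K + 1) * norm (X \<tau> - y)" if "\<tau> + a \<ge> 0" "a \<le> t" "t \<le> b" for \<tau> t
  proof -
    have "norm (\<Phi> t (X \<tau>) - \<Phi> t y) \<le> K * norm (X \<tau> - y)"
      using that by (intro K(2)) (auto simp: X_bound \<Phi>_add[symmetric])
    also have "\<dots> \<le> (K + 1) * norm (X \<tau> - y)" by (intro mult_right_mono) auto
    finally show ?thesis by (simp add: \<Phi>_add)
  qed
  then show ?thesis using that[of "K + 1"] K(1) by simp
qed

lemma shadow_tendsto:
  assumes \<tau>: "filterlim \<tau> at_top sequentially" and lim: "(\<lambda>n. X (\<tau> n)) \<longlonglongrightarrow> y"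
  shows "(\<lambda>n. X (t + \<tau> n)) \<longlonglongrightarrow> \<Phi> t y"
proof -
  obtain K where K: "\<And>\<tau> s. \<tau> + min t 0 \<ge> 0 \<Longrightarrow> min t 0 \<le> s \<Longrightarrow> s \<le> max t 0 \<Longrightarrow>
      norm (X (s + \<tau>) - \<Phi> s y) \<le> K * norm (X \<tau> - y)"
    by (rule shadow[of "min t 0" "max t 0" y]) auto
  have "(\<lambda>n. X (t + \<tau> n) - \<Phi> t y) \<longlonglongrightarrow> 0"
  proof (rule Lim_null_comparison)
    have "eventually (\<lambda>n. \<tau> n \<ge> - min t 0) sequentially" using \<tau> by (simp add: filterlim_at_top)
    then show "eventually (\<lambda>n. norm (X (t + \<tau> n) - \<Phi> t y) \<le> K * norm (X (\<tau> n) - y)) sequentially"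
      by eventually_elim (rule K, auto)
    have "(\<lambda>n. X (\<tau> n) - y) \<longlonglongrightarrow> 0" using lim by (simp add: LIM_zero)
    then have "(\<lambda>n. K * norm (X (\<tau> n) - y)) \<longlonglongrightarrow> K * norm (0::'a)" by (intro tendsto_intros)
    then show "(\<lambda>n. K * norm (X (\<tau> n) - y)) \<longlonglongrightarrow> 0" by simp
  qed
  then show ?thesis by (simp add: LIM_zero_iff)
qed

lemma omega_invariant:
  assumes "y \<in> \<Omega>" shows "\<Phi> t y \<in> \<Omega>"
proof -
  obtain \<tau> where \<tau>: "\<And>n. real n \<le> \<tau> n" "(\<lambda>n. X (\<tau> n)) \<longlonglongrightarrow> y"
    using omega_limit_sequence[OF assms] by blast
  have "filterlim (\<lambda>n. t + \<tau> n) at_top sequentially"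
    by (rule filterlim_tendsto_add_at_top[OF tendsto_const filterlim_real_le[OF \<tau>(1)]])
  then show ?thesis using shadow_tendsto[OF filterlim_real_le[OF \<tau>(1)] \<tau>(2)] by (rule omega_limitI)
qed

lemma omega_bound:
  assumes "y \<in> \<Omega>" shows "norm (\<Phi> t y) \<le> R"
proof -
  have "norm y \<le> R" if y: "y \<in> \<Omega>" for y
  proof -
    obtain \<tau> where \<tau>: "\<And>n. real n \<le> \<tau> n" "(\<lambda>n. X (\<tau> n)) \<longlonglongrightarrow> y"
      using omega_limit_sequence[OF y] by blast
    have "norm (X (\<tau> n)) \<le> R" for n using \<tau>(1)[of n] by (intro X_bound) linarith
    then show ?thesis using LIMSEQ_le_const2[OF tendsto_norm[OF \<tau>(2)]] by blast
  qed
  then show ?thesis using omega_invariant[OF assms] by blast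
qed

lemma compact_omega: "compact \<Omega>"
proof -
  have "closed \<Omega>" unfolding omega_limit_def by (intro closed_INT) auto
  moreover have "bounded \<Omega>" unfolding bounded_iff using omega_bound[of _ 0] by auto
  ultimately show ?thesis by (simp add: compact_eq_bounded_closed)
qed

lemma omega_accumulation:
  assumes "\<And>n. real n \<le> \<tau> n"
  obtains y r where "y \<in> \<Omega>" "strict_mono (r :: nat \<Rightarrow> nat)" "(\<lambda>n. X (\<tau> (r n))) \<longlonglongrightarrow> y"
    "\<And>n. real n \<le> \<tau> (r n)"
proof -
  have "0 \<le> \<tau> n" for n using assms[of n] of_nat_0_le_iff[of n] by linarith
  then have "X (\<tau> n) \<in> cball 0 R" for n using X_bound by simp
  then obtain y r where yr: "strict_mono (r :: nat \<Rightarrow> nat)" "(\<lambda>n. X (\<tau> (r n))) \<longlonglongrightarrow> y"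
    using compact_subsequence[OF compact_cball[of 0 R], of "\<lambda>n. X (\<tau> n)"] by blast
  have ge: "real n \<le> \<tau> (r n)" for n
    using assms[of "r n"] seq_suble[OF yr(1), of n] by linarith
  have "y \<in> \<Omega>" using omega_limitI[where \<tau> = "\<lambda>n. \<tau> (r n)" and \<Phi> = \<Phi> and x = x, OF filterlim_real_le[OF ge] yr(2)] .
  then show ?thesis using that yr ge by blast
qed

lemma periodic_orbitI:
  assumes p: "p \<in> \<Omega>" and T: "T > 0" "\<Phi> T p = p" and sub: "\<And>y. y \<in> \<Omega> \<Longrightarrow> \<exists>t. y = \<Phi> t p"
  shows "periodic_orbit \<Phi> \<Omega>"
  unfolding periodic_orbit_def
proof (intro exI conjI)
  show "\<not> equilibrium \<Phi> p" using no_equilibrium[OF p] by (simp add: equilibrium_iff)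
  show "\<Omega> = range (\<lambda>t. \<Phi> t p)" using sub omega_invariant[OF p] by blast
qed (use T in auto)

text \<open>Late times are handled by accumulation at a point of the limit set, early ones by
  compactness. The orbit itself is not at rest, since an equilibrium would be its own limit
  point.\<close>

lemma F_bounded_below:
  obtains c where "c > 0" "\<And>t. t \<ge> 0 \<Longrightarrow> c \<le> norm (F (X t))"
proof -
  have Fx: "F x \<noteq> 0"
  proof
    assume "F x = 0"
    then have "X t = x" for t using equilibrium_iff[of x] by (simp add: equilibrium_def)
    then have "x \<in> \<Omega>" unfolding omega_limit_iff by auto
    then show False using no_equilibrium \<open>F x = 0\<close> by blast
  qed
  have "\<exists>n. \<forall>t\<ge>real n. inverse (real (Suc n)) \<le> norm (F (X t))"
  proof (rule ccontr)
    assume "\<not> ?thesis"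
    then have "\<forall>n. \<exists>t\<ge>real n. norm (F (X t)) < inverse (real (Suc n))" by (simp add: not_le)
    then obtain \<tau> where \<tau>: "\<And>n. real n \<le> \<tau> n" "\<And>n. norm (F (X (\<tau> n))) < inverse (real (Suc n))" by metis
    obtain y r where y: "y \<in> \<Omega>" "strict_mono (r :: nat \<Rightarrow> nat)" "(\<lambda>n. X (\<tau> (r n))) \<longlonglongrightarrow> y"
      using omega_accumulation[OF \<tau>(1)] by metis
    have "(\<lambda>n. inverse (real (Suc (r n)))) \<longlonglongrightarrow> 0"
      using LIMSEQ_subseq_LIMSEQ[OF LIMSEQ_inverse_real_of_nat y(2)] by (simp add: o_def)
    then have "norm (F y) \<le> 0"
      by (rule LIMSEQ_le[OF tendsto_norm[OF tendsto_F[OF y(3)]]]) (use \<tau>(2) in \<open>auto intro!: exI[of _ 0] less_imp_le\<close>)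
    then show False using no_equilibrium[OF y(1)] by simp
  qed
  then obtain n where n: "\<And>t. t \<ge> real n \<Longrightarrow> inverse (real (Suc n)) \<le> norm (F (X t))" by blast
  have "continuous_on {0..real n} (\<lambda>t. norm (F (X t)))" by (intro continuous_intros)
  moreover have "{0..real n} \<noteq> {}" by simp
  ultimately obtain s where s: "\<And>t. t \<in> {0..real n} \<Longrightarrow> norm (F (X s)) \<le> norm (F (X t))"
    using continuous_attains_inf[OF compact_Icc] by blast
  define c where "c = min (inverse (real (Suc n))) (norm (F (X s)))"
  have "c > 0" using F_nonzero_flow[OF Fx, of s] by (simp add: c_def)
  moreover have "c \<le> norm (F (X t))" if "t \<ge> 0" for t
    using n[of t] s[of t] that by (cases "t \<ge> real n") (auto simp: c_def)
  ultimately show ?thesis using that by blast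
qed

lemma periodic_omega_if_periodic:
  assumes T: "T > 0" "\<Phi> T x = x" shows "periodic_orbit \<Phi> \<Omega>"
proof (rule periodic_orbitI[OF _ T])
  show "x \<in> \<Omega>"
    unfolding omega_limit_iff
  proof (intro allI impI)
    fix e s :: real assume "e > 0"
    obtain k :: nat where "s / T \<le> real k" using real_arch_simple by blast
    then have "s \<le> real k * T" using T(1) by (simp add: field_simps)
    moreover have "X (real k * T) = x"
    proof (induction k)
      case (Suc k)
      then show ?case using periodic_shift(1)[OF T(2), of "real k * T"] by (simp add: algebra_simps)
    qed simp
    ultimately show "\<exists>t\<ge>s. dist (X t) x < e" using \<open>e > 0\<close> by (metis dist_self)
  qed
  fix y assume "y \<in> \<Omega>"
  then obtain \<tau> where "(\<lambda>n. X (\<tau> n)) \<longlonglongrightarrow> y" using omega_limit_sequence by blast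
  then have "y \<in> range X"
    by (rule closed_sequentially[OF compact_imp_closed[OF compact_periodic[OF T]] rangeI])
  then show "\<exists>t. y = \<Phi> t x" by blast
qed

end

section \<open>Orbits with velocity inside the cone and their time shifts\<close>

locale tangent_orbit = bounded_orbit +
  assumes tangent: "\<And>t. t \<ge> 0 \<Longrightarrow> V (F (\<Phi> t x)) < 0"
    and aperiodic: "\<And>s t. s \<noteq> t \<Longrightarrow> \<Phi> s x \<noteq> \<Phi> t x"
begin

text \<open>Limits give the weak inequality only; applied at \<open>\<Phi> (-1) y\<close> and
  followed by the flow for one unit of time, it becomes strict.\<close>

lemma tangent_omega:
  assumes y: "y \<in> \<Omega>" shows "V (F y) < 0"
proof -
  have le: "V (F z) \<le> 0" if z: "z \<in> \<Omega>" for z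
  proof -
    obtain \<tau> where \<tau>: "\<And>n. real n \<le> \<tau> n" "(\<lambda>n. X (\<tau> n)) \<longlonglongrightarrow> z"
      using omega_limit_sequence[OF z] by blast
    have "V (F (X (\<tau> n))) \<le> 0" for n using \<tau>(1)[of n] tangent[of "\<tau> n"] by auto
    then show ?thesis using LIMSEQ_le_const2[OF tendsto_V[OF tendsto_F[OF \<tau>(2)]]] by blast
  qed
  have "V (F (\<Phi> 1 (\<Phi> (-1) y))) < 0"
    using tangent_persists[of "\<Phi> (-1) y" 0 1] le[OF omega_invariant[OF y, of "-1"]]
      no_equilibrium[OF omega_invariant[OF y, of "-1"]] by simp
  then show ?thesis by (simp flip: \<Phi>_add)
qed

lemma tangent_uniform:
  obtains t1 c0 where "t1 \<ge> 0" "c0 > 0" "\<And>t. t \<ge> t1 \<Longrightarrow> V (F (X t)) \<le> - c0"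
proof -
  have "\<exists>n. \<forall>t\<ge>real n. V (F (X t)) \<le> - inverse (real (Suc n))"
  proof (rule ccontr)
    assume "\<not> ?thesis"
    then have "\<forall>n. \<exists>t\<ge>real n. V (F (X t)) > - inverse (real (Suc n))" by (simp add: not_le)
    then obtain \<tau> where \<tau>: "\<And>n. real n \<le> \<tau> n" "\<And>n. V (F (X (\<tau> n))) > - inverse (real (Suc n))" by metis
    obtain y r where y: "y \<in> \<Omega>" "strict_mono (r :: nat \<Rightarrow> nat)" "(\<lambda>n. X (\<tau> (r n))) \<longlonglongrightarrow> y"
      using omega_accumulation[OF \<tau>(1)] by metis
    have "(\<lambda>n. - inverse (real (Suc (r n)))) \<longlonglongrightarrow> - 0"
      using LIMSEQ_subseq_LIMSEQ[OF LIMSEQ_inverse_real_of_nat y(2)] by (intro tendsto_minus) (simp add: o_def)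
    then have "- 0 \<le> V (F y)"
      by (rule LIMSEQ_le[OF _ tendsto_V[OF tendsto_F[OF y(3)]]]) (use \<tau>(2) in \<open>auto intro!: exI[of _ 0] less_imp_le\<close>)
    then show False using tangent_omega[OF y(1)] by simp
  qed
  then obtain n where "\<forall>t\<ge>real n. V (F (X t)) \<le> - inverse (real (Suc n))" by blast
  then show ?thesis using that[of "real n" "inverse (real (Suc n))"] by auto
qed

lemma orbit_decay:
  obtains t1 \<eta> K \<kappa> where "t1 \<ge> 0" "\<eta> > 0" "K > 0" "\<kappa> > 0"
    "\<And>g t0 t. sol g \<Longrightarrow> t0 \<ge> t1 \<Longrightarrow> (\<And>s. s \<ge> t0 \<Longrightarrow> norm (g s) \<le> R \<and> 0 \<le> V (g s - X s)) \<Longrightarrow>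
       norm (g t0 - X t0) \<le> \<eta> \<Longrightarrow> t \<ge> t0 \<Longrightarrow>
       norm (g t - X t) \<le> K * exp (- \<kappa> * (t - t0)) * norm (g t0 - X t0)"
proof -
  obtain t1 c0 where t1: "t1 \<ge> 0" "c0 > 0" "\<And>t. t \<ge> t1 \<Longrightarrow> V (F (X t)) \<le> - c0"
    using tangent_uniform by blast
  have "norm (X t) \<le> R" if "t \<ge> t1" for t using that t1(1) by (intro X_bound) auto
  from decay[OF this t1(2,3)] show ?thesis using that[OF t1(1)] by metis
qed

lemma ordered_shift:
  assumes "V (X (t0 + s) - X t0) \<le> 0" "s \<noteq> 0" "t > t0"
  shows "V (X (t + s) - X t) < 0"
  using ordered_persists[OF sol_shift[OF sol_\<Phi>[of x], of s] sol_\<Phi>[of x], of t0 t] assms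
    aperiodic[of "t0 + s" t0] by auto

lemma ordered_shift_omega:
  assumes "V (X (t0 + s) - X t0) \<le> 0" "s \<noteq> 0" "y \<in> \<Omega>"
  shows "V (\<Phi> s y - y) \<le> 0"
proof -
  obtain \<tau> where \<tau>: "\<And>n. real n \<le> \<tau> n" "(\<lambda>n. X (\<tau> n)) \<longlonglongrightarrow> y"
    using omega_limit_sequence[OF assms(3)] by blast
  have "(\<lambda>n. V (X (s + \<tau> n) - X (\<tau> n))) \<longlonglongrightarrow> V (\<Phi> s y - y)"
    by (intro tendsto_intros shadow_tendsto filterlim_real_le \<tau>)
  moreover have "eventually (\<lambda>n. V (X (s + \<tau> n) - X (\<tau> n)) \<le> 0) sequentially"
  proof -
    have "eventually (\<lambda>n. \<tau> n > t0) sequentially"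
      using filterlim_real_le[OF \<tau>(1)] by (simp add: filterlim_at_top_dense)
    then show ?thesis
    proof eventually_elim
      case (elim n)
      then show ?case using ordered_shift[OF assms(1,2) elim] by (simp add: add.commute)
    qed
  qed
  ultimately show ?thesis by (rule tendsto_upperbound) simp
qed

text \<open>The difference quotient tends to \<open>F x\<close>, which lies in the open cone, and
  \<open>V\<close> is homogeneous. This keeps the infimum of the unordered shifts positive.\<close>

lemma initially_ordered:
  obtains s0 where "s0 > 0" "\<And>s. 0 < s \<Longrightarrow> s < s0 \<Longrightarrow> V (X s - X 0) < 0"
proof -
  have "((\<lambda>t. \<Phi> t x) has_vector_derivative F x) (at 0)" using sol_\<Phi>[of x] unfolding sol_def by (metis \<Phi>_0)
  then have "((\<lambda>t. (1 / norm (t - 0)) *\<^sub>R (X t - (X 0 + (t - 0) *\<^sub>R F x))) \<longlongrightarrow> 0) (at 0)"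
    unfolding has_vector_derivative_def has_derivative_at2 by blast
  then have L: "((\<lambda>t. norm ((1 / norm (t - 0)) *\<^sub>R (X t - (X 0 + (t - 0) *\<^sub>R F x)))) \<longlongrightarrow> 0) (at 0)"
    by (rule tendsto_norm_zero)
  have "((\<lambda>t. norm ((1 / t) *\<^sub>R (X t - X 0) - F x)) \<longlongrightarrow> 0) (at 0)"
  proof (rule Lim_transform_eventually[OF L])
    have "norm ((1 / norm (t - 0)) *\<^sub>R (X t - (X 0 + (t - 0) *\<^sub>R F x))) = norm ((1 / t) *\<^sub>R (X t - X 0) - F x)"
      if "t \<noteq> 0" for t :: real
    proof -
      have "(1 / t) *\<^sub>R (X t - X 0) - F x = (1 / t) *\<^sub>R (X t - (X 0 + t *\<^sub>R F x))"
        using that by (simp add: scaleR_diff_right scaleR_add_right)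
      then show ?thesis by simp
    qed
    then show "\<forall>\<^sub>F t in at 0. norm ((1 / norm (t - 0)) *\<^sub>R (X t - (X 0 + (t - 0) *\<^sub>R F x))) = norm ((1 / t) *\<^sub>R (X t - X 0) - F x)"
      unfolding eventually_at_filter by simp
  qed
  then have "((\<lambda>t. (1 / t) *\<^sub>R (X t - X 0)) \<longlongrightarrow> F x) (at 0)"
    by (rule LIM_zero_cancel[OF tendsto_norm_zero_cancel])
  then have "((\<lambda>t. V ((1 / t) *\<^sub>R (X t - X 0))) \<longlongrightarrow> V (F x)) (at 0)" by (rule tendsto_V)
  moreover have "V (F x) < 0" using tangent[of 0] by simp
  ultimately have "eventually (\<lambda>t. V ((1 / t) *\<^sub>R (X t - X 0)) < 0) (at 0)" by (rule order_tendstoD)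
  then obtain d where d: "d > 0" "\<And>t. t \<noteq> 0 \<Longrightarrow> \<bar>t\<bar> < d \<Longrightarrow> V ((1 / t) *\<^sub>R (X t - X 0)) < 0"
    unfolding eventually_at by (auto simp: dist_real_def)
  have "V (X s - X 0) < 0" if "0 < s" "s < d" for s
    using d(2)[of s] that by (simp add: V_scaleR divide_less_0_iff power_divide)
  then show ?thesis using that d(1) by blast
qed

text \<open>Each shift below the infimum \<open>s1\<close> is ordered from some time on, so it is
  weakly ordered on the limit set; \<open>s1\<close> is approached by shifts that are never ordered.
  On the limit set both signs meet in \<open>V = 0\<close> for the shift \<open>s1\<close>. For two
  distinct points this would become strict after one unit of time, so \<open>s1\<close> is a
  period.\<close>

lemma periodic_if_unordered_shift:
  assumes "s > 0" "\<And>t. t \<ge> 0 \<Longrightarrow> V (X (t + s) - X t) > 0"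
  shows "periodic_orbit \<Phi> \<Omega>"
proof -
  define S where "S = {s. s > 0 \<and> (\<forall>t\<ge>0. V (X (t + s) - X t) > 0)}"
  obtain s0 where s0: "s0 > 0" "\<And>s. 0 < s \<Longrightarrow> s < s0 \<Longrightarrow> V (X s - X 0) < 0"
    using initially_ordered by blast
  have Sge: "s0 \<le> s" if "s \<in> S" for s
  proof (rule ccontr)
    assume "\<not> s0 \<le> s"
    then have "V (X s - X 0) < 0" using s0(2)[of s] that by (auto simp: S_def)
    moreover have "V (X (0 + s) - X 0) > 0" using that unfolding S_def by blast
    ultimately show False by simp
  qed
  have Sne: "S \<noteq> {}" using assms by (auto simp: S_def)
  have bdd: "bdd_below S" using Sge by (auto simp: bdd_below_def)
  define s1 where "s1 = Inf S"
  have s1: "s1 > 0" using cInf_greatest[OF Sne Sge] s0(1) by (simp add: s1_def)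
  have cV: "continuous_on UNIV (\<lambda>s. V (X (t + s) - X t))" for t by (intro continuous_intros)
  have s1ge: "V (X (t + s1) - X t) \<ge> 0" if t: "t \<ge> 0" for t
  proof (rule ccontr)
    assume "\<not> ?thesis"
    then have neg: "V (X (t + s1) - X t) < 0" by simp
    have "isCont (\<lambda>s. V (X (t + s) - X t)) s1"
      using cV[of t] by (simp add: continuous_on_eq_continuous_at)
    then have "eventually (\<lambda>s. V (X (t + s) - X t) < 0) (at s1)"
      unfolding isCont_def using neg by (rule order_tendstoD)
    then obtain d where d: "d > 0" "\<And>s. s \<noteq> s1 \<Longrightarrow> \<bar>s - s1\<bar> < d \<Longrightarrow> V (X (t + s) - X t) < 0"
      unfolding eventually_at by (auto simp: dist_real_def)
    obtain s' where s': "s' \<in> S" "s' < s1 + d"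
      using cInf_less_iff[OF Sne bdd, of "s1 + d"] d(1) by (auto simp: s1_def)
    have "s1 \<le> s'" using cInf_lower[OF s'(1) bdd] by (simp add: s1_def)
    then have "V (X (t + s') - X t) < 0" using d(2)[of s'] neg s'(2) by (cases "s' = s1") auto
    moreover have "V (X (t + s') - X t) > 0" using s'(1) t by (auto simp: S_def)
    ultimately show False by simp
  qed
  have below: "V (\<Phi> s y - y) \<le> 0" if s: "0 < s" "s < s1" and y: "y \<in> \<Omega>" for s y
  proof -
    have "s \<notin> S" using cInf_lower[OF _ bdd, of s] s by (auto simp: s1_def)
    then obtain t where "t \<ge> 0" "V (X (t + s) - X t) \<le> 0" using s by (auto simp: S_def not_less)
    then show ?thesis using ordered_shift_omega[of t s y] s y by auto
  qed
  have zero: "V (\<Phi> s1 y - y) = 0" if y: "y \<in> \<Omega>" for y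
  proof (rule antisym)
    have "((\<lambda>s. V (\<Phi> s y - y)) \<longlongrightarrow> V (\<Phi> s1 y - y)) (at_left s1)"
      by (intro tendsto_intros tendsto_\<Phi>_time)
    moreover have "eventually (\<lambda>s. V (\<Phi> s y - y) \<le> 0) (at_left s1)"
      using below y s1 by (auto simp: eventually_at_left_field intro!: exI[of _ 0])
    ultimately show "V (\<Phi> s1 y - y) \<le> 0" by (rule tendsto_upperbound) simp
    obtain \<tau> where \<tau>: "\<And>n. real n \<le> \<tau> n" "(\<lambda>n. X (\<tau> n)) \<longlonglongrightarrow> y"
      using omega_limit_sequence[OF y] by blast
    have "(\<lambda>n. V (X (s1 + \<tau> n) - X (\<tau> n))) \<longlonglongrightarrow> V (\<Phi> s1 y - y)"
      by (intro tendsto_intros shadow_tendsto filterlim_real_le \<tau>)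
    moreover have "0 \<le> V (X (s1 + \<tau> n) - X (\<tau> n))" for n
      using s1ge[of "\<tau> n"] \<tau>(1)[of n] by (simp add: add.commute)
    ultimately show "0 \<le> V (\<Phi> s1 y - y)" using LIMSEQ_le_const by blast
  qed
  have per: "\<Phi> s1 y = y" if y: "y \<in> \<Omega>" for y
  proof (rule ccontr)
    assume "\<Phi> s1 y \<noteq> y"
    then have "V (\<Phi> 1 (\<Phi> s1 y) - \<Phi> 1 y) < 0" using zero[OF y] by (intro ordered_flow) auto
    moreover have "\<Phi> 1 (\<Phi> s1 y) = \<Phi> s1 (\<Phi> 1 y)" by (metis \<Phi>_add add.commute)
    ultimately show False using zero[OF omega_invariant[OF y, of 1]] by simp
  qed
  obtain t1 \<eta> K \<kappa> where D: "t1 \<ge> 0" "\<eta> > 0" "K > 0" "\<kappa> > 0"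
    "\<And>g t0 t. sol g \<Longrightarrow> t0 \<ge> t1 \<Longrightarrow> (\<And>s. s \<ge> t0 \<Longrightarrow> norm (g s) \<le> R \<and> 0 \<le> V (g s - X s)) \<Longrightarrow>
       norm (g t0 - X t0) \<le> \<eta> \<Longrightarrow> t \<ge> t0 \<Longrightarrow>
       norm (g t - X t) \<le> K * exp (- \<kappa> * (t - t0)) * norm (g t0 - X t0)"
    using orbit_decay by metis
  \<comment> \<open>As \<open>s1\<close> is a period on the limit set, the orbit comes close to its
    own shift, which lets \<open>orbit_decay\<close> start.\<close>
  have "\<exists>t0\<ge>t1. norm (X (t0 + s1) - X t0) \<le> \<eta>"
  proof (rule ccontr)
    assume n: "\<not> ?thesis"
    have "real n \<le> t1 + real n" for n using D(1) by simp
    then obtain y r where y: "y \<in> \<Omega>" "strict_mono (r :: nat \<Rightarrow> nat)" "(\<lambda>n. X (t1 + real (r n))) \<longlonglongrightarrow> y"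
        "\<And>n. real n \<le> t1 + real (r n)"
      using omega_accumulation[of "\<lambda>n. t1 + real n"] by metis
    have "(\<lambda>n. norm (X (s1 + (t1 + real (r n))) - X (t1 + real (r n)))) \<longlonglongrightarrow> norm (\<Phi> s1 y - y)"
      by (intro tendsto_intros shadow_tendsto filterlim_real_le y)
    moreover have "\<eta> \<le> norm (X (s1 + (t1 + real (r n))) - X (t1 + real (r n)))" for n
    proof -
      have "\<not> norm (X ((t1 + real (r n)) + s1) - X (t1 + real (r n))) \<le> \<eta>" using n by auto
      then show ?thesis by (simp add: add_ac)
    qed
    ultimately have "\<eta> \<le> norm (\<Phi> s1 y - y)" using LIMSEQ_le_const by blast
    then show False using per[OF y(1)] D(2) by simp
  qed
  then obtain t0 where t0: "t0 \<ge> t1" "norm (X (t0 + s1) - X t0) \<le> \<eta>" by blast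
  \<comment> \<open>Sampling with period \<open>s1\<close> gives steps that shrink geometrically;
    the limit \<open>p\<close> generates the periodic orbit.\<close>
  define z where "z = (\<lambda>k. X (t0 + real k * s1))"
  have step: "norm (z (Suc k) - z k) \<le> K * \<eta> * exp (- \<kappa> * s1) ^ k" for k
  proof -
    have "norm (X ((t0 + real k * s1) + s1) - X (t0 + real k * s1)) \<le>
        K * exp (- \<kappa> * ((t0 + real k * s1) - t0)) * norm (X (t0 + s1) - X t0)"
      using s1 t0 D(1) s1ge X_bound by (intro D(5)[OF sol_shift[OF sol_\<Phi>[of x], of s1]]) auto
    also have "\<dots> \<le> K * exp (- \<kappa> * ((t0 + real k * s1) - t0)) * \<eta>"
      using t0 D by (intro mult_left_mono) auto
    also have "exp (- \<kappa> * ((t0 + real k * s1) - t0)) = exp (- \<kappa> * s1) ^ k"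
      by (simp add: exp_of_nat_mult[symmetric] mult_ac)
    finally show ?thesis by (simp add: z_def algebra_simps)
  qed
  have "summable (\<lambda>k. K * \<eta> * exp (- \<kappa> * s1) ^ k)"
    using D s1 by (intro summable_mult summable_geometric) auto
  then have "summable (\<lambda>k. z (Suc k) - z k)"
    by (rule summable_comparison_test'[where N = 0]) (use step in auto)
  then have "(\<lambda>n. \<Sum>k<n. z (Suc k) - z k) \<longlonglongrightarrow> (\<Sum>k. z (Suc k) - z k)" by (rule summable_LIMSEQ)
  then have "(\<lambda>n. (z n - z 0) + z 0) \<longlonglongrightarrow> (\<Sum>k. z (Suc k) - z k) + z 0"
    unfolding sum_lessThan_telescope by (intro tendsto_add tendsto_const)
  then obtain p where p: "z \<longlonglongrightarrow> p" by auto
  have zinf: "filterlim (\<lambda>k. t0 + real k * s1) at_top sequentially"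
    by (rule filterlim_tendsto_add_at_top[OF tendsto_const])
      (use s1 in \<open>intro filterlim_at_top_mult_tendsto_pos[OF tendsto_const _ filterlim_real_sequentially]\<close>)
  have p\<Omega>: "p \<in> \<Omega>" using omega_limitI[OF zinf] p by (simp add: z_def)
  show ?thesis
  proof (rule periodic_orbitI[OF p\<Omega> s1 per[OF p\<Omega>]])
    fix y assume y: "y \<in> \<Omega>"
    obtain \<tau> where \<tau>: "\<And>n. real n \<le> \<tau> n" "(\<lambda>n. X (\<tau> n)) \<longlonglongrightarrow> y"
      using omega_limit_sequence[OF y] by blast
    \<comment> \<open>Split \<open>\<tau> n\<close> into \<open>t0\<close>, whole multiples of
      \<open>s1\<close> and a remainder \<open>r n\<close> within one period, so that
      \<open>X (\<tau> n)\<close> is close to \<open>\<Phi> (r n) p\<close>. The truncation by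
      \<open>nat\<close> is void once \<open>\<tau> n \<ge> t0\<close>.\<close>
    define k where "k = (\<lambda>n. nat \<lfloor>(\<tau> n - t0) / s1\<rfloor>)"
    define r where "r = (\<lambda>n. \<tau> n - (t0 + real (k n) * s1))"
    have kr: "0 \<le> r n \<and> r n \<le> s1" if "\<tau> n \<ge> t0" for n
    proof -
      have "0 \<le> (\<tau> n - t0) / s1" using that s1 by simp
      then have "real (k n) \<le> (\<tau> n - t0) / s1" "(\<tau> n - t0) / s1 \<le> real (k n) + 1"
        unfolding k_def by linarith+
      then show ?thesis using s1 by (simp add: r_def field_simps)
    qed
    obtain K' where K': "\<And>\<tau> t. \<tau> + 0 \<ge> 0 \<Longrightarrow> 0 \<le> t \<Longrightarrow> t \<le> s1 \<Longrightarrow> norm (X (t + \<tau>) - \<Phi> t p) \<le> K' * norm (X \<tau> - p)"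
      by (rule shadow[of 0 s1 p]) (use s1 in auto)
    have ev: "eventually (\<lambda>n. \<tau> n \<ge> t0) sequentially"
      using filterlim_real_le[OF \<tau>(1)] by (simp add: filterlim_at_top)
    have kinf: "filterlim k at_top sequentially"
      unfolding filterlim_at_top
    proof
      fix Z :: nat
      have "eventually (\<lambda>n. \<tau> n \<ge> t0 + real Z * s1) sequentially"
        using filterlim_real_le[OF \<tau>(1)] by (simp add: filterlim_at_top)
      then show "eventually (\<lambda>n. Z \<le> k n) sequentially"
      proof eventually_elim
        case (elim n)
        then have "real Z \<le> (\<tau> n - t0) / s1" using s1 by (simp add: field_simps)
        then show ?case unfolding k_def by linarith
      qed
    qed
    have "(\<lambda>n. X (\<tau> n) - \<Phi> (r n) p) \<longlonglongrightarrow> 0"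
    proof (rule Lim_null_comparison)
      show "eventually (\<lambda>n. norm (X (\<tau> n) - \<Phi> (r n) p) \<le> K' * norm (z (k n) - p)) sequentially"
        using ev
      proof eventually_elim
        case (elim n)
        have "norm (X (r n + (t0 + real (k n) * s1)) - \<Phi> (r n) p) \<le> K' * norm (X (t0 + real (k n) * s1) - p)"
          using kr[OF elim] t0(1) D(1) s1 by (intro K') auto
        then show ?case by (simp add: r_def z_def)
      qed
      have "(\<lambda>n. z (k n)) \<longlonglongrightarrow> p" using filterlim_compose[OF p kinf] .
      then have "(\<lambda>n. z (k n) - p) \<longlonglongrightarrow> 0" by (simp add: LIM_zero)
      then have "(\<lambda>n. K' * norm (z (k n) - p)) \<longlonglongrightarrow> K' * norm (0::'a)" by (intro tendsto_intros)
      then show "(\<lambda>n. K' * norm (z (k n) - p)) \<longlonglongrightarrow> 0" by simp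
    qed
    then have "(\<lambda>n. X (\<tau> n) - (X (\<tau> n) - \<Phi> (r n) p)) \<longlonglongrightarrow> y - 0" by (intro tendsto_diff \<tau>(2))
    then have "(\<lambda>n. \<Phi> (r n) p) \<longlonglongrightarrow> y" by simp
    moreover have "closed ((\<lambda>t. \<Phi> t p) ` {0..s1})"
      by (intro compact_imp_closed compact_continuous_image continuous_intros) auto
    moreover have "eventually (\<lambda>n. \<Phi> (r n) p \<in> (\<lambda>t. \<Phi> t p) ` {0..s1}) sequentially"
      using ev by eventually_elim (use kr in auto)
    ultimately have "y \<in> (\<lambda>t. \<Phi> t p) ` {0..s1}"
      by (intro Lim_in_closed_set[of "(\<lambda>t. \<Phi> t p) ` {0..s1}" "\<lambda>n. \<Phi> (r n) p" sequentially]) auto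
    then show "\<exists>t. y = \<Phi> t p" by blast
  qed
qed

end

section \<open>All shifts ordered: recurrence and a periodic point\<close>

locale ordered_orbit = tangent_orbit +
  assumes all_shifts_ordered: "\<And>s. s > 0 \<Longrightarrow> \<exists>t\<ge>0. V (X (t + s) - X t) \<le> 0"
begin

text \<open>The order of \<open>X\<close> with its shifts passes weakly to the limit set; starting
  one unit of time earlier makes it strict. Both points lie on one orbit, because time shifts are
  all that survives the limit.\<close>

lemma omega_orbit_ordered:
  assumes y: "y \<in> \<Omega>" and ne: "\<Phi> s y \<noteq> \<Phi> t y"
  shows "V (\<Phi> s y - \<Phi> t y) < 0"
proof -
  have pos: "V (\<Phi> s z - z) < 0" if s: "s > 0" and z: "z \<in> \<Omega>" and ne: "\<Phi> s z \<noteq> z" for s z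
  proof -
    obtain t where "V (X (t + s) - X t) \<le> 0" using all_shifts_ordered[OF s] by blast
    then have "V (\<Phi> s (\<Phi> (-1) z) - \<Phi> (-1) z) \<le> 0"
      using ordered_shift_omega[of t s] s omega_invariant[OF z] by auto
    moreover have "\<Phi> s (\<Phi> (-1) z) \<noteq> \<Phi> (-1) z"
      using ne \<Phi>_inj[of "-1" "\<Phi> s z" z] by (metis \<Phi>_add add.commute)
    ultimately have "V (\<Phi> 1 (\<Phi> s (\<Phi> (-1) z)) - \<Phi> 1 (\<Phi> (-1) z)) < 0"
      by (intro ordered_flow) auto
    then show ?thesis by (simp flip: \<Phi>_add)
  qed
  consider "s > t" | "s < t" using ne by force
  then show ?thesis
  proof cases
    case 1
    then show ?thesis using pos[of "s - t" "\<Phi> t y"] omega_invariant[OF y] ne by (simp flip: \<Phi>_add)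
  next
    case 2
    then have "V (\<Phi> t y - \<Phi> s y) < 0"
      using pos[of "t - s" "\<Phi> s y"] omega_invariant[OF y] ne by (simp flip: \<Phi>_add)
    then show ?thesis by (simp add: V_minus)
  qed
qed

lemma omega_nonempty: "\<Omega> \<noteq> {}"
  using omega_accumulation[of real] by auto

lemma continuous_on_\<Phi>_omega: "continuous_on \<Omega> (\<Phi> t)"
  by (rule continuous_on_\<Phi>_bounded[OF omega_bound])

text \<open>In a minimal closed set invariant towards the past, the closure of any backward
  half-orbit, however late it is started, is such a set again and so contains the point. The
  direction matches \<open>planar_trap\<close>, which keeps the past away from the near
  future.\<close>

lemma recurrent_point_exists:
  obtains y where "y \<in> \<Omega>" "\<And>e N. e > 0 \<Longrightarrow> \<exists>\<sigma>\<le>-N. dist (\<Phi> \<sigma> y) y < e"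
proof -
  define \<A> where "\<A> = {N. N \<subseteq> \<Omega> \<and> N \<noteq> {} \<and> closed N \<and> (\<forall>t\<le>0. \<Phi> t ` N \<subseteq> N)}"
  have \<Omega>A: "\<Omega> \<in> \<A>" using omega_nonempty compact_imp_closed[OF compact_omega] omega_invariant by (auto simp: \<A>_def)
  \<comment> \<open>\<open>subset_Zorn\<close> produces maximal sets, so it is applied to
    complements; compactness makes the intersection of a chain nonempty.\<close>
  have "\<exists>M\<in>uminus ` \<A>. \<forall>U\<in>uminus ` \<A>. M \<subseteq> U \<longrightarrow> U = M"
  proof (rule subset_Zorn)
    fix \<C> assume ch: "subset.chain (uminus ` \<A>) \<C>"
    show "\<exists>U\<in>uminus ` \<A>. \<forall>C\<in>\<C>. C \<subseteq> U"
    proof (cases "\<C> = {}")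
      case True then show ?thesis using \<Omega>A by blast
    next
      case False
      define \<D> where "\<D> = uminus ` \<C>"
      have DA: "\<D> \<subseteq> \<A>" using ch by (auto simp: \<D>_def subset.chain_def)
      have "\<Inter>\<D> \<noteq> {}"
      proof (rule compact_chain)
        show "compact S" if "S \<in> \<D>" for S
          using DA that compact_omega unfolding \<A>_def by (metis (no_types, lifting) compact_Int_closed inf.absorb_iff2 mem_Collect_eq subsetD)
        show "{} \<notin> \<D>" using DA by (auto simp: \<A>_def)
        show "S \<subseteq> T \<or> T \<subseteq> S" if ST: "S \<in> \<D> \<and> T \<in> \<D>" for S T
        proof -
          have "\<forall>A\<in>\<C>. \<forall>B\<in>\<C>. A \<subseteq> B \<or> B \<subseteq> A" using ch by (simp add: subset_chain_def)
          moreover obtain A B where "A \<in> \<C>" "B \<in> \<C>" "S = - A" "T = - B" using ST by (auto simp: \<D>_def)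
          ultimately show ?thesis by (metis Compl_subset_Compl_iff)
        qed
      qed
      moreover have "\<Inter>\<D> \<subseteq> \<Omega>"
      proof -
        obtain S where "S \<in> \<D>" using False by (auto simp: \<D>_def)
        then have "S \<in> \<A>" using DA by blast
        then have "S \<subseteq> \<Omega>" by (simp add: \<A>_def)
        then show ?thesis using \<open>S \<in> \<D>\<close> by blast
      qed
      moreover have "closed (\<Inter>\<D>)" using DA by (intro closed_Inter) (auto simp: \<A>_def)
      moreover have "\<Phi> t ` \<Inter>\<D> \<subseteq> \<Inter>\<D>" if "t \<le> 0" for t using DA that unfolding \<A>_def by blast
      ultimately have "\<Inter>\<D> \<in> \<A>" by (simp add: \<A>_def)
      moreover have "\<forall>C\<in>\<C>. C \<subseteq> - \<Inter>\<D>" by (auto simp: \<D>_def)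
      ultimately show ?thesis by blast
    qed
  qed
  then obtain N where N: "N \<in> \<A>" "\<And>N'. N' \<in> \<A> \<Longrightarrow> N' \<subseteq> N \<Longrightarrow> N' = N"
    by (auto simp: image_iff)
  obtain y where y: "y \<in> N" using N(1) by (auto simp: \<A>_def)
  have y\<Omega>: "y \<in> \<Omega>" using y N(1) by (auto simp: \<A>_def)
  have rec: "\<exists>\<sigma>\<le>-M. dist (\<Phi> \<sigma> y) y < e" if "e > 0" for e M
  proof -
    define Z where "Z = closure ((\<lambda>\<sigma>. \<Phi> \<sigma> y) ` {..- max M 0})"
    have ZN: "Z \<subseteq> N"
      unfolding Z_def using N(1) y by (intro closure_minimal) (auto simp: \<A>_def image_subset_iff)
    have "\<Phi> t ` Z \<subseteq> Z" if t: "t \<le> 0" for t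
      unfolding Z_def
    proof (rule image_closure_subset)
      show "continuous_on (closure ((\<lambda>\<sigma>. \<Phi> \<sigma> y) ` {..- max M 0})) (\<Phi> t)"
        using ZN N(1) by (intro continuous_on_subset[OF continuous_on_\<Phi>_omega]) (auto simp: Z_def \<A>_def)
      show "\<Phi> t ` (\<lambda>\<sigma>. \<Phi> \<sigma> y) ` {..- max M 0} \<subseteq> closure ((\<lambda>\<sigma>. \<Phi> \<sigma> y) ` {..- max M 0})"
        using t by (intro order_trans[OF _ closure_subset]) (auto simp flip: \<Phi>_add)
    qed simp
    then have "Z \<in> \<A>" using ZN N(1) by (auto simp: \<A>_def Z_def)
    then have "y \<in> Z" using N(2) ZN y by blast
    then obtain \<sigma> where "\<sigma> \<le> - max M 0" "dist (\<Phi> \<sigma> y) y < e"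
      unfolding Z_def closure_approachable using \<open>e > 0\<close> by auto
    then show ?thesis by (intro exI[of _ \<sigma>]) auto
  qed
  show ?thesis using that[OF y\<Omega> rec] .
qed

lemma periodic_point_exists:
  obtains p T where "p \<in> \<Omega>" "T > 0" "\<Phi> T p = p"
proof -
  obtain y where y: "y \<in> \<Omega>" "\<And>e N. e > 0 \<Longrightarrow> \<exists>\<sigma>\<le>-N. dist (\<Phi> \<sigma> y) y < e"
    using recurrent_point_exists by blast
  have "\<exists>T>0. \<Phi> T y = y"
  proof (rule ccontr)
    assume no: "\<not> ?thesis"
    have ne: "\<Phi> s y \<noteq> \<Phi> t y" if "s < t" for s t
    proof
      assume "\<Phi> s y = \<Phi> t y"
      then have "\<Phi> (-s) (\<Phi> s y) = \<Phi> (-s) (\<Phi> t y)" by simp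
      then have "\<Phi> (t - s) y = y" by (simp flip: \<Phi>_add)
      then show False using no that by auto
    qed
    obtain P where P: "P > 0" "\<And>u. norm (\<pi> u) \<le> norm u * P"
      using bounded_linear.pos_bounded[OF bl_pi] by blast
    obtain L where L: "L \<ge> 0" "\<And>x y. norm x \<le> R \<Longrightarrow> norm y \<le> R \<Longrightarrow> norm (F x - F y) \<le> L * norm (x - y)"
      using F_lipschitz by blast
    define G where "G = (\<lambda>s. \<pi> (\<Phi> s y))"
    define v where "v = \<pi> (F y)"
    have "norm (F y) \<le> C * norm v" unfolding v_def using tangent_omega[OF y(1)] by (intro cone_V) auto
    then have v0: "v \<noteq> 0" using no_equilibrium[OF y(1)] by auto
    \<comment> \<open>The order lets the projection control distances along the orbit. Hence
      nearness in the plane forces nearby velocities, which for an arbitrary projected curve would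
      fail.\<close>
    have close: "norm (\<Phi> s y - \<Phi> t y) \<le> C * norm (G s - G t)" for s t
    proof (cases "\<Phi> s y = \<Phi> t y")
      case False
      then have "V (\<Phi> s y - \<Phi> t y) \<le> 0" using omega_orbit_ordered[OF y(1)] by (simp add: less_imp_le)
      then show ?thesis using cone_V[of "\<Phi> s y - \<Phi> t y"] by (simp add: G_def pi_diff)
    qed (use C_pos in simp)
    \<comment> \<open>Within this planar distance of \<open>G 0\<close> the projected velocity moves
      by at most half of \<open>norm v\<close>; \<open>L + 1\<close> keeps the denominator
      positive.\<close>
    define \<rho> where "\<rho> = norm v / (2 * (P * (L + 1) * C))"
    show False
    proof (rule no_injective_recurrence[of G "\<lambda>s. \<pi> (F (\<Phi> s y))" v \<rho>])
      show "(G has_vector_derivative \<pi> (F (\<Phi> s y))) (at s)" for s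
        unfolding G_def using sol_\<Phi>[of y] unfolding sol_def
        by (intro bounded_linear.has_vector_derivative[OF bl_pi]) blast
      show "inj G"
      proof (rule injI, rule ccontr)
        fix s t assume st: "G s = G t" "s \<noteq> t"
        then have "\<Phi> s y = \<Phi> t y" using close[of s t] by simp
        then show False using ne[of s t] ne[of t s] st(2) by force
      qed
      show "\<rho> > 0" using v0 P(1) L(1) C_pos by (simp add: \<rho>_def)
      show "0 < Re (\<pi> (F (\<Phi> s y)) * cnj v)" if s: "norm (G s - G 0) \<le> \<rho>" for s
      proof -
        have "norm (\<pi> (F (\<Phi> s y)) - v) \<le> P * norm (F (\<Phi> s y) - F y)"
          using P(2)[of "F (\<Phi> s y) - F y"] by (simp add: v_def pi_diff mult.commute)
        also have "\<dots> \<le> P * ((L + 1) * norm (\<Phi> s y - y))"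
        proof (intro mult_left_mono)
          have "norm (F (\<Phi> s y) - F y) \<le> L * norm (\<Phi> s y - y)"
            using omega_bound[OF y(1), of s] omega_bound[OF y(1), of 0] by (intro L(2)) auto
          also have "\<dots> \<le> (L + 1) * norm (\<Phi> s y - y)" by (intro mult_right_mono) auto
          finally show "norm (F (\<Phi> s y) - F y) \<le> (L + 1) * norm (\<Phi> s y - y)" .
        qed (use P in auto)
        also have "\<dots> \<le> P * ((L + 1) * (C * \<rho>))"
        proof -
          have "norm (\<Phi> s y - y) \<le> C * norm (G s - G 0)" using close[of s 0] by simp
          also have "\<dots> \<le> C * \<rho>" using s C_pos by (intro mult_left_mono) auto
          finally show ?thesis using P(1) L(1) by (intro mult_left_mono) auto
        qed
        also have "\<dots> = norm v / 2"
        proof -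
          have "P \<noteq> 0" "L + 1 \<noteq> 0" "C \<noteq> 0" using P(1) L(1) C_pos by auto
          then show ?thesis by (simp add: \<rho>_def)
        qed
        finally have d: "norm (\<pi> (F (\<Phi> s y)) - v) \<le> norm v / 2" .
        have "(norm v)\<^sup>2 / 2 > 0" using v0 by simp
        then show ?thesis using Re_mult_cnj_ge[OF d] by linarith
      qed
      fix \<epsilon> N L' :: real assume \<epsilon>: "\<epsilon> > 0"
      obtain K where K: "K \<ge> 0"
        "\<And>z t. (\<And>r. - \<bar>L'\<bar> \<le> r \<Longrightarrow> r \<le> \<bar>L'\<bar> \<Longrightarrow> norm (\<Phi> r z) \<le> R) \<Longrightarrow> - \<bar>L'\<bar> \<le> t \<Longrightarrow> t \<le> \<bar>L'\<bar> \<Longrightarrow>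
           norm (\<Phi> t z - \<Phi> t y) \<le> K * norm (z - y)"
        using flow_lipschitz[of "- \<bar>L'\<bar>" "\<bar>L'\<bar>" R y] by auto
      obtain \<sigma> where \<sigma>: "\<sigma> \<le> - N" "dist (\<Phi> \<sigma> y) y < \<epsilon> / ((K + 1) * P)"
        using y(2)[of "\<epsilon> / ((K + 1) * P)" N] \<epsilon> K P by auto
      have "norm (G (\<sigma> + \<tau>) - G \<tau>) < \<epsilon>" if \<tau>: "\<tau> \<in> {- L'..L'}" for \<tau>
      proof -
        have "norm (G (\<sigma> + \<tau>) - G \<tau>) \<le> norm (\<Phi> (\<tau> + \<sigma>) y - \<Phi> \<tau> y) * P"
          using P(2)[of "\<Phi> (\<tau> + \<sigma>) y - \<Phi> \<tau> y"] by (simp add: G_def pi_diff add.commute)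
        also have "norm (\<Phi> (\<tau> + \<sigma>) y - \<Phi> \<tau> y) \<le> K * norm (\<Phi> \<sigma> y - y)"
          unfolding \<Phi>_add using \<tau> omega_bound[OF omega_invariant[OF y(1)]] by (intro K(2)) auto
        also have "\<dots> \<le> (K + 1) * norm (\<Phi> \<sigma> y - y)" by (intro mult_right_mono) auto
        finally have "norm (G (\<sigma> + \<tau>) - G \<tau>) \<le> (K + 1) * norm (\<Phi> \<sigma> y - y) * P"
          using P(1) by simp
        also have "\<dots> < \<epsilon>"
        proof -
          have "(K + 1) * P > 0" using K(1) P(1) by simp
          then have "dist (\<Phi> \<sigma> y) y * ((K + 1) * P) < \<epsilon>" using \<sigma>(2) by (simp only: pos_less_divide_eq)
          then show ?thesis by (simp only: dist_norm mult_ac)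
        qed
        finally show ?thesis .
      qed
      then show "\<exists>\<sigma>\<le>- N. \<forall>\<tau>\<in>{- L'..L'}. norm (G (\<sigma> + \<tau>) - G \<tau>) < \<epsilon>" using \<sigma>(1) by blast
    qed (use v0 in auto)
  qed
  then show ?thesis using that y(1) by blast
qed

end

section \<open>Orbits accumulating on a periodic orbit\<close>

text \<open>For each \<open>\<theta>\<close> there is exactly one zero of \<open>Re (g \<theta> s)\<close>, and \<open>Im g\<close> cannot change sign on these
  zeros because \<open>g\<close> never vanishes.\<close>

lemma sign_transport_pos:
  fixes g :: "real \<Rightarrow> real \<Rightarrow> complex"
  assumes "T \<ge> 0" and cont: "continuous_on ({0..T} \<times> {a..b}) (\<lambda>z. g (fst z) (snd z))"
    and mono: "\<And>\<theta> s s'. 0 \<le> \<theta> \<Longrightarrow> \<theta> \<le> T \<Longrightarrow> a \<le> s \<Longrightarrow> s < s' \<Longrightarrow> s' \<le> b \<Longrightarrow> Re (g \<theta> s) < Re (g \<theta> s')"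
    and ends: "\<And>\<theta>. 0 \<le> \<theta> \<Longrightarrow> \<theta> \<le> T \<Longrightarrow> Re (g \<theta> a) \<le> 0 \<and> 0 \<le> Re (g \<theta> b)"
    and nz: "\<And>\<theta> s. 0 \<le> \<theta> \<Longrightarrow> \<theta> \<le> T \<Longrightarrow> a \<le> s \<Longrightarrow> s \<le> b \<Longrightarrow> g \<theta> s \<noteq> 0"
    and s0: "a \<le> s0" "s0 \<le> b" "Re (g 0 s0) = 0" and s1: "a \<le> s1" "s1 \<le> b" "Re (g T s1) = 0"
    and pos: "Im (g 0 s0) > 0"
  shows "Im (g T s1) > 0"
proof (rule ccontr)
  assume neg: "\<not> ?thesis"
  define D where "D = {0..T} \<times> {a..b}"
  have cD: "compact D" by (auto simp: D_def intro!: compact_Times)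
  define A where "A = fst ` (D \<inter> (\<lambda>z. g (fst z) (snd z)) -` {w. Re w = 0 \<and> Im w \<ge> 0})"
  define B where "B = fst ` (D \<inter> (\<lambda>z. g (fst z) (snd z)) -` {w. Re w = 0 \<and> Im w \<le> 0})"
  have cl: "compact (fst ` (D \<inter> (\<lambda>z. g (fst z) (snd z)) -` W))" if "closed W" for W
  proof -
    have "closed (D \<inter> (\<lambda>z. g (fst z) (snd z)) -` W)"
      by (rule continuous_closed_preimage[OF cont[folded D_def] compact_imp_closed[OF cD] that])
    then have "compact (D \<inter> (\<lambda>z. g (fst z) (snd z)) -` W)"
      using cD by (metis (no_types, lifting) compact_Int_closed inf.left_idem)
    then show ?thesis by (intro compact_continuous_image continuous_intros)
  qed
  have "closed {w. Re w = 0 \<and> Im w \<ge> 0}"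
    by (intro closed_Collect_conj closed_Collect_eq closed_Collect_le continuous_intros)
  then have clA: "closed A" unfolding A_def by (rule compact_imp_closed[OF cl])
  have "closed {w. Re w = 0 \<and> Im w \<le> 0}"
    by (intro closed_Collect_conj closed_Collect_eq closed_Collect_le continuous_intros)
  then have clB: "closed B" unfolding B_def by (rule compact_imp_closed[OF cl])
  have Aiff: "\<theta> \<in> A \<longleftrightarrow> 0 \<le> \<theta> \<and> \<theta> \<le> T \<and> (\<exists>s. a \<le> s \<and> s \<le> b \<and> Re (g \<theta> s) = 0 \<and> Im (g \<theta> s) \<ge> 0)" for \<theta>
    by (force simp: A_def D_def image_iff)
  have Biff: "\<theta> \<in> B \<longleftrightarrow> 0 \<le> \<theta> \<and> \<theta> \<le> T \<and> (\<exists>s. a \<le> s \<and> s \<le> b \<and> Re (g \<theta> s) = 0 \<and> Im (g \<theta> s) \<le> 0)" for \<theta>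
    by (force simp: B_def D_def image_iff)
  have "{0..T} \<subseteq> A \<union> B"
  proof
    fix \<theta> assume \<theta>: "\<theta> \<in> {0..T}"
    have "continuous_on {a..b} (\<lambda>s. g (fst (\<theta>, s)) (snd (\<theta>, s)))"
      by (rule continuous_on_compose2[OF cont]) (use \<theta> in \<open>auto intro!: continuous_intros\<close>)
    then have "continuous_on {a..b} (\<lambda>s. Re (g \<theta> s))" by (intro continuous_on_Re) simp
    then obtain s where "a \<le> s" "s \<le> b" "Re (g \<theta> s) = 0"
      using IVT'[of "\<lambda>s. Re (g \<theta> s)" a 0 b] ends[of \<theta>] \<theta> s0 by auto
    then show "\<theta> \<in> A \<union> B" using \<theta> unfolding Un_iff Aiff Biff by (metis atLeastAtMost_iff linear)
  qed
  moreover have "A \<inter> B \<inter> {0..T} = {}"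
  proof (rule ccontr)
    assume "\<not> ?thesis"
    then obtain \<theta> s s' where \<theta>: "0 \<le> \<theta>" "\<theta> \<le> T" and s: "a \<le> s" "s \<le> b" "Re (g \<theta> s) = 0" "Im (g \<theta> s) \<ge> 0"
      and s': "a \<le> s'" "s' \<le> b" "Re (g \<theta> s') = 0" "Im (g \<theta> s') \<le> 0"
      using Aiff Biff by (metis IntE all_not_in_conv)
    have "s = s'" using mono[OF \<theta>, of s s'] mono[OF \<theta>, of s' s] s s' by (metis less_irrefl linorder_neqE)
    then have "g \<theta> s = 0" using s s' by (simp add: complex_eq_iff)
    then show False using nz[OF \<theta>] s by blast
  qed
  moreover have "A \<inter> {0..T} \<noteq> {}" using Aiff[of 0] s0 pos \<open>T \<ge> 0\<close> by (auto intro: less_imp_le)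
  moreover have "B \<inter> {0..T} \<noteq> {}"
  proof -
    have "T \<in> B" using Biff[of T] s1 neg \<open>T \<ge> 0\<close> by (auto simp: not_less)
    then show ?thesis using \<open>T \<ge> 0\<close> by auto
  qed
  moreover have "connected {0..T}" by simp
  ultimately show False using clA clB unfolding connected_closed by blast
qed

lemma sign_transport:
  fixes g :: "real \<Rightarrow> real \<Rightarrow> complex"
  assumes "T \<ge> 0" and cont: "continuous_on ({0..T} \<times> {a..b}) (\<lambda>z. g (fst z) (snd z))"
    and mono: "\<And>\<theta> s s'. 0 \<le> \<theta> \<Longrightarrow> \<theta> \<le> T \<Longrightarrow> a \<le> s \<Longrightarrow> s < s' \<Longrightarrow> s' \<le> b \<Longrightarrow> Re (g \<theta> s) < Re (g \<theta> s')"
    and ends: "\<And>\<theta>. 0 \<le> \<theta> \<Longrightarrow> \<theta> \<le> T \<Longrightarrow> Re (g \<theta> a) \<le> 0 \<and> 0 \<le> Re (g \<theta> b)"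
    and nz: "\<And>\<theta> s. 0 \<le> \<theta> \<Longrightarrow> \<theta> \<le> T \<Longrightarrow> a \<le> s \<Longrightarrow> s \<le> b \<Longrightarrow> g \<theta> s \<noteq> 0"
    and s0: "a \<le> s0" "s0 \<le> b" "Re (g 0 s0) = 0" and s1: "a \<le> s1" "s1 \<le> b" "Re (g T s1) = 0"
  shows "Im (g 0 s0) > 0 \<longleftrightarrow> Im (g T s1) > 0"
proof
  assume "Im (g 0 s0) > 0"
  then show "Im (g T s1) > 0" using sign_transport_pos[of T a b g s0 s1] assms by blast
next
  assume p1: "Im (g T s1) > 0"
  show "Im (g 0 s0) > 0"
  proof (rule ccontr)
    assume n: "\<not> Im (g 0 s0) > 0"
    have "g 0 s0 \<noteq> 0" using nz s0 \<open>T \<ge> 0\<close> by simp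
    \<comment> \<open>A negative sign is transported by conjugating \<open>g\<close>, which leaves
      the real parts unchanged.\<close>
    then have "Im (cnj (g 0 s0)) > 0" using n s0 by (auto simp: complex_eq_iff)
    then have "Im (cnj (g T s1)) > 0"
      using assms by (intro sign_transport_pos[of T a b "\<lambda>\<theta> s. cnj (g \<theta> s)" s0 s1]) (auto intro!: continuous_intros)
    then show False using p1 by simp
  qed
qed

context ordered_orbit
begin

text \<open>Being outside the cone persists backwards in time. So the phase \<open>b n\<close> is
  unordered with \<open>X\<close> on all of \<open>[0, n]\<close>, and a limit \<open>l\<close> of
  these phases on the compact orbit is unordered with \<open>X\<close> at all forward times; decay
  then synchronises the two.\<close>

lemma periodic_if_not_ordered_with:
  assumes p: "p \<in> \<Omega>" and T: "T > 0" "\<Phi> T p = p"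
    and un: "\<And>t. t \<ge> 0 \<Longrightarrow> \<exists>\<theta>. V (X t - \<Phi> \<theta> p) \<ge> 0"
  shows "periodic_orbit \<Phi> \<Omega>"
proof -
  let ?\<gamma> = "range (\<lambda>t. \<Phi> t p)"
  have \<gamma>\<Omega>: "?\<gamma> \<subseteq> \<Omega>" using omega_invariant[OF p] by blast
  have "\<forall>n::nat. \<exists>\<theta>. V (X (real n) - \<Phi> \<theta> p) \<ge> 0" using un by simp
  then obtain \<theta> where \<theta>: "\<And>n::nat. V (X (real n) - \<Phi> (\<theta> n) p) \<ge> 0" by metis
  define b where "b = (\<lambda>n::nat. \<Phi> (\<theta> n - real n) p)"
  have b\<gamma>: "b n \<in> ?\<gamma>" for n by (simp add: b_def)
  have bn: "V (X s - \<Phi> s (b n)) \<ge> 0" if s: "0 \<le> s" "s \<le> real n" for s n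
  proof (rule ccontr)
    assume "\<not> ?thesis"
    then have neg: "V (X s - \<Phi> s (b n)) < 0" by simp
    then have "X s \<noteq> \<Phi> s (b n)" by auto
    then have "V (\<Phi> (real n - s) (X s) - \<Phi> (real n - s) (\<Phi> s (b n))) < 0"
      by (rule ordered_flow'[OF _ neg]) (use s in auto)
    then show False using \<theta>[of n] by (simp add: b_def flip: \<Phi>_add)
  qed
  obtain l r where l: "l \<in> ?\<gamma>" "strict_mono (r :: nat \<Rightarrow> nat)" "(\<lambda>n. b (r n)) \<longlonglongrightarrow> l"
    by (rule compact_subsequence[OF compact_periodic[OF T] b\<gamma>])
  have lV: "V (X s - \<Phi> s l) \<ge> 0" if s: "s \<ge> 0" for s
  proof -
    have "(\<lambda>n. \<Phi> s (b (r n))) \<longlonglongrightarrow> \<Phi> s l"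
      using l \<gamma>\<Omega> b\<gamma> by (intro continuous_on_tendsto_compose[OF continuous_on_\<Phi>_omega]) (auto simp: subset_iff)
    then have "(\<lambda>n. V (X s - \<Phi> s (b (r n)))) \<longlonglongrightarrow> V (X s - \<Phi> s l)" by (intro tendsto_intros)
    moreover have "0 \<le> V (X s - \<Phi> s (b (r n)))" if "n \<ge> nat \<lceil>s\<rceil>" for n
      using seq_suble[OF l(2), of n] that s by (intro bn) linarith+
    ultimately show ?thesis by (intro LIMSEQ_le_const) blast+
  qed
  obtain t1 \<eta> K \<kappa> where D: "t1 \<ge> 0" "\<eta> > 0" "K > 0" "\<kappa> > 0"
    "\<And>g t0 t. sol g \<Longrightarrow> t0 \<ge> t1 \<Longrightarrow> (\<And>s. s \<ge> t0 \<Longrightarrow> norm (g s) \<le> R \<and> 0 \<le> V (g s - X s)) \<Longrightarrow>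
       norm (g t0 - X t0) \<le> \<eta> \<Longrightarrow> t \<ge> t0 \<Longrightarrow>
       norm (g t - X t) \<le> K * exp (- \<kappa> * (t - t0)) * norm (g t0 - X t0)"
    using orbit_decay by metis
  have l\<Omega>: "l \<in> \<Omega>" using l \<gamma>\<Omega> by blast
  \<comment> \<open>When \<open>X\<close> returns close to \<open>p\<close>, the moving phase tends
    to some \<open>m\<close> on the same orbit with \<open>V (p - m) \<ge> 0\<close>. Distinct
    points of that orbit are strictly ordered, so \<open>m = p\<close>.\<close>
  have "\<exists>t0\<ge>t1. norm (\<Phi> t0 l - X t0) \<le> \<eta>"
  proof -
    obtain \<tau> where \<tau>: "\<And>n. real n \<le> \<tau> n" "(\<lambda>n. X (\<tau> n)) \<longlonglongrightarrow> p"
      using omega_limit_sequence[OF p] by blast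
    have "\<Phi> t l \<in> ?\<gamma>" for t using l(1) by (auto simp flip: \<Phi>_add)
    then obtain m r' where m: "m \<in> ?\<gamma>" "strict_mono (r' :: nat \<Rightarrow> nat)" "(\<lambda>n. \<Phi> (\<tau> (r' n)) l) \<longlonglongrightarrow> m"
      using compact_subsequence[OF compact_periodic[OF T], of "\<lambda>n. \<Phi> (\<tau> n) l"] by blast
    have L: "(\<lambda>n. X (\<tau> (r' n))) \<longlonglongrightarrow> p" using LIMSEQ_subseq_LIMSEQ[OF \<tau>(2) m(2)] by (simp add: o_def)
    have "(\<lambda>n. V (X (\<tau> (r' n)) - \<Phi> (\<tau> (r' n)) l)) \<longlonglongrightarrow> V (p - m)"
      using m(3) L by (intro tendsto_intros) (auto simp: o_def)
    moreover have \<tau>0: "\<tau> n \<ge> 0" for n using \<tau>(1)[of n] by linarith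
    ultimately have "V (p - m) \<ge> 0" using lV by (intro LIMSEQ_le_const[of "\<lambda>n. V (X (\<tau> (r' n)) - \<Phi> (\<tau> (r' n)) l)"]) auto
    moreover obtain \<theta>' where "m = \<Phi> \<theta>' p" using m(1) by blast
    ultimately have "p = m" using omega_orbit_ordered[OF p, of 0 \<theta>'] by fastforce
    then have "(\<lambda>n. norm (\<Phi> (\<tau> (r' n)) l - X (\<tau> (r' n)))) \<longlonglongrightarrow> norm (m - m)"
      using m(3) L by (intro tendsto_intros) (auto simp: o_def)
    then have "eventually (\<lambda>n. norm (\<Phi> (\<tau> (r' n)) l - X (\<tau> (r' n))) < \<eta>) sequentially"
      using D(2) by (intro order_tendstoD(2)) auto
    moreover have "eventually (\<lambda>n. \<tau> n \<ge> t1) sequentially"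
      using filterlim_real_le[OF \<tau>(1)] by (simp add: filterlim_at_top)
    then have "eventually (\<lambda>n. \<tau> (r' n) \<ge> t1) sequentially" by (rule eventually_subseq[OF m(2)])
    ultimately have "eventually (\<lambda>n. norm (\<Phi> (\<tau> (r' n)) l - X (\<tau> (r' n))) < \<eta> \<and> \<tau> (r' n) \<ge> t1) sequentially"
      by (rule eventually_conj)
    then show ?thesis using less_imp_le by (auto dest!: eventually_happens)
  qed
  then obtain t0 where t0: "t0 \<ge> t1" "norm (\<Phi> t0 l - X t0) \<le> \<eta>" by blast
  have conv: "norm (\<Phi> t l - X t) \<le> K * exp (- \<kappa> * (t - t0)) * norm (\<Phi> t0 l - X t0)" if "t \<ge> t0" for t
    using t0 D(1) that omega_bound[OF l\<Omega>] lV by (intro D(5) sol_\<Phi>) (auto simp: V_minus)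
  show ?thesis
  proof (rule periodic_orbitI[OF p T])
    fix y assume y: "y \<in> \<Omega>"
    obtain \<tau> where \<tau>: "\<And>n. real n \<le> \<tau> n" "(\<lambda>n. X (\<tau> n)) \<longlonglongrightarrow> y"
      using omega_limit_sequence[OF y] by blast
    have \<tau>inf: "filterlim \<tau> at_top sequentially" using filterlim_real_le[OF \<tau>(1)] .
    have "(\<lambda>n. \<Phi> (\<tau> n) l - X (\<tau> n)) \<longlonglongrightarrow> 0"
    proof (rule Lim_null_comparison)
      have "eventually (\<lambda>n. \<tau> n \<ge> t0) sequentially" using \<tau>inf by (simp add: filterlim_at_top)
      then show "eventually (\<lambda>n. norm (\<Phi> (\<tau> n) l - X (\<tau> n)) \<le> K * exp (- \<kappa> * (\<tau> n - t0)) * norm (\<Phi> t0 l - X t0)) sequentially"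
        by eventually_elim (rule conv)
      have "filterlim (\<lambda>t. - \<kappa> * (t - t0)) at_bot at_top"
        using D(4) by real_asymp
      then have "((\<lambda>t. exp (- \<kappa> * (t - t0))) \<longlongrightarrow> 0) at_top" by (rule filterlim_compose[OF exp_at_bot])
      then have "(\<lambda>n. exp (- \<kappa> * (\<tau> n - t0))) \<longlonglongrightarrow> 0" by (rule filterlim_compose[OF _ \<tau>inf])
      then have "(\<lambda>n. K * exp (- \<kappa> * (\<tau> n - t0)) * norm (\<Phi> t0 l - X t0)) \<longlonglongrightarrow> K * 0 * norm (\<Phi> t0 l - X t0)"
        by (intro tendsto_intros)
      then show "(\<lambda>n. K * exp (- \<kappa> * (\<tau> n - t0)) * norm (\<Phi> t0 l - X t0)) \<longlonglongrightarrow> 0" by simp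
    qed
    then have "(\<lambda>n. (\<Phi> (\<tau> n) l - X (\<tau> n)) + X (\<tau> n)) \<longlonglongrightarrow> 0 + y" by (intro tendsto_add \<tau>(2))
    then have "(\<lambda>n. \<Phi> (\<tau> n) l) \<longlonglongrightarrow> y" by simp
    have "\<Phi> (\<tau> n) l \<in> ?\<gamma>" for n using l(1) by (auto simp flip: \<Phi>_add)
    from closed_sequentially[OF compact_imp_closed[OF compact_periodic[OF T]] this \<open>(\<lambda>n. \<Phi> (\<tau> n) l) \<longlonglongrightarrow> y\<close>]
    have "y \<in> ?\<gamma>" .
    then show "\<exists>t. y = \<Phi> t p" by blast
  qed
qed

text \<open>On the section \<open>h = 0\<close> at \<open>p\<close>, transport once around the orbit
  preserves the sign of \<open>r\<close> and the sign of its increments between successive returns.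
  If decreasing returns occur arbitrarily close to \<open>p\<close>, the decrease continues and
  holds \<open>X\<close> near the periodic orbit. Otherwise \<open>\<bar>r\<bar>\<close> never
  decreases near \<open>p\<close>; tracing close visits back in time then forces \<open>X\<close> to
  meet \<open>p\<close> within a bounded time interval, which the order forbids.\<close>

lemma periodic_if_ordered_with:
  assumes p: "p \<in> \<Omega>" and T: "T > 0" "\<Phi> T p = p"
    and t0: "t0 \<ge> 0" and ord0: "\<And>\<theta>. V (X t0 - \<Phi> \<theta> p) < 0"
  shows "periodic_orbit \<Phi> \<Omega>"
proof -
  have ord: "V (X t - \<Phi> \<theta> p) < 0" if "t \<ge> t0" for t \<theta>
  proof -
    have "X t0 \<noteq> \<Phi> (\<theta> - (t - t0)) p" using ord0[of "\<theta> - (t - t0)"] by auto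
    then have "V (\<Phi> (t - t0) (X t0) - \<Phi> (t - t0) (\<Phi> (\<theta> - (t - t0)) p)) < 0"
      using ord0 that by (intro ordered_flow') auto
    then show ?thesis by (simp flip: \<Phi>_add)
  qed
  note per = periodic_shift[OF T(2)]
  have pb: "norm (\<Phi> \<theta> p) \<le> R" for \<theta> using omega_bound[OF p] .
  obtain P where P: "P > 0" "\<And>u. norm (\<pi> u) \<le> norm u * P"
    using bounded_linear.pos_bounded[OF bl_pi] by blast
  obtain L where L: "L \<ge> 0" "\<And>x y. norm x \<le> R \<Longrightarrow> norm y \<le> R \<Longrightarrow> norm (F x - F y) \<le> L * norm (x - y)"
    using F_lipschitz by blast
  define u where "u = (\<lambda>\<theta>. \<pi> (F (\<Phi> \<theta> p)))"
  have cu: "continuous_on S u" for S unfolding u_def by (intro continuous_intros)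
  have u0: "u \<theta> \<noteq> 0" for \<theta>
  proof -
    have "norm (F (\<Phi> \<theta> p)) \<le> C * norm (u \<theta>)"
      unfolding u_def using tangent_omega[OF omega_invariant[OF p]] by (intro cone_V) (auto intro: less_imp_le)
    then show ?thesis using no_equilibrium[OF omega_invariant[OF p]] by fastforce
  qed
  have ne: "{0..T} \<noteq> {}" using T by simp
  obtain cm where cm: "cm > 0" "\<And>\<theta>. 0 \<le> \<theta> \<Longrightarrow> \<theta> \<le> T \<Longrightarrow> cm \<le> norm (u \<theta>)"
  proof -
    have "continuous_on {0..T} (\<lambda>\<theta>. norm (u \<theta>))" by (intro continuous_intros cu)
    then obtain \<theta> where "\<theta> \<in> {0..T}" "\<forall>\<theta>'\<in>{0..T}. norm (u \<theta>) \<le> norm (u \<theta>')"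
      using continuous_attains_inf[OF compact_Icc ne] by blast
    then show ?thesis using that[of "norm (u \<theta>)"] u0[of \<theta>] by auto
  qed
  obtain um where um: "um > 0" "\<And>\<theta>. 0 \<le> \<theta> \<Longrightarrow> \<theta> \<le> T \<Longrightarrow> norm (u \<theta>) \<le> um"
  proof -
    have "bounded (u ` {0..T})" by (intro compact_imp_bounded compact_continuous_image cu) auto
    then show ?thesis using that unfolding bounded_pos by auto
  qed
  \<comment> \<open>Within \<open>\<epsilon>2\<close> of \<open>\<Phi> \<theta> p\<close> the
    projected velocity differs from \<open>u \<theta>\<close> by at most \<open>cm / 2\<close>,
    which leaves the component \<open>c2\<close> along \<open>u \<theta>\<close>.\<close>
  define \<epsilon>2 where "\<epsilon>2 = cm / (2 * P * (L + 1))"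
  define c2 where "c2 = cm\<^sup>2 / 2"
  have \<epsilon>2: "\<epsilon>2 > 0" and c2: "c2 > 0" using cm P L by (auto simp: \<epsilon>2_def c2_def)
  have near: "c2 \<le> Re (\<pi> (F z) * cnj (u \<theta>))"
    if z: "norm z \<le> R" and \<theta>: "0 \<le> \<theta>" "\<theta> \<le> T" and d: "norm (z - \<Phi> \<theta> p) \<le> \<epsilon>2" for z \<theta>
  proof -
    have "norm (\<pi> (F z) - u \<theta>) \<le> norm (F z - F (\<Phi> \<theta> p)) * P"
      using P(2)[of "F z - F (\<Phi> \<theta> p)"] by (simp add: u_def pi_diff)
    also have "\<dots> \<le> ((L + 1) * \<epsilon>2) * P"
    proof (intro mult_right_mono)
      have "norm (F z - F (\<Phi> \<theta> p)) \<le> L * norm (z - \<Phi> \<theta> p)" using z pb by (intro L(2))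
      also have "\<dots> \<le> (L + 1) * \<epsilon>2" using d L(1) by (intro mult_mono) auto
      finally show "norm (F z - F (\<Phi> \<theta> p)) \<le> (L + 1) * \<epsilon>2" .
    qed (use P in auto)
    also have "\<dots> = cm / 2"
    proof -
      have "P \<noteq> 0" "L + 1 \<noteq> 0" using P(1) L(1) by auto
      then show ?thesis by (simp add: \<epsilon>2_def)
    qed
    finally have a: "norm (\<pi> (F z) - u \<theta>) \<le> norm (u \<theta>) / 2" using cm(2)[OF \<theta>] by linarith
    have "cm\<^sup>2 \<le> (norm (u \<theta>))\<^sup>2" using cm(1) cm(2)[OF \<theta>] by (intro power_mono) auto
    then show ?thesis using Re_mult_cnj_ge[OF a] unfolding c2_def by linarith
  qed
  obtain K where K: "K > 0"
    "\<And>\<tau> t. \<tau> + - (3*T) \<ge> 0 \<Longrightarrow> - (3*T) \<le> t \<Longrightarrow> t \<le> 3*T \<Longrightarrow> norm (X (t + \<tau>) - \<Phi> t p) \<le> K * norm (X \<tau> - p)"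
    by (rule shadow[of "- (3*T)" "3*T" p]) (use T in auto)
  \<comment> \<open>The shift by \<open>T\<close> is strictly ordered at some time, hence so are
    nearby shifts at that same time; persistence extends this to all later times with one common
    \<open>\<delta>0\<close>.\<close>
  obtain \<tau>0 \<delta>0 where \<delta>0: "\<delta>0 > 0" and self: "\<And>t s. t \<ge> \<tau>0 \<Longrightarrow> \<bar>s - T\<bar> \<le> \<delta>0 \<Longrightarrow> V (X (t + s) - X t) < 0"
  proof -
    obtain t2 where "V (X (t2 + T) - X t2) \<le> 0" using all_shifts_ordered[OF T(1)] by blast
    then have neg: "V (X ((t2 + 1) + T) - X (t2 + 1)) < 0" using ordered_shift[of t2 T "t2 + 1"] T by auto
    have "continuous_on UNIV (\<lambda>s. V (X ((t2 + 1) + s) - X (t2 + 1)))" by (intro continuous_intros)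
    then have "isCont (\<lambda>s. V (X ((t2 + 1) + s) - X (t2 + 1))) T" by (simp add: continuous_on_eq_continuous_at)
    then have "eventually (\<lambda>s. V (X ((t2 + 1) + s) - X (t2 + 1)) < 0) (at T)"
      unfolding isCont_def using neg by (rule order_tendstoD)
    then obtain d where d: "d > 0" "\<And>s. s \<noteq> T \<Longrightarrow> \<bar>s - T\<bar> < d \<Longrightarrow> V (X ((t2 + 1) + s) - X (t2 + 1)) < 0"
      unfolding eventually_at by (auto simp: dist_real_def)
    define \<delta>0 where "\<delta>0 = min (d/2) (T/2)"
    have "V (X (t + s) - X t) < 0" if "t \<ge> t2 + 2" "\<bar>s - T\<bar> \<le> \<delta>0" for t s
    proof -
      have "V (X ((t2 + 1) + s) - X (t2 + 1)) < 0"
        using that(2) d neg by (cases "s = T") (auto simp: \<delta>0_def)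
      moreover have "s \<noteq> 0" using that(2) T(1) by (auto simp: \<delta>0_def)
      ultimately show ?thesis using ordered_shift[of "t2 + 1" s t] that(1) by auto
    qed
    then show ?thesis using that[of \<delta>0 "t2 + 2"] d(1) T(1) by (auto simp: \<delta>0_def)
  qed
  have "uniformly_continuous_on {-(3*T)..3*T} (\<lambda>t. \<Phi> t p)"
    by (intro compact_uniformly_continuous continuous_intros) auto
  then obtain \<delta>2 where \<delta>2: "\<delta>2 > 0"
    "\<And>a b. a \<in> {-(3*T)..3*T} \<Longrightarrow> b \<in> {-(3*T)..3*T} \<Longrightarrow> dist a b < \<delta>2 \<Longrightarrow> dist (\<Phi> a p) (\<Phi> b p) < \<epsilon>2 / 2"
    unfolding uniformly_continuous_on_def using \<epsilon>2 by (metis half_gt_zero)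
  \<comment> \<open>\<open>\<delta>0\<close> keeps return shifts ordered,
    \<open>\<delta>2 / 3\<close> serves the doubled deviation \<open>2 * \<delta>\<close> in
    \<open>tclose\<close>, and \<open>T / 4\<close> makes each return advance by at least
    \<open>T / 2\<close> and at most \<open>2 * T\<close>.\<close>
  define \<delta> where "\<delta> = Min {\<delta>0, \<delta>2 / 3, T / 4}"
  have \<delta>: "\<delta> > 0" "\<delta> \<le> \<delta>0" "2 * \<delta> < \<delta>2" "\<delta> \<le> T / 4" using \<delta>0 \<delta>2 T by (auto simp: \<delta>_def)
  have tclose: "norm (\<Phi> a p - \<Phi> b p) \<le> \<epsilon>2 / 2" if "\<bar>a - b\<bar> \<le> 2 * \<delta>" "\<bar>a\<bar> \<le> 3*T" "\<bar>b\<bar> \<le> 3*T" for a b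
  proof -
    have "dist (\<Phi> a p) (\<Phi> b p) < \<epsilon>2 / 2"
      using that \<delta>(3) by (intro \<delta>2(2)) (auto simp: dist_real_def abs_le_iff)
    then show ?thesis by (simp add: dist_norm)
  qed
  \<comment> \<open>\<open>3*T\<close> leaves room for shadowing windows into the past,
    \<open>t0 + T\<close> for the order with the periodic orbit, and \<open>\<tau>0\<close> for the
    order with shifts.\<close>
  define tm where "tm = Max {t0 + T, \<tau>0, 3*T}"
  have tm: "t0 \<le> tm" "\<tau>0 \<le> tm" "3*T \<le> tm" "t0 + T \<le> tm" using T(1) by (auto simp: tm_def le_max_iff_disj)
  have tm0: "tm \<ge> 0" using tm(3) T(1) by linarith
  define v where "v = u 0"
  \<comment> \<open>\<open>h\<close> and \<open>r\<close> are the coordinates of the projection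
    along and across the motion at \<open>p\<close>.\<close>
  define h where "h = (\<lambda>z. Re (\<pi> (z - p) * cnj v))"
  define r where "r = (\<lambda>z. Im (\<pi> (z - p) * cnj v))"
  have v0: "norm v > 0" using u0 by (simp add: v_def)
  have uT: "u T = v" using T by (simp add: u_def v_def)
  have Xb: "norm (X t) \<le> R" if "t \<ge> tm" for t using that tm0 by (intro X_bound) auto
  have Kb: "norm (X (t + \<theta>) - \<Phi> \<theta> p) \<le> K * norm (X t - p)" if "t \<ge> tm" "\<bar>\<theta>\<bar> \<le> 3*T" for t \<theta>
    using K(2)[of t \<theta>] that tm by (simp add: add.commute abs_le_iff)
  have diff0: "\<pi> (z - p) * cnj v - \<pi> (z' - p) * cnj v = \<pi> (z - z') * cnj v" for z z'
    by (simp add: pi_diff algebra_simps)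
  define C1 where "C1 = C / norm v"
  have C1: "C1 > 0" using C_pos v0 by (simp add: C1_def)
  have dl: "norm (X t - p) \<le> C1 * \<bar>r (X t)\<bar>" if "t \<ge> tm" "h (X t) = 0" for t
  proof -
    have "V (X t - p) < 0" using ord[of t 0] that(1) tm(1) by simp
    then have "norm (X t - p) \<le> C * norm (\<pi> (X t - p))" by (intro cone_V) simp
    moreover have "norm (\<pi> (X t - p)) * norm v = norm (\<pi> (X t - p) * cnj v)" by (simp add: norm_mult)
    moreover have "norm (\<pi> (X t - p) * cnj v) = \<bar>r (X t)\<bar>" using that(2) by (simp add: h_def r_def cmod_def)
    moreover have "norm (X t - p) * norm v \<le> (C * norm (\<pi> (X t - p))) * norm v"
      using calculation(1) by (intro mult_right_mono) auto
    ultimately have "norm (X t - p) * norm v \<le> C * \<bar>r (X t)\<bar>" by (simp only: mult.assoc)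
    then show ?thesis using v0 by (simp add: C1_def pos_le_divide_eq)
  qed
  have rn0: "r (X t) \<noteq> 0" if "t \<ge> tm" "h (X t) = 0" for t
  proof
    assume "r (X t) = 0"
    then have "X t = p" using dl[OF that] by simp
    then show False using ord[of t 0] that(1) tm(1) by simp
  qed
  have rb: "\<bar>r z\<bar> \<le> norm v * P * norm (z - p)" for z
  proof -
    have "\<bar>r z\<bar> \<le> norm (\<pi> (z - p) * cnj v)" unfolding r_def by (rule abs_Im_le_cmod)
    also have "\<dots> \<le> (norm (z - p) * P) * norm v"
      unfolding norm_mult complex_mod_cnj using P(2) by (intro mult_right_mono) auto
    finally show ?thesis by (simp add: mult_ac)
  qed
  \<comment> \<open>The first bound keeps \<open>X\<close> in the range of \<open>near\<close>. The
    second makes the displacement along the motion smaller than slope \<open>c2\<close> times window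
    \<open>\<delta>\<close>, so that a crossing exists at every phase; the factor 2 is for the two
    shadowing errors in \<open>sgn2\<close>.\<close>
  define \<epsilon>3 where "\<epsilon>3 = min (\<epsilon>2 / (2 * K)) (c2 * \<delta> / (4 * K * P * um))"
  have \<epsilon>3: "\<epsilon>3 > 0" "K * \<epsilon>3 \<le> \<epsilon>2 / 2" "um * (P * (2 * (K * \<epsilon>3))) < c2 * \<delta>"
  proof -
    show "\<epsilon>3 > 0" using \<epsilon>2 K c2 \<delta> P um by (simp add: \<epsilon>3_def)
    have "K * \<epsilon>3 \<le> K * (\<epsilon>2 / (2 * K))" using K by (intro mult_left_mono) (auto simp: \<epsilon>3_def)
    then show "K * \<epsilon>3 \<le> \<epsilon>2 / 2" using K by simp
    have "um * (P * (2 * (K * \<epsilon>3))) \<le> um * (P * (2 * (K * (c2 * \<delta> / (4 * K * P * um)))))"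
      using K P um by (intro mult_left_mono) (auto simp: \<epsilon>3_def)
    also have "\<dots> = c2 * \<delta> / 2" using K P um by (simp add: field_simps)
    also have "\<dots> < c2 * \<delta>" using c2 \<delta> by simp
    finally show "um * (P * (2 * (K * \<epsilon>3))) < c2 * \<delta>" .
  qed
  have reb: "\<bar>Re (\<pi> w * cnj (u \<theta>))\<bar> \<le> um * (P * norm w)" if "0 \<le> \<theta>" "\<theta> \<le> T" for w \<theta>
  proof -
    have "\<bar>Re (\<pi> w * cnj (u \<theta>))\<bar> \<le> norm (\<pi> w) * norm (u \<theta>)"
      using abs_Re_le_cmod[of "\<pi> w * cnj (u \<theta>)"] by (simp add: norm_mult)
    also have "\<dots> \<le> (norm w * P) * um" using P um(2)[OF that] by (intro mult_mono) auto
    finally show ?thesis by (simp add: mult_ac)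
  qed
  have derX: "((\<lambda>s. Re (\<pi> (X (a + s) - y) * cnj w)) has_real_derivative Re (\<pi> (F (X (a + s))) * cnj w)) (at s)" for a s y w
  proof -
    have "((\<lambda>s. X (s + a) - y) has_vector_derivative F (X (s + a))) (at s)"
      using sol_shift[OF sol_\<Phi>[of x], of a] unfolding sol_def by (auto intro!: derivative_eq_intros)
    from bounded_linear.has_vector_derivative[OF bl_pi this]
    have "((\<lambda>s. \<pi> (X (s + a) - y) * cnj w) has_vector_derivative \<pi> (F (X (s + a))) * cnj w) (at s)"
      by (auto intro!: derivative_eq_intros)
    from bounded_linear.has_vector_derivative[OF bounded_linear_Re this]
    show ?thesis by (simp add: has_real_derivative_iff_has_vector_derivative add.commute)
  qed
  \<comment> \<open>\<open>sign_transport\<close> in the moving frame \<open>u \<theta>\<close>: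
    \<open>Y \<theta>\<close> is the reference point at phase \<open>\<theta>\<close> and
    \<open>a \<theta> + s\<close> the time at which \<open>X\<close> is compared with it. The order
    keeps the projected difference from vanishing.\<close>
  have transport: "Im (\<pi> (X (a 0 + s0) - Y 0) * cnj (u 0)) > 0 \<longleftrightarrow> Im (\<pi> (X (a T + s1) - Y T) * cnj (u T)) > 0"
    if ca: "continuous_on {0..T} a" and cY: "continuous_on {0..T} Y"
      and slope: "\<And>\<theta> s. 0 \<le> \<theta> \<Longrightarrow> \<theta> \<le> T \<Longrightarrow> \<bar>s - c\<bar> \<le> \<delta> \<Longrightarrow> c2 \<le> Re (\<pi> (F (X (a \<theta> + s))) * cnj (u \<theta>))"
      and mid: "\<And>\<theta>. 0 \<le> \<theta> \<Longrightarrow> \<theta> \<le> T \<Longrightarrow> \<bar>Re (\<pi> (X (a \<theta> + c) - Y \<theta>) * cnj (u \<theta>))\<bar> < c2 * \<delta>"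
      and nV: "\<And>\<theta> s. 0 \<le> \<theta> \<Longrightarrow> \<theta> \<le> T \<Longrightarrow> \<bar>s - c\<bar> \<le> \<delta> \<Longrightarrow> V (X (a \<theta> + s) - Y \<theta>) < 0"
      and s0: "\<bar>s0 - c\<bar> \<le> \<delta>" "Re (\<pi> (X (a 0 + s0) - Y 0) * cnj (u 0)) = 0"
      and s1: "\<bar>s1 - c\<bar> \<le> \<delta>" "Re (\<pi> (X (a T + s1) - Y T) * cnj (u T)) = 0"
    for a :: "real \<Rightarrow> real" and Y :: "real \<Rightarrow> 'a" and c s0 s1 :: real
  proof -
    define g where "g = (\<lambda>\<theta> s. \<pi> (X (a \<theta> + s) - Y \<theta>) * cnj (u \<theta>))"
    have mono: "Re (g \<theta> s') - Re (g \<theta> s) \<ge> c2 * (s' - s)"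
      if \<theta>: "0 \<le> \<theta>" "\<theta> \<le> T" and s: "c - \<delta> \<le> s" "s \<le> s'" "s' \<le> c + \<delta>" for \<theta> s s'
    proof (cases "s = s'")
      case False
      then have "s < s'" using s by simp
      from MVT2[OF this, of "\<lambda>s. Re (\<pi> (X (a \<theta> + s) - Y \<theta>) * cnj (u \<theta>))" "\<lambda>s. Re (\<pi> (F (X (a \<theta> + s))) * cnj (u \<theta>))"] derX
      obtain z where z: "s < z" "z < s'" "Re (g \<theta> s') - Re (g \<theta> s) = (s' - s) * Re (\<pi> (F (X (a \<theta> + z))) * cnj (u \<theta>))"
        unfolding g_def by blast
      have "c2 \<le> Re (\<pi> (F (X (a \<theta> + z))) * cnj (u \<theta>))" using z s by (intro slope \<theta>) (auto simp: abs_le_iff)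
      then have "(s' - s) * c2 \<le> (s' - s) * Re (\<pi> (F (X (a \<theta> + z))) * cnj (u \<theta>))" using s by (intro mult_left_mono) auto
      then show ?thesis using z(3) by (simp add: mult.commute)
    qed simp
    have "Im (g 0 s0) > 0 \<longleftrightarrow> Im (g T s1) > 0"
    proof (rule sign_transport[of T "c - \<delta>" "c + \<delta>"])
      show "continuous_on ({0..T} \<times> {c - \<delta>..c + \<delta>}) (\<lambda>z. g (fst z) (snd z))"
        unfolding g_def
        by (intro continuous_intros continuous_on_compose2[OF ca] continuous_on_compose2[OF cY]
            continuous_on_compose2[OF cu[of UNIV]]) auto
      show "Re (g \<theta> s) < Re (g \<theta> s')" if "0 \<le> \<theta>" "\<theta> \<le> T" "c - \<delta> \<le> s" "s < s'" "s' \<le> c + \<delta>" for \<theta> s s'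
      proof -
        have "c2 * (s' - s) > 0" using c2 that by simp
        then show ?thesis using mono[of \<theta> s s'] that by linarith
      qed
      show "Re (g \<theta> (c - \<delta>)) \<le> 0 \<and> 0 \<le> Re (g \<theta> (c + \<delta>))" if "0 \<le> \<theta>" "\<theta> \<le> T" for \<theta>
        using mono[OF that, of "c - \<delta>" c] mono[OF that, of c "c + \<delta>"] \<delta>(1) mid[OF that]
        by (auto simp: g_def abs_less_iff)
      show "g \<theta> s \<noteq> 0" if "0 \<le> \<theta>" "\<theta> \<le> T" "c - \<delta> \<le> s" "s \<le> c + \<delta>" for \<theta> s
      proof
        assume "g \<theta> s = 0"
        then have "\<pi> (X (a \<theta> + s) - Y \<theta>) = 0" using u0 by (simp add: g_def)
        moreover have V: "V (X (a \<theta> + s) - Y \<theta>) < 0" using that by (intro nV) (auto simp: abs_le_iff)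
        ultimately have "X (a \<theta> + s) - Y \<theta> = 0" using cone_V[of "X (a \<theta> + s) - Y \<theta>"] by simp
        then show False using V by simp
      qed
    qed (use T s0 s1 in \<open>auto simp: g_def abs_le_iff\<close>)
    then show ?thesis by (simp add: g_def)
  qed
  \<comment> \<open>The reference is the periodic orbit: after one turn \<open>X\<close> is still on
    the same side of it.\<close>
  have sgn1: "r (X t) > 0 \<longleftrightarrow> r (X t') > 0"
    if t: "t \<ge> tm" and t': "\<bar>t' - t - T\<bar> \<le> \<delta>" and hh: "h (X t) = 0" "h (X t') = 0" and cl: "norm (X t - p) \<le> \<epsilon>3" for t t'
  proof -
    have e: "K * norm (X t - p) \<le> K * \<epsilon>3" using cl K by (intro mult_left_mono) auto
    have "Im (\<pi> (X ((t + 0) + 0) - \<Phi> 0 p) * cnj (u 0)) > 0 \<longleftrightarrow> Im (\<pi> (X ((t + T) + (t' - t - T)) - \<Phi> T p) * cnj (u T)) > 0"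
    proof (rule transport[of "\<lambda>\<theta>. t + \<theta>" "\<lambda>\<theta>. \<Phi> \<theta> p" 0])
      fix \<theta> s assume \<theta>: "0 \<le> \<theta>" "\<theta> \<le> T" and s: "\<bar>s - 0\<bar> \<le> \<delta>"
      have b: "\<bar>\<theta> + s\<bar> \<le> 3*T" "\<bar>\<theta>\<bar> \<le> 3*T" using \<theta> s \<delta>(4) T(1) by (auto simp: abs_le_iff)
      have "norm (X (t + (\<theta> + s)) - \<Phi> (\<theta> + s) p) \<le> \<epsilon>2 / 2" using Kb[OF t b(1)] e \<epsilon>3(2) by linarith
      moreover have "norm (\<Phi> (\<theta> + s) p - \<Phi> \<theta> p) \<le> \<epsilon>2 / 2" using b s \<delta>(1) by (intro tclose) auto
      ultimately have "norm (X (t + \<theta> + s) - \<Phi> \<theta> p) \<le> \<epsilon>2"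
        using norm_triangle_ineq[of "X (t + (\<theta> + s)) - \<Phi> (\<theta> + s) p" "\<Phi> (\<theta> + s) p - \<Phi> \<theta> p"] by (simp add: add.assoc)
      moreover have "norm (X (t + \<theta> + s)) \<le> R"
        using t \<theta> s tm(3) \<delta>(4) T(1) by (intro X_bound) (auto simp: abs_le_iff)
      ultimately show "c2 \<le> Re (\<pi> (F (X (t + \<theta> + s))) * cnj (u \<theta>))" using \<theta> by (intro near)
    next
      fix \<theta> assume \<theta>: "0 \<le> \<theta>" "\<theta> \<le> T"
      have "norm (X (t + \<theta>) - \<Phi> \<theta> p) \<le> K * \<epsilon>3" using Kb[OF t, of \<theta>] e \<theta> T(1) by (auto simp: abs_le_iff)
      also have "\<dots> \<le> 2 * (K * \<epsilon>3)" using K \<epsilon>3(1) by simp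
      finally have "um * (P * norm (X (t + \<theta>) - \<Phi> \<theta> p)) \<le> um * (P * (2 * (K * \<epsilon>3)))"
        using um P by (intro mult_left_mono) auto
      then show "\<bar>Re (\<pi> (X (t + \<theta> + 0) - \<Phi> \<theta> p) * cnj (u \<theta>))\<bar> < c2 * \<delta>"
        using reb[OF \<theta>, of "X (t + \<theta>) - \<Phi> \<theta> p"] \<epsilon>3(3) by simp
    next
      fix \<theta> s assume \<theta>: "0 \<le> \<theta>" "\<theta> \<le> T" and s: "\<bar>s - 0\<bar> \<le> \<delta>"
      have "t + \<theta> + s \<ge> t0" using t \<theta> s tm(4) \<delta>(4) T(1) by (auto simp: abs_le_iff)
      then show "V (X (t + \<theta> + s) - \<Phi> \<theta> p) < 0" by (rule ord)
    qed (use hh t' \<delta>(1) T in \<open>auto simp: h_def v_def[symmetric] uT intro!: continuous_intros\<close>)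
    then show ?thesis using T by (simp add: r_def v_def[symmetric] uT)
  qed
  \<comment> \<open>The reference is \<open>X\<close> one return earlier, ordered with itself by
    \<open>self\<close>.\<close>
  have sgn2: "r (X t') - r (X t) > 0 \<longleftrightarrow> r (X t'') - r (X t') > 0"
    if t: "t \<ge> tm" and t': "\<bar>t' - t - T\<bar> \<le> \<delta>" "\<bar>t'' - t' - T\<bar> \<le> \<delta>"
      and hh: "h (X t) = 0" "h (X t') = 0" "h (X t'') = 0" and cl: "norm (X t - p) \<le> \<epsilon>3" for t t' t''
  proof -
    have e: "K * norm (X t - p) \<le> K * \<epsilon>3" using cl K by (intro mult_left_mono) auto
    \<comment> \<open>A return takes time \<open>t' - t\<close> instead of \<open>T\<close>, so the
      phase is stretched by \<open>k\<close>: phase \<open>0\<close> compares \<open>t\<close> with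
      \<open>t'\<close>, and phase \<open>T\<close> compares \<open>t'\<close> with
      \<open>t''\<close>.\<close>
    define k where "k = (t' - t) / T"
    have kT: "k * T = t' - t" using T by (simp add: k_def)
    have kth: "\<bar>k * \<theta> - \<theta>\<bar> \<le> \<delta>" if "0 \<le> \<theta>" "\<theta> \<le> T" for \<theta>
    proof -
      have "k * \<theta> - \<theta> = (k - 1) * \<theta>" "k * T - T = (k - 1) * T" by (simp_all add: left_diff_distrib)
      then have e: "\<bar>k * \<theta> - \<theta>\<bar> = \<bar>k - 1\<bar> * \<theta>" "\<bar>k - 1\<bar> * T = \<bar>k * T - T\<bar>"
        using that T(1) by (simp_all add: abs_mult)
      have "\<bar>k * \<theta> - \<theta>\<bar> = \<bar>k - 1\<bar> * \<theta>" by (rule e(1))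
      also have "\<dots> \<le> \<bar>k - 1\<bar> * T" using that by (intro mult_left_mono) auto
      also have "\<dots> = \<bar>k * T - T\<bar>" by (rule e(2))
      finally show ?thesis using kT t'(1) by simp
    qed
    have cmp: "Re (\<pi> (X a - X b) * cnj v) = h (X a) - h (X b)" "Im (\<pi> (X a - X b) * cnj v) = r (X a) - r (X b)" for a b
      unfolding h_def r_def diff0[of "X a" "X b", symmetric] by simp_all
    have "Im (\<pi> (X ((t + k * 0) + (t' - t)) - X (t + k * 0)) * cnj (u 0)) > 0 \<longleftrightarrow>
          Im (\<pi> (X ((t + k * T) + (t'' - t')) - X (t + k * T)) * cnj (u T)) > 0"
    proof (rule transport[of "\<lambda>\<theta>. t + k * \<theta>" "\<lambda>\<theta>. X (t + k * \<theta>)" T])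
      fix \<theta> s assume \<theta>: "0 \<le> \<theta>" "\<theta> \<le> T" and s: "\<bar>s - T\<bar> \<le> \<delta>"
      have b: "\<bar>k * \<theta> + s\<bar> \<le> 3*T" "\<bar>k * \<theta> + s - T\<bar> \<le> 3*T" "\<bar>\<theta>\<bar> \<le> 3*T" "k * \<theta> + s \<ge> 0"
        using \<theta> s \<delta>(4) T(1) kth[OF \<theta>] by (auto simp: abs_le_iff)
      have "norm (X (t + (k * \<theta> + s)) - \<Phi> (k * \<theta> + s) p) \<le> \<epsilon>2 / 2" using Kb[OF t b(1)] e \<epsilon>3(2) by linarith
      moreover have "norm (\<Phi> (k * \<theta> + s - T) p - \<Phi> \<theta> p) \<le> \<epsilon>2 / 2"
        using b s \<delta>(1) kth[OF \<theta>] by (intro tclose) auto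
      then have "norm (\<Phi> (k * \<theta> + s) p - \<Phi> \<theta> p) \<le> \<epsilon>2 / 2" using per(2) by simp
      ultimately have "norm (X (t + k * \<theta> + s) - \<Phi> \<theta> p) \<le> \<epsilon>2"
        using norm_triangle_ineq[of "X (t + (k * \<theta> + s)) - \<Phi> (k * \<theta> + s) p" "\<Phi> (k * \<theta> + s) p - \<Phi> \<theta> p"] by (simp add: add.assoc)
      moreover have "norm (X (t + k * \<theta> + s)) \<le> R"
        using t b(4) tm0 by (intro X_bound) auto
      ultimately show "c2 \<le> Re (\<pi> (F (X (t + k * \<theta> + s))) * cnj (u \<theta>))" using \<theta> by (intro near)
    next
      fix \<theta> assume \<theta>: "0 \<le> \<theta>" "\<theta> \<le> T"
      have b: "\<bar>k * \<theta>\<bar> \<le> 3*T" "\<bar>k * \<theta> + T\<bar> \<le> 3*T"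
        using \<theta> \<delta>(4) T(1) kth[OF \<theta>] by (auto simp: abs_le_iff)
      have "norm (X (t + (k * \<theta> + T)) - \<Phi> (k * \<theta> + T) p) \<le> K * \<epsilon>3" "norm (X (t + k * \<theta>) - \<Phi> (k * \<theta>) p) \<le> K * \<epsilon>3"
        using Kb[OF t b(1)] Kb[OF t b(2)] e by linarith+
      then have "norm (X (t + k * \<theta> + T) - X (t + k * \<theta>)) \<le> 2 * (K * \<epsilon>3)"
        using norm_triangle_ineq4[of "X (t + (k * \<theta> + T)) - \<Phi> (k * \<theta> + T) p" "X (t + k * \<theta>) - \<Phi> (k * \<theta>) p"] per(1)
        by (simp add: add.assoc)
      then have "um * (P * norm (X (t + k * \<theta> + T) - X (t + k * \<theta>))) \<le> um * (P * (2 * (K * \<epsilon>3)))"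
        using um P by (intro mult_left_mono) auto
      then show "\<bar>Re (\<pi> (X (t + k * \<theta> + T) - X (t + k * \<theta>)) * cnj (u \<theta>))\<bar> < c2 * \<delta>"
        using reb[OF \<theta>, of "X (t + k * \<theta> + T) - X (t + k * \<theta>)"] \<epsilon>3(3) by linarith
    next
      fix \<theta> s assume \<theta>: "0 \<le> \<theta>" "\<theta> \<le> T" and s: "\<bar>s - T\<bar> \<le> \<delta>"
      have "k \<ge> 0" using t'(1) \<delta>(4) T(1) by (auto simp: k_def abs_le_iff)
      then have "t + k * \<theta> \<ge> \<tau>0" using t tm(2) \<theta> by (meson add_increasing2 mult_nonneg_nonneg order_trans)
      then show "V (X (t + k * \<theta> + s) - X (t + k * \<theta>)) < 0" using s \<delta>(2) by (intro self) auto
    qed (use hh t' T cmp(1)[of t' t] cmp(1)[of t'' t'] in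
        \<open>auto simp: v_def[symmetric] uT kT intro!: continuous_intros\<close>)
    moreover have "t + k * 0 + (t' - t) = t'" "t + k * 0 = t" "t + k * T = t'" "t' + (t'' - t') = t''"
      using kT by simp_all
    ultimately show ?thesis by (simp only: uT cmp v_def[symmetric])
  qed
  have rne: "r (X t') \<noteq> r (X t)" if t: "t \<ge> tm" and t': "\<bar>t' - t - T\<bar> \<le> \<delta>" and hh: "h (X t) = 0" "h (X t') = 0" for t t'
  proof
    assume "r (X t') = r (X t)"
    then have "\<pi> (X t' - p) * cnj v = \<pi> (X t - p) * cnj v" using hh by (auto simp: complex_eq_iff h_def r_def)
    then have "\<pi> (X t' - X t) = 0" using diff0[of "X t'" "X t"] v0 by auto
    moreover have V: "V (X (t + (t' - t)) - X t) < 0" using t tm(2) t' \<delta>(2) by (intro self) auto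
    ultimately have "X t' - X t = 0" using cone_V[of "X t' - X t"] by simp
    then show False using V by simp
  qed
  \<comment> \<open>\<open>r\<close> keeps its sign and so does its increment: once it moves towards
    zero it goes on doing so without passing zero.\<close>
  have dec: "\<bar>r (X t'')\<bar> < \<bar>r (X t')\<bar>"
    if t: "t \<ge> tm" "t' \<ge> tm" and t': "\<bar>t' - t - T\<bar> \<le> \<delta>" "\<bar>t'' - t' - T\<bar> \<le> \<delta>"
      and hh: "h (X t) = 0" "h (X t') = 0" "h (X t'') = 0"
      and cl: "norm (X t - p) \<le> \<epsilon>3" "norm (X t' - p) \<le> \<epsilon>3" and d: "\<bar>r (X t')\<bar> < \<bar>r (X t)\<bar>" for t t' t''
    using sgn1[OF t(1) t'(1) hh(1,2) cl(1)] sgn1[OF t(2) t'(2) hh(2,3) cl(2)]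
      sgn2[OF t(1) t' hh cl(1)] rne[OF t(2) t'(2) hh(2,3)] rne[OF t(1) t'(1) hh(1,2)]
      rn0[OF t(1) hh(1)] rn0[OF t(2) hh(2)] d by linarith
  \<comment> \<open>\<open>\<sigma> = 0\<close> moves a visit near \<open>p\<close> onto the
    section; \<open>T\<close> and \<open>- T\<close> produce the next and the previous
    return.\<close>
  have ret: "\<exists>\<eta>>0. \<forall>t\<ge>tm. norm (X t - p) \<le> \<eta> \<longrightarrow> (\<exists>t'. \<bar>t' - t - \<sigma>\<bar> \<le> \<delta> \<and> h (X t') = 0 \<and> norm (X t' - p) \<le> \<xi>)"
    if \<sigma>: "\<sigma> = 0 \<or> \<sigma> = T \<or> \<sigma> = - T" and \<xi>: "\<xi> > 0" for \<sigma> \<xi>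
  proof -
    have \<sigma>p: "\<Phi> (\<sigma> + s) p = \<Phi> s p" for s using \<sigma> per(1)[of s] per(2)[of s] by (auto simp: add.commute)
    have "continuous_on UNIV (\<lambda>t. \<Phi> t p)" by (intro continuous_intros)
    then have "isCont (\<lambda>t. \<Phi> t p) 0" by (simp add: continuous_on_eq_continuous_at)
    then obtain d where d: "d > 0" "\<And>s. \<bar>s\<bar> < d \<Longrightarrow> norm (\<Phi> s p - p) < \<xi> / 2"
      unfolding continuous_at_eps_delta dist_norm using \<xi> by (metis \<Phi>_0 diff_zero half_gt_zero real_norm_def)
    define e where "e = min (d/2) \<delta>"
    have e: "e > 0" "e \<le> \<delta>" "e < d" using d \<delta> by (auto simp: e_def)
    have grow: "c2 * (b - a) \<le> h (\<Phi> b p) - h (\<Phi> a p)" if ab: "- e \<le> a" "a < b" "b \<le> e" for a b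
    proof -
      have der: "((\<lambda>s. h (\<Phi> s p)) has_real_derivative Re (\<pi> (F (\<Phi> s p)) * cnj v)) (at s)" for s
      proof -
        have "((\<lambda>s. \<Phi> s p - p) has_vector_derivative F (\<Phi> s p)) (at s)"
          using sol_\<Phi>[of p] unfolding sol_def by (auto intro!: derivative_eq_intros)
        from bounded_linear.has_vector_derivative[OF bl_pi this]
        have "((\<lambda>s. \<pi> (\<Phi> s p - p) * cnj v) has_vector_derivative \<pi> (F (\<Phi> s p)) * cnj v) (at s)"
          by (auto intro!: derivative_eq_intros)
        from bounded_linear.has_vector_derivative[OF bounded_linear_Re this]
        show ?thesis by (simp add: h_def has_real_derivative_iff_has_vector_derivative)
      qed
      obtain z where z: "a < z" "z < b" "h (\<Phi> b p) - h (\<Phi> a p) = (b - a) * Re (\<pi> (F (\<Phi> z p)) * cnj v)"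
        using MVT2[OF ab(2), of "\<lambda>s. h (\<Phi> s p)" "\<lambda>s. Re (\<pi> (F (\<Phi> s p)) * cnj v)"] der by blast
      have "norm (\<Phi> z p - \<Phi> 0 p) \<le> \<epsilon>2 / 2" using z ab e \<delta>(4) T(1) by (intro tclose) (auto simp: abs_le_iff)
      then have "c2 \<le> Re (\<pi> (F (\<Phi> z p)) * cnj v)"
        unfolding v_def using pb T(1) \<epsilon>2 by (intro near) auto
      then have "(b - a) * c2 \<le> (b - a) * Re (\<pi> (F (\<Phi> z p)) * cnj v)" using ab by (intro mult_left_mono) auto
      then show ?thesis using z(3) by (simp add: mult.commute)
    qed
    have hp: "h p = 0" using lin_pi by (simp add: h_def linear_0)
    have up: "c2 * e \<le> h (\<Phi> e p)" and dn: "h (\<Phi> (- e) p) \<le> - (c2 * e)"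
      using grow[of 0 e] grow[of "- e" 0] e hp by auto
    define \<eta> where "\<eta> = min (\<xi> / (2 * K)) (c2 * e / (um * P * K))"
    have \<eta>: "\<eta> > 0" "K * \<eta> \<le> \<xi> / 2" "um * (P * (K * \<eta>)) \<le> c2 * e"
    proof -
      show "\<eta> > 0" using \<xi> K c2 e um P by (simp add: \<eta>_def)
      have "K * \<eta> \<le> K * (\<xi> / (2 * K))" using K by (intro mult_left_mono) (auto simp: \<eta>_def)
      then show "K * \<eta> \<le> \<xi> / 2" using K by simp
      have "um * (P * (K * \<eta>)) \<le> um * (P * (K * (c2 * e / (um * P * K))))"
        using K um P by (intro mult_left_mono) (auto simp: \<eta>_def)
      also have "\<dots> = c2 * e" using K um P by simp
      finally show "um * (P * (K * \<eta>)) \<le> c2 * e" .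
    qed
    have "\<exists>t'. \<bar>t' - t - \<sigma>\<bar> \<le> \<delta> \<and> h (X t') = 0 \<and> norm (X t' - p) \<le> \<xi>"
      if t: "t \<ge> tm" and cl: "norm (X t - p) \<le> \<eta>" for t
    proof -
      have sh: "norm (X (t + (\<sigma> + s)) - \<Phi> s p) \<le> K * \<eta>" if "\<bar>s\<bar> \<le> e" for s
      proof -
        have "\<bar>\<sigma> + s\<bar> \<le> 3*T" using \<sigma> that e(2) \<delta>(4) T(1) by (auto simp: abs_le_iff)
        from Kb[OF t this] have "norm (X (t + (\<sigma> + s)) - \<Phi> s p) \<le> K * norm (X t - p)" by (simp add: \<sigma>p)
        also have "\<dots> \<le> K * \<eta>" using cl K by (intro mult_left_mono) auto
        finally show ?thesis .
      qed
      have hd: "\<bar>h (X (t + (\<sigma> + s))) - h (\<Phi> s p)\<bar> \<le> c2 * e" if "\<bar>s\<bar> \<le> e" for s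
      proof -
        have "h (X (t + (\<sigma> + s))) - h (\<Phi> s p) = Re (\<pi> (X (t + (\<sigma> + s)) - \<Phi> s p) * cnj (u 0))"
          unfolding h_def v_def[symmetric] diff0[of "X (t + (\<sigma> + s))" "\<Phi> s p", symmetric] by simp
        then have "\<bar>h (X (t + (\<sigma> + s))) - h (\<Phi> s p)\<bar> \<le> um * (P * norm (X (t + (\<sigma> + s)) - \<Phi> s p))"
          using reb[of 0 "X (t + (\<sigma> + s)) - \<Phi> s p"] T(1) by simp
        also have "\<dots> \<le> um * (P * (K * \<eta>))" using um P sh[OF that] by (intro mult_left_mono) auto
        finally show ?thesis using \<eta>(3) by linarith
      qed
      have "h (X (t + (\<sigma> + - e))) \<le> 0" "0 \<le> h (X (t + (\<sigma> + e)))" using hd[of e] hd[of "- e"] up dn e(1) by auto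
      moreover have "continuous_on {- e..e} (\<lambda>s. h (X (t + (\<sigma> + s))))" unfolding h_def by (intro continuous_intros)
      ultimately obtain s where s: "- e \<le> s" "s \<le> e" "h (X (t + (\<sigma> + s))) = 0"
        using IVT'[of "\<lambda>s. h (X (t + (\<sigma> + s)))" "- e" 0 e] e(1) by auto
      have "norm (X (t + (\<sigma> + s)) - p) \<le> \<xi>"
      proof -
        have "\<bar>s\<bar> \<le> e" "\<bar>s\<bar> < d" using s e(3) by (auto simp: abs_le_iff)
        then show ?thesis
          using sh[of s] d(2)[of s] \<eta>(2) norm_triangle_ineq[of "X (t + (\<sigma> + s)) - \<Phi> s p" "\<Phi> s p - p"] by simp
      qed
      then show ?thesis using s e(2) by (intro exI[of _ "t + (\<sigma> + s)"]) auto
    qed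
    then show ?thesis using \<eta>(1) by blast
  qed
  have Sn: "real (Suc n) * c = real n * c + c" for n c by (simp add: distrib_right)
  define pair where "pair = (\<lambda>t t'. tm \<le> t \<and> \<bar>t' - t - T\<bar> \<le> \<delta> \<and> h (X t) = 0 \<and> h (X t') = 0)"
  show ?thesis
  proof (cases "\<forall>\<eta>>0. \<exists>t t'. pair t t' \<and> \<bar>r (X t')\<bar> < \<bar>r (X t)\<bar> \<and> \<bar>r (X t)\<bar> < \<eta>")
    case True
    \<comment> \<open>A time is \<open>good\<close> if it is close to \<open>p\<close> and a
      decreasing return follows. By \<open>dec\<close> this passes on to that return, and shadowing
      bridges the gaps of at most \<open>2*T\<close>.\<close>
    have track: "\<exists>s. \<forall>t\<ge>s. \<exists>\<theta>. norm (X t - \<Phi> \<theta> p) \<le> e" if e: "e > 0" for e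
    proof -
      obtain \<eta>r where \<eta>r: "\<eta>r > 0" "\<And>t. t \<ge> tm \<Longrightarrow> norm (X t - p) \<le> \<eta>r \<Longrightarrow>
          \<exists>t'. \<bar>t' - t - T\<bar> \<le> \<delta> \<and> h (X t') = 0 \<and> norm (X t' - p) \<le> \<epsilon>3"
        using ret[of T \<epsilon>3] \<epsilon>3(1) by auto
      define \<eta> where "\<eta> = Min {\<eta>r / C1, \<epsilon>3 / C1, e / (K * C1)}"
      have \<eta>: "\<eta> > 0" "C1 * \<eta> \<le> \<eta>r" "C1 * \<eta> \<le> \<epsilon>3" "K * (C1 * \<eta>) \<le> e"
      proof -
        have "\<eta> \<le> \<eta>r / C1" "\<eta> \<le> \<epsilon>3 / C1" "\<eta> \<le> e / (K * C1)" by (auto simp: \<eta>_def)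
        then show "C1 * \<eta> \<le> \<eta>r" "C1 * \<eta> \<le> \<epsilon>3" "K * (C1 * \<eta>) \<le> e" using C1 K by (auto simp: field_simps)
        show "\<eta> > 0" using C1 K e \<eta>r \<epsilon>3 by (simp add: \<eta>_def)
      qed
      define good where "good = (\<lambda>t. \<bar>r (X t)\<bar> \<le> \<eta> \<and> (\<exists>t'. pair t t' \<and> \<bar>r (X t')\<bar> < \<bar>r (X t)\<bar>))"
      have goodcl: "norm (X t - p) \<le> C1 * \<eta>" if "tm \<le> t" "h (X t) = 0" "\<bar>r (X t)\<bar> \<le> \<eta>" for t
      proof -
        have "C1 * \<bar>r (X t)\<bar> \<le> C1 * \<eta>" using that C1 by (intro mult_left_mono) auto
        then show ?thesis using dl[OF that(1,2)] by linarith
      qed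
      have step: "\<exists>t'. t + T/2 \<le> t' \<and> t' \<le> t + 2*T \<and> good t'" if g: "good t" for t
      proof -
        obtain t' where t': "pair t t'" "\<bar>r (X t')\<bar> < \<bar>r (X t)\<bar>" "\<bar>r (X t)\<bar> \<le> \<eta>" using g by (auto simp: good_def)
        have t'T: "t + T/2 \<le> t'" "t' \<le> t + 2*T" using t'(1) \<delta>(4) T(1) by (auto simp: pair_def abs_le_iff)
        have tt: "tm \<le> t" "tm \<le> t'" "h (X t) = 0" "h (X t') = 0" "\<bar>t' - t - T\<bar> \<le> \<delta>"
          using t'(1) t'T T(1) by (auto simp: pair_def)
        have cl: "norm (X t - p) \<le> C1 * \<eta>" "norm (X t' - p) \<le> C1 * \<eta>" using tt t' by (auto intro!: goodcl)
        obtain t'' where t'': "\<bar>t'' - t' - T\<bar> \<le> \<delta>" "h (X t'') = 0"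
          using \<eta>r(2)[OF tt(2)] cl(2) \<eta>(2) by auto
        have "\<bar>r (X t'')\<bar> < \<bar>r (X t')\<bar>"
          using cl \<eta>(3) t'(2) by (intro dec[OF tt(1,2,5) t''(1) tt(3,4) t''(2)]) auto
        then have "good t'" using t' t'' tt by (auto simp: good_def pair_def)
        then show ?thesis using t'T by blast
      qed
      obtain ta where ta: "good ta" "tm \<le> ta"
      proof -
        obtain t t' where "pair t t'" "\<bar>r (X t')\<bar> < \<bar>r (X t)\<bar>" "\<bar>r (X t)\<bar> < \<eta>" using True \<eta>(1) by blast
        then show ?thesis using that[of t] by (auto simp: good_def pair_def)
      qed
      \<comment> \<open>The induction proceeds by \<open>T/2\<close>, the least advance of
        \<open>step\<close>.\<close>
      have cover: "\<forall>s. ta \<le> s \<and> s \<le> ta + real n * (T/2) \<longrightarrow> (\<exists>t. good t \<and> t \<le> s \<and> s \<le> t + 2*T)" for n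
      proof (induction n)
        case 0
        then show ?case using ta T(1) by (auto intro!: exI[of _ ta])
      next
        case (Suc n)
        show ?case
        proof (intro allI impI)
          fix s assume s: "ta \<le> s \<and> s \<le> ta + real (Suc n) * (T/2)"
          show "\<exists>t. good t \<and> t \<le> s \<and> s \<le> t + 2*T"
          proof (cases "s < ta + T/2")
            case True
            then show ?thesis using ta s T(1) by (intro exI[of _ ta]) auto
          next
            case False
            then have "ta \<le> s - T/2 \<and> s - T/2 \<le> ta + real n * (T/2)" using s unfolding Sn by linarith
            then obtain t where t: "good t" "t \<le> s - T/2" "s - T/2 \<le> t + 2*T" using Suc by blast
            show ?thesis
            proof (cases "s \<le> t + 2*T")
              case True then show ?thesis using t T(1) by (intro exI[of _ t]) auto
            next
              case False
              obtain t' where t': "t + T/2 \<le> t'" "t' \<le> t + 2*T" "good t'" using step[OF t(1)] by blast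
              then have "t' \<le> s" "s \<le> t' + 2*T" using t(3) False by linarith+
              then show ?thesis using t'(3) by blast
            qed
          qed
        qed
      qed
      have "\<exists>\<theta>. norm (X s - \<Phi> \<theta> p) \<le> e" if s: "s \<ge> ta" for s
      proof -
        obtain n :: nat where "(s - ta) / (T/2) \<le> real n" using real_arch_simple by blast
        then have "s \<le> ta + real n * (T/2)" using T(1) by (simp add: field_simps)
        then obtain t where t: "good t" "t \<le> s" "s \<le> t + 2*T" using cover s by blast
        have tt: "tm \<le> t" "h (X t) = 0" "\<bar>r (X t)\<bar> \<le> \<eta>" using t(1) by (auto simp: good_def pair_def)
        have "norm (X (t + (s - t)) - \<Phi> (s - t) p) \<le> K * norm (X t - p)"
          using t T(1) by (intro Kb tt) (auto simp: abs_le_iff)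
        also have "\<dots> \<le> K * (C1 * \<eta>)" using goodcl[OF tt] K by (intro mult_left_mono) auto
        finally show ?thesis using \<eta>(4) by (intro exI[of _ "s - t"]) simp
      qed
      then show ?thesis by blast
    qed
    show ?thesis
    proof (rule periodic_orbitI[OF p T])
      fix y assume y: "y \<in> \<Omega>"
      have "y \<in> closure (range (\<lambda>t. \<Phi> t p))"
        unfolding closure_approachable
      proof (intro allI impI)
        fix e :: real assume e: "e > 0"
        obtain s where s: "\<And>t. t \<ge> s \<Longrightarrow> \<exists>\<theta>. norm (X t - \<Phi> \<theta> p) \<le> e / 2" using track[of "e/2"] e by auto
        obtain t where t: "t \<ge> s" "dist (X t) y < e / 2" using y e unfolding omega_limit_iff by (meson half_gt_zero)
        obtain \<theta> where "norm (X t - \<Phi> \<theta> p) \<le> e / 2" using s[OF t(1)] by blast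
        then have "dist (\<Phi> \<theta> p) y < e" using t(2) dist_triangle3[of "\<Phi> \<theta> p" y "X t"] by (simp add: dist_norm)
        then show "\<exists>z\<in>range (\<lambda>t. \<Phi> t p). dist z y < e" by blast
      qed
      then show "\<exists>t. y = \<Phi> t p" using compact_imp_closed[OF compact_periodic[OF T]] by (auto simp: closure_closed)
    qed
  next
    case False
    then obtain \<eta>3 where \<eta>3: "\<eta>3 > 0" "\<And>t t'. pair t t' \<Longrightarrow> \<bar>r (X t)\<bar> < \<eta>3 \<Longrightarrow> \<bar>r (X t)\<bar> \<le> \<bar>r (X t')\<bar>"
      by (meson not_le)
    define vP where "vP = norm v * P"
    have vP: "vP > 0" using v0 P by (simp add: vP_def)
    \<comment> \<open>Close visits occur arbitrarily late. The previous return of each has no larger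
      \<open>\<bar>r\<bar>\<close>, so the closeness is inherited back to the first
      \<open>3*T\<close> units after \<open>tm\<close>.\<close>
    have returns: "\<exists>t. tm \<le> t \<and> t \<le> tm + 3*T \<and> norm (X t - p) \<le> e" if e: "e > 0" for e
    proof -
      define \<xi> where "\<xi> = \<eta>3 / (2 * vP)"
      have \<xi>: "\<xi> > 0" "vP * \<xi> < \<eta>3" using \<eta>3(1) vP by (auto simp: \<xi>_def)
      obtain \<eta>b where \<eta>b: "\<eta>b > 0" "\<And>t. t \<ge> tm \<Longrightarrow> norm (X t - p) \<le> \<eta>b \<Longrightarrow>
          \<exists>t'. \<bar>t' - t - (- T)\<bar> \<le> \<delta> \<and> h (X t') = 0 \<and> norm (X t' - p) \<le> \<xi>"
        using ret[of "- T" \<xi>] \<xi>(1) by auto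
      define \<eta> where "\<eta> = min (\<eta>b / C1) (e / C1)"
      have \<eta>: "\<eta> > 0" "C1 * \<eta> \<le> \<eta>b" "C1 * \<eta> \<le> e"
      proof -
        have "\<eta> \<le> \<eta>b / C1" "\<eta> \<le> e / C1" by (auto simp: \<eta>_def)
        then show "C1 * \<eta> \<le> \<eta>b" "C1 * \<eta> \<le> e" using C1 by (auto simp: field_simps)
        show "\<eta> > 0" using C1 e \<eta>b by (simp add: \<eta>_def)
      qed
      define Q where "Q = (\<lambda>t. tm \<le> t \<and> h (X t) = 0 \<and> \<bar>r (X t)\<bar> \<le> \<eta>)"
      have Qcl: "norm (X t - p) \<le> C1 * \<eta>" if "Q t" for t
      proof -
        have "C1 * \<bar>r (X t)\<bar> \<le> C1 * \<eta>" using that C1 by (intro mult_left_mono) (auto simp: Q_def)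
        then show ?thesis using dl[of t] that by (auto simp: Q_def)
      qed
      have step: "\<exists>t'. t' \<le> t - T/2 \<and> Q t'" if Q: "Q t" and tb: "t > tm + 3*T" for t
      proof -
        have tt: "tm \<le> t" "h (X t) = 0" "\<bar>r (X t)\<bar> \<le> \<eta>" using Q by (auto simp: Q_def)
        obtain t' where t': "\<bar>t' - t - (- T)\<bar> \<le> \<delta>" "h (X t') = 0" "norm (X t' - p) \<le> \<xi>"
          using \<eta>b(2)[OF tt(1)] Qcl[OF Q] \<eta>(2) by auto
        have b: "t' \<le> t - T/2" "tm \<le> t'" using t'(1) \<delta>(4) T(1) tb by (auto simp: abs_le_iff)
        have "\<bar>r (X t')\<bar> \<le> vP * norm (X t' - p)" using rb by (simp add: vP_def)
        also have "\<dots> \<le> vP * \<xi>" using t'(3) vP by (intro mult_left_mono) auto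
        finally have "\<bar>r (X t')\<bar> < \<eta>3" using \<xi>(2) by linarith
        moreover have "pair t' t" using t' b tt by (auto simp: pair_def abs_le_iff)
        ultimately have "\<bar>r (X t')\<bar> \<le> \<bar>r (X t)\<bar>" using \<eta>3(2) by blast
        then have "Q t'" using t' b tt by (simp add: Q_def)
        then show ?thesis using b by blast
      qed
      have descend: "\<forall>t. Q t \<and> t \<le> tm + 3*T + real n * (T/2) \<longrightarrow> (\<exists>t'. Q t' \<and> t' \<le> tm + 3*T)" for n
      proof (induction n)
        case (Suc n)
        show ?case
        proof (intro allI impI)
          fix t assume t: "Q t \<and> t \<le> tm + 3*T + real (Suc n) * (T/2)"
          show "\<exists>t'. Q t' \<and> t' \<le> tm + 3*T"
          proof (cases "t \<le> tm + 3*T")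
            case False
            then have "t > tm + 3*T" by simp
            then obtain t' where t': "t' \<le> t - T/2" "Q t'" using step t by blast
            then have "t' \<le> tm + 3*T + real n * (T/2)" using t unfolding Sn by linarith
            then show ?thesis using Suc t' by blast
          qed (use t in blast)
        qed
      qed auto
      obtain \<eta>s where \<eta>s: "\<eta>s > 0" "\<And>t. t \<ge> tm \<Longrightarrow> norm (X t - p) \<le> \<eta>s \<Longrightarrow>
          \<exists>t'. \<bar>t' - t - 0\<bar> \<le> \<delta> \<and> h (X t') = 0 \<and> norm (X t' - p) \<le> \<eta> / vP"
        using ret[of 0 "\<eta> / vP"] \<eta>(1) vP by auto
      obtain t where t: "t \<ge> tm + T" "dist (X t) p < \<eta>s" using p \<eta>s(1) unfolding omega_limit_iff by blast
      obtain t' where t': "\<bar>t' - t - 0\<bar> \<le> \<delta>" "h (X t') = 0" "norm (X t' - p) \<le> \<eta> / vP"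
        using \<eta>s(2)[of t] t T(1) by (auto simp: dist_norm)
      have "\<bar>r (X t')\<bar> \<le> vP * norm (X t' - p)" using rb by (simp add: vP_def)
      also have "\<dots> \<le> vP * (\<eta> / vP)" using t'(3) vP by (intro mult_left_mono) auto
      finally have "Q t'" using t' t \<delta>(4) T(1) vP by (auto simp: Q_def abs_le_iff)
      moreover obtain n :: nat where "(t' - (tm + 3*T)) / (T/2) \<le> real n" using real_arch_simple by blast
      then have "t' \<le> tm + 3*T + real n * (T/2)" using T(1) by (simp add: field_simps)
      ultimately obtain t'' where t'': "Q t''" "t'' \<le> tm + 3*T" using descend by blast
      then show ?thesis using Qcl[OF t''(1)] \<eta>(3) by (auto simp: Q_def)
    qed
    have "continuous_on {tm..tm + 3*T} (\<lambda>t. norm (X t - p))" by (intro continuous_intros)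
    moreover have "{tm..tm + 3*T} \<noteq> {}" using T(1) by simp
    ultimately obtain ts where ts: "ts \<in> {tm..tm + 3*T}" "\<And>t. t \<in> {tm..tm + 3*T} \<Longrightarrow> norm (X ts - p) \<le> norm (X t - p)"
      using continuous_attains_inf[OF compact_Icc, of tm "tm + 3*T" "\<lambda>t. norm (X t - p)"] by blast
    have "X ts = p"
    proof (rule ccontr)
      assume "X ts \<noteq> p"
      then have "norm (X ts - p) / 2 > 0" by simp
      then obtain t where t: "tm \<le> t" "t \<le> tm + 3*T" "norm (X t - p) \<le> norm (X ts - p) / 2" using returns by blast
      have "norm (X ts - p) \<le> norm (X t - p)" using t by (intro ts(2)) auto
      then show False using t(3) \<open>norm (X ts - p) / 2 > 0\<close> by linarith
    qed
    then show ?thesis using ord[of ts 0] ts(1) tm(1) by simp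
  qed
qed

theorem periodic_omega: "periodic_orbit \<Phi> \<Omega>"
proof -
  obtain p T where p: "p \<in> \<Omega>" "T > 0" "\<Phi> T p = p" using periodic_point_exists by blast
  show ?thesis
  proof (cases "\<exists>t0\<ge>0. \<forall>\<theta>. V (X t0 - \<Phi> \<theta> p) < 0")
    case True
    then show ?thesis using periodic_if_ordered_with[OF p] by blast
  next
    case False
    then show ?thesis using periodic_if_not_ordered_with[OF p] by (meson not_less)
  qed
qed

end

context tangent_orbit
begin

theorem omega_periodic: "periodic_orbit \<Phi> \<Omega>"
proof (cases "\<forall>s>0. \<exists>t\<ge>0. V (X (t + s) - X t) \<le> 0")
  case True
  then interpret ordered_orbit F DF \<Phi> q lam \<pi> C x R by unfold_locales blast
  show ?thesis by (rule periodic_omega)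
next
  case False
  then show ?thesis using periodic_if_unordered_shift by (meson not_le)
qed

end

section \<open>Almost every point\<close>

lemma matrix_form_expand:
  fixes Q J :: "real ^ 'n ^ 'n"
  assumes sym: "symmetric_matrix Q"
  shows "v \<bullet> ((Q ** J + transpose J ** Q + c *\<^sub>R Q) *v v) = 2 * ((Q *v v) \<bullet> (J *v v)) + c * (v \<bullet> (Q *v v))"
proof -
  have "v \<bullet> (Q *v (J *v v)) = (Q *v v) \<bullet> (J *v v)"
    using sym by (metis dot_lmul_matrix inner_commute symmetric_matrix_def transpose_matrix_vector)
  moreover have "v \<bullet> (transpose J *v (Q *v v)) = (Q *v v) \<bullet> (J *v v)"
    by (metis dot_lmul_matrix inner_commute transpose_matrix_vector)
  ultimately show ?thesis
    by (simp add: matrix_vector_mult_add_rdistrib inner_add_right scaleR_matrix_vector_assoc[symmetric]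
        matrix_vector_mul_assoc[symmetric])
qed

context rank_two_flow
begin

lemma dissipative_forward_bounded:
  assumes "dissipative \<Phi>"
  obtains R where "\<And>t. t \<ge> 0 \<Longrightarrow> norm (\<Phi> t x) \<le> R"
proof -
  obtain S t0 where S: "bounded S" "t0 > 0" "\<And>t. t \<ge> t0 \<Longrightarrow> \<Phi> t x \<in> S"
    using assms unfolding dissipative_def by metis
  obtain R1 where R1: "\<And>y. y \<in> S \<Longrightarrow> norm y \<le> R1" using S(1) unfolding bounded_iff by blast
  obtain R2 where R2: "\<And>t. 0 \<le> t \<Longrightarrow> t \<le> t0 \<Longrightarrow> norm (\<Phi> t x) \<le> R2"
    using sol_bounded_interval[OF sol_\<Phi>] by blast
  have "norm (\<Phi> t x) \<le> max R1 R2" if "t \<ge> 0" for t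
    using R1[OF S(3)[of t]] R2[of t] that by (cases "t \<ge> t0") auto
  then show ?thesis using that by blast
qed

text \<open>Dissipativity bounds the orbit and the absence of equilibria bounds its velocity from
  below, so the sign of \<open>V\<close> is what fails. The orbit is restarted at a time when its
  velocity is in the cone, without changing the limit set. A periodic restart is split off, since
  shifts by its period have zero difference.\<close>

lemma periodic_if_not_outside_cone:
  assumes "dissipative \<Phi>" and ne: "\<And>y. y \<in> omega_limit \<Phi> x \<Longrightarrow> \<not> equilibrium \<Phi> y"
    and out: "\<And>n. x \<notin> outside_cone (real (Suc n))"
  shows "periodic_orbit \<Phi> (omega_limit \<Phi> x)"
proof -
  obtain R where R: "\<And>t. t \<ge> 0 \<Longrightarrow> norm (\<Phi> t x) \<le> R"
    using dissipative_forward_bounded[OF assms(1)] by blast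
  interpret b: bounded_orbit F DF \<Phi> q lam \<pi> C x R
    by unfold_locales (use R ne equilibrium_iff in auto)
  obtain c where c: "c > 0" "\<And>t. t \<ge> 0 \<Longrightarrow> c \<le> norm (F (\<Phi> t x))" using b.F_bounded_below by blast
  obtain n :: nat where n: "max R (1 / c) \<le> real n" using real_arch_simple by blast
  have "1 / c \<le> real (Suc n)" using n by simp
  then have "1 / real (Suc n) \<le> c" using c(1) by (simp add: field_simps)
  then have "norm (\<Phi> t x) \<le> real (Suc n) \<and> 1 / real (Suc n) \<le> norm (F (\<Phi> t x))" if "t \<ge> 0" for t
    using R[OF that] c(2)[OF that] n by auto
  then obtain t0 where t0: "t0 \<ge> 0" "V (F (\<Phi> t0 x)) < 0"
    using out[of n] unfolding outside_cone_def mem_Collect_eq not_all not_imp by (meson not_le)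
  define z where "z = \<Phi> t0 x"
  have \<Omega>: "omega_limit \<Phi> z = omega_limit \<Phi> x" by (simp add: z_def omega_limit_shift)
  have zR: "norm (\<Phi> t z) \<le> R" if "t \<ge> 0" for t
    using R[of "t + t0"] that t0(1) by (simp add: z_def \<Phi>_add)
  interpret z: bounded_orbit F DF \<Phi> q lam \<pi> C z R
    by unfold_locales (use zR ne equilibrium_iff \<Omega> in auto)
  show ?thesis
  proof (cases "\<exists>T>0. \<Phi> T z = z")
    case True
    then show ?thesis using z.periodic_omega_if_periodic \<Omega> by auto
  next
    case False
    have ap: "\<Phi> s z \<noteq> \<Phi> t z" if "s < t" for s t
    proof
      assume "\<Phi> s z = \<Phi> t z"
      then have "\<Phi> (-s) (\<Phi> s z) = \<Phi> (-s) (\<Phi> t z)" by simp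
      then have "\<Phi> (t - s) z = z" by (simp flip: \<Phi>_add)
      then show False using False that by auto
    qed
    have Fz: "F z \<noteq> 0" using t0(2) by (auto simp: z_def)
    interpret z: tangent_orbit F DF \<Phi> q lam \<pi> C z R
    proof unfold_locales
      show "V (F (\<Phi> t z)) < 0" if "t \<ge> 0" for t
        using tangent_persists[OF Fz, of 0 t] t0(2) that by (cases "t = 0") (auto simp: z_def)
      show "\<Phi> s z \<noteq> \<Phi> t z" if "s \<noteq> t" for s t using ap[of s t] ap[of t s] that by force
    qed
    show ?thesis using z.omega_periodic \<Omega> by simp
  qed
qed

end

theorem corollary5p2:
  fixes F :: "real ^ 'n \<Rightarrow> real ^ 'n"
    and \<Phi> :: "real \<Rightarrow> real ^ 'n \<Rightarrow> real ^ 'n"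
    and Q :: "real ^ 'n ^ 'n"
    and lam :: "real ^ 'n \<Rightarrow> real"
  assumes "C2_smooth F"
    and "flow_of F \<Phi>"
    and "symmetric_matrix Q"
    and "invertible Q"
    and "size {# \<mu> \<in># eigenvalues Q. \<mu> < 0 #} = 2"
    and "size {# \<mu> \<in># eigenvalues Q. \<mu> > 0 #} + 2 = CARD('n)"
    and "continuous_on UNIV lam"
    and "\<And>x. negative_definite
           (Q ** jacobian F (at x) + transpose (jacobian F (at x)) ** Q + lam x *\<^sub>R Q)"
    and "dissipative \<Phi>"
  shows "AE x in lebesgue.
           (\<forall>y \<in> omega_limit \<Phi> x. \<not> equilibrium \<Phi> y) \<longrightarrow> periodic_orbit \<Phi> (omega_limit \<Phi> x)"
proof -
  obtain DF DDF where DF: "\<And>x. (F has_derivative blinfun_apply (DF x)) (at x)"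
    and DDF: "\<And>x. (DF has_derivative blinfun_apply (DDF x)) (at x)"
    using assms(1) unfolding C2_smooth_def by blast
  obtain \<pi> :: "real ^ 'n \<Rightarrow> complex" and \<iota> :: "complex \<Rightarrow> real ^ 'n" and C :: real
    where split: "linear \<pi>" "linear \<iota>" "C > 0" "\<And>w. w \<bullet> (Q *v w) \<le> 0 \<Longrightarrow> norm w \<le> C * norm (\<pi> w)"
      "\<And>u. \<iota> u \<bullet> (Q *v \<iota> u) = - (norm u)\<^sup>2"
    using rank_two_splitting[OF assms(3,5,6)] by blast
  \<comment> \<open>\<open>jacobian\<close> is defined through a choice of derivative; uniqueness
    identifies it with \<open>DF x\<close>.\<close>
  have jac: "jacobian F (at x) *v v = DF x v" for x v
  proof -
    have "F differentiable (at x)" using DF differentiable_def by blast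
    then have "(F has_derivative (\<lambda>h. jacobian F (at x) *v h)) (at x)" by (simp add: jacobian_works)
    from has_derivative_unique[OF this DF] show ?thesis by (rule fun_cong)
  qed
  interpret rank_two_flow F DF \<Phi> "\<lambda>v. Q *v v" lam \<pi> C
  proof (rule rank_two_flow.intro)
    show "continuous_on UNIV DF"
      using DDF has_derivative_continuous continuous_at_imp_continuous_on by blast
    show "linear ((*v) Q)" by (rule matrix_vector_mul_linear)
    show "(Q *v x) \<bullet> y = x \<bullet> (Q *v y)" for x y
      using assms(3) by (metis dot_lmul_matrix inner_commute symmetric_matrix_def transpose_matrix_vector)
    show "2 * ((Q *v v) \<bullet> DF x v) + lam x * (v \<bullet> (Q *v v)) < 0" if "v \<noteq> 0" for x v
      using assms(8)[of x] that unfolding negative_definite_def matrix_form_expand[OF assms(3)] jac by blast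
  qed (use DF assms split in auto)
  \<comment> \<open>Countably many sets suffice, because the bounds in \<open>outside_cone\<close>
    may be enlarged to an integer.\<close>
  define N where "N = (\<Union>n. outside_cone (real (Suc n)))"
  have "negligible (outside_cone (real (Suc n)))" for n
    using split(2,5) by (intro negligible_outside_cone) (auto simp: V_def)
  then have "negligible N" unfolding N_def by (intro negligible_countable_Union) auto
  then have "N \<in> null_sets lebesgue" by (simp add: negligible_iff_null_sets)
  then show ?thesis
  proof (rule AE_I')
    have "x \<in> N" if "\<forall>y \<in> omega_limit \<Phi> x. \<not> equilibrium \<Phi> y" "\<not> periodic_orbit \<Phi> (omega_limit \<Phi> x)" for x
    proof (rule ccontr)
      assume "x \<notin> N"
      then have "x \<notin> outside_cone (real (Suc n))" for n unfolding N_def by blast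
      then show False using periodic_if_not_outside_cone[OF assms(9), of x] that by blast
    qed
    then show "{x \<in> space lebesgue. \<not> ((\<forall>y \<in> omega_limit \<Phi> x. \<not> equilibrium \<Phi> y) \<longrightarrow> periodic_orbit \<Phi> (omega_limit \<Phi> x))} \<subseteq> N"
      by blast
  qed
qed

end
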